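(* Let $n\ge2$ and let $\Sigma$ be a connected, embedded and closed hypersurface in $H_n$ with constant $p$-mean curvature $H=c>0$. If, moreover, $\Sigma$ is umbilic, then, after a Heisenberg rigid motion, $\Sigma$ is a Pansu sphere.
   Context: The Heisenberg group $H_n$ is $\mathbb R^{2n+1}$ with coordinates $(x_1,\dots,x_n,y_1,\dots,y_n,t)$, $z=(x_1+iy_1,\dots,x_n+iy_n)$, group law $(x,y,t)\circ(x',y',t')=(x+x',y+y',t+t'+\sum_j(y_jx_j'-x_jy_j'))$, contact form $\Theta=dt+\sum_{j}(x_jdy_j-y_jdx_j)$, contact bundle $\xi=\ker\Theta$, and left-invariant fields $\mathring e_\beta=\partial_{x_\beta}+y_\beta\partial_t$, $\mathring e_{n+\beta}=\partial_{y_\beta}-x_\beta\partial_t$, $T=\partial_t$. $J\mathring e_\beta=\mathring e_{n+\beta}$, $J\mathring e_{n+\beta}=-\mathring e_\beta$; the Levi metric $G$ on $\xi$ makes $\mathring e_1,\dots,\mathring e_{2n}$ orthonormal; $\nabla$ is the flat connection for which all $\mathring e_a$ and $T$ are parallel. Heisenberg rigid motions are the elements of $PSH(n)$, generated by left translations and the maps $(z,t)\mapsto(Az,t)$, $A\in U(n)$. Hypersurfaces are $C^2$, and $C^\infty$ near regular points; "closed" means compact without boundary. A point $p\in\Sigma$ is singular if $\xi=T\Sigma$ at $p$, otherwise regular. At regular points let $\xi'=(\xi\cap T\Sigma)\cap J(\xi\cap T\Sigma)$, let $e_n\in\xi\cap T\Sigma$ be a unit vector $G$-orthogonal to $\xi'$,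 and $e_{2n}=Je_n$ (horizontal normal). Define $\alpha$ by $\alpha e_{2n}+T\in T\Sigma$ and $J'$ on $\xi\cap T\Sigma$ by $J'=J$ on $\xi'$, $J'e_n=0$. The shape operator is $\mathfrak S(v)=-\nabla_ve_{2n}+\alpha J'v$, a symmetric operator on $\xi\cap T\Sigma$. A regular point is umbilic if $\mathfrak S(\xi')\subset\xi'$ and all eigenvalues of $\mathfrak S|_{\xi'}$ equal a common value $k$; then $\mathfrak S(e_n)=le_n$ for some real $l$, and the $p$-mean curvature is $H=l+(2n-2)k$. $\Sigma$ is umbilic if all its regular points are umbilic; $H=c$ is required at all regular points. For $\lambda>0$ the Pansu sphere $S_\lambda$ is the union of the graphs $t=g(z)$ and $t=-g(z)$, where $g(z)=\frac{1}{2\lambda^2}\left(\lambda|z|\sqrt{1-\lambda^2|z|^2}+\cos^{-1}(\lambda|z|)\right)$, $|z|\le 1/\lambda$. *)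

theory Defs
  imports "HOL-Analysis.Analysis"
begin

text \<open>
  A point of the Heisenberg group is a pair \<open>(z, t)\<close> with \<open>z $ \<beta> = x\<^sub>\<beta> + \<i> y\<^sub>\<beta>\<close>.  Every tangent space
  is identified with the ambient vector space.  The group law is the one with contact form
  \<open>dt + (\<Sum>\<beta>. x\<^sub>\<beta> dy\<^sub>\<beta> - y\<^sub>\<beta> dx\<^sub>\<beta>)\<close>.
\<close>

type_synonym 'n heis = "(complex, 'n) vec \<times> real"

definition heis_mult :: "'n::finite heis \<Rightarrow> 'n heis \<Rightarrow> 'n heis" where
  "heis_mult p q =
     (fst p + fst q,
      snd p + snd q + (\<Sum>\<beta>\<in>UNIV. Im (fst p $ \<beta>) * Re (fst q $ \<beta>) - Re (fst p $ \<beta>) * Im (fst q $ \<beta>)))"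

definition contact_form :: "'n::finite heis \<Rightarrow> 'n heis \<Rightarrow> real" where
  "contact_form p v =
     snd v + (\<Sum>\<beta>\<in>UNIV. Re (fst p $ \<beta>) * Im (fst v $ \<beta>) - Im (fst p $ \<beta>) * Re (fst v $ \<beta>))"

definition contact_plane :: "'n::finite heis \<Rightarrow> 'n heis set" where
  "contact_plane p = {v. contact_form p v = 0}"

definition frame_x :: "'n::finite \<Rightarrow> 'n heis \<Rightarrow> 'n heis" where
  "frame_x \<beta> p = (axis \<beta> 1, Im (fst p $ \<beta>))"

definition frame_y :: "'n::finite \<Rightarrow> 'n heis \<Rightarrow> 'n heis" where
  "frame_y \<beta> p = (axis \<beta> \<i>, - Re (fst p $ \<beta>))"

definition frame_t :: "'n::finite heis" where
  "frame_t = (0, 1)"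

text \<open>
  A vector \<open>v\<close> in the contact plane at \<open>p\<close> equals
  \<open>(\<Sum>\<beta>. Re (fst v $ \<beta>) *\<^sub>R frame_x \<beta> p + Im (fst v $ \<beta>) *\<^sub>R frame_y \<beta> p)\<close>.
  The next three definitions are meant for such vectors only.
\<close>

definition J :: "'n::finite heis \<Rightarrow> 'n heis \<Rightarrow> 'n heis" where
  "J p v = (\<Sum>\<beta>\<in>UNIV. Re (fst v $ \<beta>) *\<^sub>R frame_y \<beta> p - Im (fst v $ \<beta>) *\<^sub>R frame_x \<beta> p)"

definition levi :: "'n::finite heis \<Rightarrow> 'n heis \<Rightarrow> real" where
  "levi v w = (\<Sum>\<beta>\<in>UNIV. Re (fst v $ \<beta>) * Re (fst w $ \<beta>) + Im (fst v $ \<beta>) * Im (fst w $ \<beta>))"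

text \<open>
  Covariant derivative at \<open>p\<close>, in a direction \<open>v\<close> tangent to \<open>S\<close>, of a horizontal field \<open>V\<close> along \<open>S\<close>:
  the frame is parallel, so the coefficients are differentiated.  The derivative is taken within \<open>S\<close>,
  which determines it on the tangent space of \<open>S\<close>.
\<close>
definition cov_deriv ::
    "'n::finite heis set \<Rightarrow> 'n heis \<Rightarrow> 'n heis \<Rightarrow> ('n heis \<Rightarrow> 'n heis) \<Rightarrow> 'n heis" where
  "cov_deriv S p v V =
     (let w = frechet_derivative (\<lambda>q. fst (V q)) (at p within S) v
      in \<Sum>\<beta>\<in>UNIV. Re (w $ \<beta>) *\<^sub>R frame_x \<beta> p + Im (w $ \<beta>) *\<^sub>R frame_y \<beta> p)"

inductive_set rigid_motions :: "('n::finite heis \<Rightarrow> 'n heis) set" where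
  translation: "heis_mult p \<in> rigid_motions"
| unitary: "(\<chi> i j. cnj (A $ j $ i)) ** A = mat 1 \<Longrightarrow> (\<lambda>(z, t). (A *v z, t)) \<in> rigid_motions"
| composition: "f \<in> rigid_motions \<Longrightarrow> g \<in> rigid_motions \<Longrightarrow> f \<circ> g \<in> rigid_motions"

text \<open>Meant for open \<open>U\<close> in a finite-dimensional space.\<close>
primrec times_cont_diff :: "nat \<Rightarrow> ('a::euclidean_space \<Rightarrow> real) \<Rightarrow> 'a set \<Rightarrow> bool" where
  "times_cont_diff 0 f U \<longleftrightarrow> continuous_on U f"
| "times_cont_diff (Suc m) f U \<longleftrightarrow>
     (\<exists>D. (\<forall>x\<in>U. (f has_derivative D x) (at x)) \<and> (\<forall>v. times_cont_diff m (\<lambda>x. D x v) U))"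

definition C_on :: "enat \<Rightarrow> ('a::euclidean_space \<Rightarrow> real) \<Rightarrow> 'a set \<Rightarrow> bool" where
  "C_on k f U \<longleftrightarrow> (\<forall>m. enat m \<le> k \<longrightarrow> times_cont_diff m f U)"

text \<open>Near \<open>p\<close>, \<open>S\<close> is an embedded hypersurface without boundary, of class \<open>C\<^sup>k\<close> (for \<open>k \<ge> 1\<close>).\<close>
definition hypersurface_at :: "enat \<Rightarrow> 'a::euclidean_space set \<Rightarrow> 'a \<Rightarrow> bool" where
  "hypersurface_at k S p \<longleftrightarrow>
     (\<exists>U f D. open U \<and> p \<in> U \<and> C_on k f U \<and> S \<inter> U = {q \<in> U. f q = 0} \<and>
        (f has_derivative D) (at p) \<and> D \<noteq> (\<lambda>v. 0))"

definition tangent_space :: "'a::euclidean_space set \<Rightarrow> 'a \<Rightarrow> 'a set" where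
  "tangent_space S p =
     {v. \<exists>\<gamma> \<epsilon>. \<epsilon> > 0 \<and> \<gamma> ` {-\<epsilon><..<\<epsilon>} \<subseteq> S \<and> \<gamma> 0 = p \<and> (\<gamma> has_vector_derivative v) (at (0::real))}"

definition regular_points :: "'n::finite heis set \<Rightarrow> 'n heis set" where
  "regular_points S = {p \<in> S. contact_plane p \<noteq> tangent_space S p}"

definition closed_embedded_hypersurface :: "'n::finite heis set \<Rightarrow> bool" where
  "closed_embedded_hypersurface S \<longleftrightarrow>
     S \<noteq> {} \<and> compact S \<and> (\<forall>p\<in>S. hypersurface_at 2 S p) \<and>
     (\<forall>p\<in>regular_points S. hypersurface_at \<infinity> S p)"

definition horizontal_tangent :: "'n::finite heis set \<Rightarrow> 'n heis \<Rightarrow> 'n heis set" where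
  "horizontal_tangent S p = contact_plane p \<inter> tangent_space S p"

definition xi' :: "'n::finite heis set \<Rightarrow> 'n heis \<Rightarrow> 'n heis set" where
  "xi' S p = horizontal_tangent S p \<inter> J p ` horizontal_tangent S p"

text \<open>
  \<open>e\<close> plays the role of the field \<open>e\<^sub>n\<close>.  At each regular point \<open>e\<^sub>n\<close> is determined up to sign; a continuous
  choice over the regular points fixes the signs of \<open>e\<^sub>2\<^sub>n\<close>, of the shape operator and of the
  \<open>p\<close>-mean curvature.
\<close>
definition characteristic_field :: "'n::finite heis set \<Rightarrow> ('n heis \<Rightarrow> 'n heis) \<Rightarrow> bool" where
  "characteristic_field S e \<longleftrightarrow>
     continuous_on (regular_points S) e \<and>
     (\<forall>p\<in>regular_points S.
        e p \<in> horizontal_tangent S p \<and> levi (e p) (e p) = 1 \<and> (\<forall>v\<in>xi' S p. levi (e p) v = 0))"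

definition horizontal_normal :: "('n::finite heis \<Rightarrow> 'n heis) \<Rightarrow> 'n heis \<Rightarrow> 'n heis" where
  "horizontal_normal e p = J p (e p)"

definition alpha :: "'n::finite heis set \<Rightarrow> ('n heis \<Rightarrow> 'n heis) \<Rightarrow> 'n heis \<Rightarrow> real" where
  "alpha S e p = (THE a. a *\<^sub>R horizontal_normal e p + frame_t \<in> tangent_space S p)"

text \<open>The linear map equal to \<open>J\<close> on \<open>xi' S p\<close> and to \<open>0\<close> on \<open>e p\<close>.\<close>
definition J' :: "('n::finite heis \<Rightarrow> 'n heis) \<Rightarrow> 'n heis \<Rightarrow> 'n heis \<Rightarrow> 'n heis" where
  "J' e p v = J p (v - levi v (e p) *\<^sub>R e p)"

definition shape_op :: "'n::finite heis set \<Rightarrow> ('n heis \<Rightarrow> 'n heis) \<Rightarrow> 'n heis \<Rightarrow> 'n heis \<Rightarrow> 'n heis" where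
  "shape_op S e p v = - cov_deriv S p v (horizontal_normal e) + alpha S e p *\<^sub>R J' e p v"

definition xi'_eigenvalue :: "'n::finite heis set \<Rightarrow> ('n heis \<Rightarrow> 'n heis) \<Rightarrow> 'n heis \<Rightarrow> real \<Rightarrow> bool" where
  "xi'_eigenvalue S e p \<mu> \<longleftrightarrow> (\<exists>v\<in>xi' S p. v \<noteq> 0 \<and> shape_op S e p v = \<mu> *\<^sub>R v)"

definition umbilic_at :: "'n::finite heis set \<Rightarrow> ('n heis \<Rightarrow> 'n heis) \<Rightarrow> 'n heis \<Rightarrow> bool" where
  "umbilic_at S e p \<longleftrightarrow>
     shape_op S e p ` xi' S p \<subseteq> xi' S p \<and> (\<exists>k. \<forall>\<mu>. xi'_eigenvalue S e p \<mu> \<longrightarrow> \<mu> = k)"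

definition umbilic :: "'n::finite heis set \<Rightarrow> ('n heis \<Rightarrow> 'n heis) \<Rightarrow> bool" where
  "umbilic S e \<longleftrightarrow> (\<forall>p\<in>regular_points S. umbilic_at S e p)"

text \<open>
  The formula for the \<open>p\<close>-mean curvature at an umbilic point (for \<open>n \<ge> 2\<close>), where \<open>k\<close> and \<open>l\<close> are uniquely
  determined.
\<close>
definition has_p_mean_curvature ::
    "'n::finite heis set \<Rightarrow> ('n heis \<Rightarrow> 'n heis) \<Rightarrow> 'n heis \<Rightarrow> real \<Rightarrow> bool" where
  "has_p_mean_curvature S e p H \<longleftrightarrow>
     (\<exists>k l. xi'_eigenvalue S e p k \<and> shape_op S e p (e p) = l *\<^sub>R e p \<and>
            H = l + (2 * real CARD('n) - 2) * k)"

definition pansu_profile :: "real \<Rightarrow> (complex, 'n::finite) vec \<Rightarrow> real" where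
  "pansu_profile lam z =
     1 / (2 * lam\<^sup>2) * (lam * norm z * sqrt (1 - lam\<^sup>2 * (norm z)\<^sup>2) + arccos (lam * norm z))"

definition pansu_sphere :: "real \<Rightarrow> 'n::finite heis set" where
  "pansu_sphere lam =
     {(z, t). norm z \<le> 1 / lam \<and> (t = pansu_profile lam z \<or> t = - pansu_profile lam z)}"

end

theory Submission
  imports Defs "HOL-Real_Asymp.Real_Asymp"
begin

text \<open>
  Write \<open>\<nu>\<close> for the horizontal normal, viewed as a map to \<open>\<complex>\<^sup>n\<close>, and \<open>\<kappa> = k - \<i>\<alpha>\<close>.  Umbilicity says
  \<open>\<nabla>\<^sub>X \<nu> = - \<kappa> X\<close> on \<open>\<xi>'\<close> and \<open>\<nabla> \<nu> = - l e\<^sub>n\<close> along \<open>e\<^sub>n\<close>.  The Codazzi equations then show that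
  \<open>k\<close> and \<open>\<alpha>\<close> are constant in all tangent directions but \<open>e\<^sub>n\<close>, along which they satisfy an ODE; the
  point \<open>F = z + \<nu> / \<kappa>\<close> is locally constant, and so is the ratio of \<open>\<bar>\<kappa>\<bar>\<^sup>2\<^sup>n\<close> and \<open>\<delta> = c - 2nk\<close>.

  If \<open>\<delta> \<noteq> 0\<close> somewhere, this first integral bounds \<open>\<alpha>\<close>.  As \<open>\<alpha>\<close> blows up at singular points, the surface
  is then regular everywhere, and an explicit function that is strictly monotone along the characteristic
  curves contradicts compactness.  Hence \<open>k = c / (2n)\<close>, and integrating the ODE puts every regular point
  on a Pansu sphere with locally constant centre.  The regular points with a given centre are mapped
  by \<open>(\<nu>, \<alpha>)\<close> to an open and closed subset of \<open>S\<^sup>2\<^sup>n\<^sup>-\<^sup>1 \<times> \<real>\<close>, so the surface contains the whole sphere; near a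
  pole both are graphs over the same disc, so the sphere is also open in the surface.
\<close>

section \<open>Smooth functions\<close>

text \<open>The tangent space is spanned by \<open>\<xi>'\<close>, the characteristic direction and
  one more vector, and that last one is reached by brackets of fields in \<open>\<xi>'\<close>. So
  what is constant along \<open>\<xi>'\<close> is constant along it too. Nonzero vectors of
  \<open>\<xi>'\<close> exist because n is at least 2. The obstacle is global. Derivatives are taken
  at regular points only, and these might fall into several components, while connectedness is given
  for the whole surface. Each conclusion is therefore drawn from a level set shown to be open and
  closed. Closedness is the hard half, since a limit of regular points could be singular; a bound on
  \<open>\<alpha>\<close> excludes this. At the poles that control is lost, hence the separate
  comparison of graphs there. No integral curve of the characteristic field is constructed: at a
  maximum of a suitable function on the compact surface, a curve with the right velocity at one
  point is enough.\<close>

lemma times_cont_diff_cong: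
  assumes "open U" "\<And>x. x \<in> U \<Longrightarrow> f x = g x" "times_cont_diff m f U"
  shows "times_cont_diff m g U"
proof (cases m)
  case 0
  then show ?thesis using assms by (auto cong: continuous_on_cong)
next
  case (Suc m')
  then obtain D where D: "\<forall>x\<in>U. (f has_derivative D x) (at x)" "\<forall>v. times_cont_diff m' (\<lambda>x. D x v) U"
    using assms by auto
  have "\<forall>x\<in>U. (g has_derivative D x) (at x)"
    using has_derivative_transform_within_open[OF _ assms(1)] D(1) assms(2) by blast
  with D(2) Suc show ?thesis by auto
qed

lemma times_cont_diff_SucE:
  assumes "times_cont_diff (Suc m) f U"
  obtains D where "\<And>x. x \<in> U \<Longrightarrow> (f has_derivative D x) (at x)"
    "\<And>v. times_cont_diff m (\<lambda>x. D x v) U"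
  using assms by auto

lemma times_cont_diff_SucI:
  assumes "\<And>x. x \<in> U \<Longrightarrow> (f has_derivative D x) (at x)"
    "\<And>v. times_cont_diff m (\<lambda>x. D x v) U"
  shows "times_cont_diff (Suc m) f U"
  using assms by auto

lemma times_cont_diff_subset:
  assumes "V \<subseteq> U" "times_cont_diff m f U"
  shows "times_cont_diff m f V"
  using assms(2)
proof (induction m arbitrary: f)
  case 0
  then show ?case using assms(1) by (auto intro: continuous_on_subset)
next
  case (Suc m)
  from Suc.prems obtain D where D: "\<And>x. x \<in> U \<Longrightarrow> (f has_derivative D x) (at x)"
    "\<And>v. times_cont_diff m (\<lambda>x. D x v) U"
    by (rule times_cont_diff_SucE) blast
  show ?case
    by (rule times_cont_diff_SucI[where D = D]) (use D assms(1) Suc.IH in auto)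
qed

lemma times_cont_diff_Suc_imp:
  assumes "times_cont_diff (Suc m) f U"
  shows "times_cont_diff m f U"
  using assms
proof (induction m arbitrary: f)
  case 0
  then obtain D where "\<And>x. x \<in> U \<Longrightarrow> (f has_derivative D x) (at x)" by auto
  then have "\<forall>x\<in>U. isCont f x" using has_derivative_continuous by blast
  then show ?case using continuous_at_imp_continuous_on[of U f] by simp
next
  case (Suc m)
  from Suc.prems obtain D where D: "\<And>x. x \<in> U \<Longrightarrow> (f has_derivative D x) (at x)"
    "\<And>v. times_cont_diff (Suc m) (\<lambda>x. D x v) U"
    by (rule times_cont_diff_SucE) blast
  show ?case
    by (rule times_cont_diff_SucI[where D = D]) (use D Suc.IH in blast)+
qed

lemma times_cont_diff_const: "times_cont_diff m (\<lambda>x. c) U"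
proof (induction m arbitrary: c)
  case (Suc m)
  then show ?case
    by (simp, intro exI[of _ "\<lambda>x v. 0"]) auto
qed simp

lemma times_cont_diff_add:
  assumes "times_cont_diff m f U" "times_cont_diff m g U"
  shows "times_cont_diff m (\<lambda>x. f x + g x) U"
  using assms
proof (induction m arbitrary: f g)
  case 0
  then show ?case by (auto intro: continuous_intros)
next
  case (Suc m)
  then obtain Df Dg where "\<forall>x\<in>U. (f has_derivative Df x) (at x)" "\<forall>v. times_cont_diff m (\<lambda>x. Df x v) U"
     "\<forall>x\<in>U. (g has_derivative Dg x) (at x)" "\<forall>v. times_cont_diff m (\<lambda>x. Dg x v) U"
    by auto
  then show ?case using Suc.IH
    by (simp, intro exI[of _ "\<lambda>x v. Df x v + Dg x v"]) (auto intro: has_derivative_add)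
qed

lemma times_cont_diff_mult:
  assumes "times_cont_diff m f U" "times_cont_diff m g U"
  shows "times_cont_diff m (\<lambda>x. f x * g x) U"
  using assms
proof (induction m arbitrary: f g)
  case 0
  then show ?case by (auto intro: continuous_intros)
next
  case (Suc m)
  then obtain Df Dg where D: "\<forall>x\<in>U. (f has_derivative Df x) (at x)" "\<forall>v. times_cont_diff m (\<lambda>x. Df x v) U"
     "\<forall>x\<in>U. (g has_derivative Dg x) (at x)" "\<forall>v. times_cont_diff m (\<lambda>x. Dg x v) U"
    by auto
  have "times_cont_diff m f U" "times_cont_diff m g U"
    using Suc.prems times_cont_diff_Suc_imp by blast+
  then show ?case using Suc.IH D
    by (simp, intro exI[of _ "\<lambda>x v. f x * Dg x v + Df x v * g x"])
       (auto intro: has_derivative_mult times_cont_diff_add)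
qed

lemma times_cont_diff_powr:
  assumes "times_cont_diff m g U" "\<And>x. x \<in> U \<Longrightarrow> g x > 0"
  shows "times_cont_diff m (\<lambda>x. g x powr a) U"
  using assms(1)
proof (induction m arbitrary: a)
  case 0
  then show ?case using assms(2) by (fastforce intro!: continuous_intros)
next
  case (Suc m)
  then obtain D where D: "\<forall>x\<in>U. (g has_derivative D x) (at x)" "\<forall>v. times_cont_diff m (\<lambda>x. D x v) U"
    by auto
  have g: "times_cont_diff m g U" using Suc.prems times_cont_diff_Suc_imp by blast
  have "((\<lambda>x. g x powr a) has_derivative (\<lambda>v. a * (g x powr (a - 1) * D x v))) (at x)" if "x \<in> U" for x
    using that D(1) assms(2)[OF that]
    by (auto intro!: derivative_eq_intros simp: powr_diff fun_eq_iff field_simps)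
  moreover have "times_cont_diff m (\<lambda>x. a * (g x powr (a - 1) * D x v)) U" for v
    by (intro times_cont_diff_mult times_cont_diff_const Suc.IH g D(2)[rule_format])
  ultimately show ?case
    unfolding times_cont_diff.simps by (intro exI[of _ "\<lambda>x v. a * (g x powr (a - 1) * D x v)"]) blast
qed

lemma times_cont_diff_linear:
  assumes "bounded_linear h"
  shows "times_cont_diff m h U"
proof (cases m)
  case 0
  then show ?thesis using assms by (simp add: linear_continuous_on)
next
  case (Suc m')
  then show ?thesis
    using assms bounded_linear_imp_has_derivative times_cont_diff_const
    by (simp, intro exI[of _ "\<lambda>x. h"]) blast
qed

definition smooth :: "'a::euclidean_space set \<Rightarrow> ('a \<Rightarrow> 'b::euclidean_space) \<Rightarrow> bool" where
  "smooth U G \<longleftrightarrow> (\<forall>b\<in>Basis. C_on \<infinity> (\<lambda>x. G x \<bullet> b) U)"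

lemma smooth_real_iff: "smooth U (g :: 'a::euclidean_space \<Rightarrow> real) \<longleftrightarrow> (\<forall>m. times_cont_diff m g U)"
  by (simp add: smooth_def C_on_def)

lemma smooth_componentwise_iff: "smooth U G \<longleftrightarrow> (\<forall>b\<in>Basis. smooth U (\<lambda>x. G x \<bullet> b))"
  unfolding smooth_real_iff by (simp add: smooth_def C_on_def)

lemma smooth_cong:
  assumes "open U" "\<And>x. x \<in> U \<Longrightarrow> f x = g x" "smooth U f"
  shows "smooth U g"
proof -
  have "C_on \<infinity> (\<lambda>x. g x \<bullet> b) U" if "b \<in> Basis" for b
    using assms that times_cont_diff_cong[OF assms(1), of "\<lambda>x. f x \<bullet> b" "\<lambda>x. g x \<bullet> b"]
    unfolding smooth_def C_on_def by auto
  then show ?thesis by (simp add: smooth_def)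
qed

lemma smooth_subset: "V \<subseteq> U \<Longrightarrow> smooth U f \<Longrightarrow> smooth V f"
  unfolding smooth_def C_on_def using times_cont_diff_subset by blast

lemma smooth_const: "smooth U (\<lambda>x. c)"
  by (simp add: smooth_def C_on_def times_cont_diff_const)

lemma smooth_add: "smooth U f \<Longrightarrow> smooth U g \<Longrightarrow> smooth U (\<lambda>x. f x + g x)"
  by (simp add: smooth_def C_on_def inner_add_left times_cont_diff_add)

lemma smooth_mult: "smooth U f \<Longrightarrow> smooth U g \<Longrightarrow> smooth U (\<lambda>x. f x * g x :: real)"
  by (simp add: smooth_real_iff times_cont_diff_mult)

lemma smooth_powr: "smooth U f \<Longrightarrow> (\<And>x. x \<in> U \<Longrightarrow> f x > 0) \<Longrightarrow> smooth U (\<lambda>x. f x powr a :: real)"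
  by (simp add: smooth_real_iff times_cont_diff_powr)

lemma smooth_scaleR:
  "smooth U f \<Longrightarrow> smooth U g \<Longrightarrow> smooth U (\<lambda>x. f x *\<^sub>R g x)"
  by (simp add: smooth_componentwise_iff[of U "\<lambda>x. f x *\<^sub>R g x"] smooth_componentwise_iff[of U g] smooth_mult)

lemma smooth_sum: "finite I \<Longrightarrow> (\<And>i. i \<in> I \<Longrightarrow> smooth U (f i)) \<Longrightarrow> smooth U (\<lambda>x. \<Sum>i\<in>I. f i x)"
  by (induction I rule: finite_induct) (auto intro: smooth_const smooth_add)

lemma smooth_linear: "bounded_linear h \<Longrightarrow> smooth U h"
  unfolding smooth_def C_on_def
  by (auto intro!: times_cont_diff_linear bounded_linear_compose[OF bounded_linear_inner_left])

lemma smooth_linear_compose: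
  assumes "bounded_linear h" "smooth U f"
  shows "smooth U (\<lambda>x. h (f x))"
proof -
  have h: "h y = (\<Sum>b\<in>Basis. (y \<bullet> b) *\<^sub>R h b)" for y
    using linear_sum[OF bounded_linear.linear[OF assms(1)], of "\<lambda>b. (y \<bullet> b) *\<^sub>R b" Basis]
      linear_cmul[OF bounded_linear.linear[OF assms(1)]] by (simp add: euclidean_representation)
  show ?thesis
    by (subst h) (use assms(2) in \<open>auto intro!: smooth_sum smooth_scaleR smooth_const simp: smooth_componentwise_iff[of U f]\<close>)
qed

lemma smooth_inner:
  assumes "smooth U f" "smooth U g"
  shows "smooth U (\<lambda>x. f x \<bullet> g x)"
proof -
  have "smooth U (\<lambda>x. \<Sum>b\<in>Basis. (f x \<bullet> b) * (g x \<bullet> b))"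
    using assms by (auto intro!: smooth_sum smooth_mult simp: smooth_componentwise_iff[of U f] smooth_componentwise_iff[of U g])
  then show ?thesis by (subst euclidean_inner)
qed

lemma smooth_real_D:
  fixes g :: "'a::euclidean_space \<Rightarrow> real"
  assumes "open U" "smooth U g"
  shows "x \<in> U \<Longrightarrow> (g has_derivative frechet_derivative g (at x)) (at x)"
    and "smooth U (\<lambda>x. frechet_derivative g (at x) v)"
proof -
  have ex: "\<exists>D. (\<forall>x\<in>U. (g has_derivative D x) (at x)) \<and> (\<forall>v. times_cont_diff m (\<lambda>x. D x v) U)" for m
    using assms(2) unfolding smooth_real_iff by (metis times_cont_diff.simps(2))
  show 1: "(g has_derivative frechet_derivative g (at x)) (at x)" if x: "x \<in> U" for x
  proof -
    obtain D where "\<forall>x\<in>U. (g has_derivative D x) (at x)" using ex[of 0] by auto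
    then have "g differentiable (at x)" using x unfolding differentiable_def by blast
    then show ?thesis by (simp add: frechet_derivative_works)
  qed
  show "smooth U (\<lambda>x. frechet_derivative g (at x) v)"
    unfolding smooth_real_iff
  proof
    fix m
    obtain D where D: "\<And>x. x \<in> U \<Longrightarrow> (g has_derivative D x) (at x)"
       "\<And>v. times_cont_diff m (\<lambda>x. D x v) U"
      using assms(2)[unfolded smooth_real_iff, THEN spec[of _ "Suc m"]] by (rule times_cont_diff_SucE) blast
    have "D x v = frechet_derivative g (at x) v" if "x \<in> U" for x
      using frechet_derivative_at[OF D(1)[OF that]] by simp
    then show "times_cont_diff m (\<lambda>x. frechet_derivative g (at x) v) U"
      by (rule times_cont_diff_cong[OF assms(1) _ D(2)])
  qed
qed

lemma smooth_has_derivative: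
  assumes "open U" "smooth U G" "x \<in> U"
  shows "(G has_derivative frechet_derivative G (at x)) (at x)"
proof -
  have "((\<lambda>x. G x \<bullet> b) has_derivative frechet_derivative (\<lambda>x. G x \<bullet> b) (at x)) (at x)" if "b \<in> Basis" for b
    using smooth_real_D(1)[OF assms(1) _ assms(3)] assms(2) that smooth_componentwise_iff by blast
  then have "G differentiable (at x)"
    unfolding differentiable_componentwise_within differentiable_def[of "\<lambda>x. G x \<bullet> _"] by blast
  then show ?thesis by (simp add: frechet_derivative_works)
qed

lemma frechet_derivative_inner:
  assumes "G differentiable (at x)"
  shows "frechet_derivative (\<lambda>x. G x \<bullet> b) (at x) v = frechet_derivative G (at x) v \<bullet> b"
proof -
  have "((\<lambda>x. G x \<bullet> b) has_derivative (\<lambda>v. frechet_derivative G (at x) v \<bullet> b)) (at x)"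
    using assms by (auto intro!: has_derivative_inner_left simp: frechet_derivative_works)
  from frechet_derivative_at[OF this] show ?thesis by metis
qed

lemma smooth_differentiable: "open U \<Longrightarrow> smooth U G \<Longrightarrow> x \<in> U \<Longrightarrow> G differentiable (at x)"
  using smooth_has_derivative by (auto simp: differentiable_def)

lemma smooth_deriv:
  assumes "open U" "smooth U G"
  shows "smooth U (\<lambda>x. frechet_derivative G (at x) v)"
proof -
  have "smooth U (\<lambda>x. frechet_derivative G (at x) v \<bullet> b)" if "b \<in> Basis" for b
  proof (rule smooth_cong[OF assms(1)])
    show "smooth U (\<lambda>x. frechet_derivative (\<lambda>x. G x \<bullet> b) (at x) v)"
      using smooth_real_D(2)[OF assms(1)] assms(2) that smooth_componentwise_iff by blast
    show "\<And>x. x \<in> U \<Longrightarrow> frechet_derivative (\<lambda>x. G x \<bullet> b) (at x) v = frechet_derivative G (at x) v \<bullet> b"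
      using frechet_derivative_inner smooth_differentiable[OF assms] by blast
  qed
  then show ?thesis using smooth_componentwise_iff by blast
qed

lemma smooth_continuous_on: "open U \<Longrightarrow> smooth U G \<Longrightarrow> continuous_on U G"
  by (meson continuous_at_imp_continuous_on differentiable_imp_continuous_within smooth_differentiable)

section \<open>Symmetry of second derivatives\<close>

lemma second_difference_mvt:
  fixes g :: "'a::euclidean_space \<Rightarrow> real"
  assumes "open U" "smooth U g" "0 < h"
    and sub: "\<And>s r. 0 \<le> s \<Longrightarrow> s \<le> h \<Longrightarrow> 0 \<le> r \<Longrightarrow> r \<le> h \<Longrightarrow> x + s *\<^sub>R v + r *\<^sub>R w \<in> U"
  shows "\<exists>s r. 0 < s \<and> s < h \<and> 0 < r \<and> r < h \<and>
    g (x + h *\<^sub>R v + h *\<^sub>R w) - g (x + h *\<^sub>R v) - g (x + h *\<^sub>R w) + g x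
      = h\<^sup>2 * frechet_derivative (\<lambda>y. frechet_derivative g (at y) v) (at (x + s *\<^sub>R v + r *\<^sub>R w)) w"
proof -
  define gv where "gv y = frechet_derivative g (at y) v" for y
  have gv: "smooth U gv" unfolding gv_def using smooth_deriv assms by blast
  define \<phi> where "\<phi> s = g (x + s *\<^sub>R v + h *\<^sub>R w) - g (x + s *\<^sub>R v)" for s
  have d1: "((\<lambda>s. g (x + s *\<^sub>R v + r *\<^sub>R w)) has_derivative
     (\<lambda>t. t * gv (x + s *\<^sub>R v + r *\<^sub>R w))) (at s)"
    if "0 \<le> s" "s \<le> h" "0 \<le> r" "r \<le> h" for s r
  proof -
    have D: "(g has_derivative frechet_derivative g (at (x + s *\<^sub>R v + r *\<^sub>R w))) (at (x + s *\<^sub>R v + r *\<^sub>R w))"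
      using smooth_has_derivative[OF assms(1,2)] sub that by blast
    have "((\<lambda>s. x + s *\<^sub>R v + r *\<^sub>R w) has_derivative (\<lambda>t. t *\<^sub>R v)) (at s)"
      by (auto intro!: derivative_eq_intros)
    from has_derivative_compose[OF this D] show ?thesis
      using linear_cmul[OF has_derivative_linear[OF D]] by (simp add: gv_def)
  qed
  have "(\<phi> has_derivative (\<lambda>t. t * (gv (x + s *\<^sub>R v + h *\<^sub>R w) - gv (x + s *\<^sub>R v)))) (at s within {0..h})"
    if "0 \<le> s" "s \<le> h" for s
    using has_derivative_diff[OF d1[of s h] d1[of s 0]] that assms(3) unfolding \<phi>_def
    by (auto simp: algebra_simps intro: has_derivative_at_withinI)
  from mvt_simple[OF assms(3) this] obtain s where s: "0 < s" "s < h"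
    "\<phi> h - \<phi> 0 = h * (gv (x + s *\<^sub>R v + h *\<^sub>R w) - gv (x + s *\<^sub>R v))" by auto
  have d2: "((\<lambda>r. gv (x + s *\<^sub>R v + r *\<^sub>R w)) has_derivative
     (\<lambda>t. t * frechet_derivative gv (at (x + s *\<^sub>R v + r *\<^sub>R w)) w)) (at r within {0..h})"
    if "0 \<le> r" "r \<le> h" for r
  proof -
    have D: "(gv has_derivative frechet_derivative gv (at (x + s *\<^sub>R v + r *\<^sub>R w))) (at (x + s *\<^sub>R v + r *\<^sub>R w))"
      using smooth_has_derivative[OF assms(1) gv] sub that s by auto
    have "((\<lambda>r. x + s *\<^sub>R v + r *\<^sub>R w) has_derivative (\<lambda>t. t *\<^sub>R w)) (at r within {0..h})"
      by (auto intro!: derivative_eq_intros)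
    from has_derivative_compose[OF this D] show ?thesis
      using linear_cmul[OF has_derivative_linear[OF D]] by simp
  qed
  from mvt_simple[OF assms(3) d2] obtain r where r: "0 < r" "r < h"
    "gv (x + s *\<^sub>R v + h *\<^sub>R w) - gv (x + s *\<^sub>R v) = h * frechet_derivative gv (at (x + s *\<^sub>R v + r *\<^sub>R w)) w"
    by auto
  have "\<phi> h - \<phi> 0 = h\<^sup>2 * frechet_derivative gv (at (x + s *\<^sub>R v + r *\<^sub>R w)) w"
    using s(3) r(3) by (simp add: power2_eq_square)
  then have "g (x + h *\<^sub>R v + h *\<^sub>R w) - g (x + h *\<^sub>R v) - g (x + h *\<^sub>R w) + g x
      = h\<^sup>2 * frechet_derivative gv (at (x + s *\<^sub>R v + r *\<^sub>R w)) w"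
    unfolding \<phi>_def by simp
  then show ?thesis using s(1,2) r(1,2) unfolding gv_def by blast
qed

text \<open>The second difference of \<open>g\<close> over a small parallelogram is symmetric in
  \<open>v\<close> and \<open>w\<close>, and by \<open>second_difference_mvt\<close> it is
  \<open>h^2\<close> times either mixed derivative at some point near \<open>x\<close>. Continuity
  at \<open>x\<close> finishes.\<close>

lemma mixed_derivatives_real:
  fixes g :: "'a::euclidean_space \<Rightarrow> real"
  assumes "open U" "smooth U g" "x \<in> U"
  shows "frechet_derivative (\<lambda>y. frechet_derivative g (at y) v) (at x) w
       = frechet_derivative (\<lambda>y. frechet_derivative g (at y) w) (at x) v"
proof -
  define A where "A y = frechet_derivative (\<lambda>y. frechet_derivative g (at y) v) (at y) w" for y
  define B where "B y = frechet_derivative (\<lambda>y. frechet_derivative g (at y) w) (at y) v" for y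
  have "smooth U A" "smooth U B" unfolding A_def B_def by (intro smooth_deriv assms)+
  then have cont: "isCont A x" "isCont B x"
    using smooth_continuous_on[OF assms(1)] assms by (auto simp: continuous_on_eq_continuous_at)
  have "\<bar>A x - B x\<bar> < e + e" if e: "e > 0" for e
  proof -
    from cont(1) e obtain d1 where d1: "d1 > 0" "\<And>y. dist y x < d1 \<Longrightarrow> \<bar>A y - A x\<bar> < e"
      unfolding continuous_at_eps_delta by (auto simp: dist_real_def)
    from cont(2) e obtain d2 where d2: "d2 > 0" "\<And>y. dist y x < d2 \<Longrightarrow> \<bar>B y - B x\<bar> < e"
      unfolding continuous_at_eps_delta by (auto simp: dist_real_def)
    obtain d3 where d3: "d3 > 0" "ball x d3 \<subseteq> U" using assms openE by blast
    define d where "d = min d1 (min d2 d3)"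
    \<comment> \<open>Small enough for the parallelogram spanned by \<open>h v\<close> and
      \<open>h w\<close> to stay within \<open>d / 2\<close> of \<open>x\<close>; the summand 1
      covers \<open>v = w = 0\<close>.\<close>
    define h where "h = d / (2 * (norm v + norm w + 1))"
    have nn: "norm v + norm w + 1 > 0" by (simp add: add_nonneg_pos)
    have d: "d > 0" using d1 d2 d3 by (simp add: d_def)
    have h: "h > 0" using d nn by (simp add: h_def)
    have near: "dist (x + s *\<^sub>R v + r *\<^sub>R w) x < d" if "0 \<le> s" "s \<le> h" "0 \<le> r" "r \<le> h" for s r
    proof -
      have "dist (x + s *\<^sub>R v + r *\<^sub>R w) x = norm (s *\<^sub>R v + r *\<^sub>R w)" by (simp add: dist_norm add.assoc)
      also have "\<dots> \<le> norm (s *\<^sub>R v) + norm (r *\<^sub>R w)" by (rule norm_triangle_ineq)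
      also have "\<dots> \<le> h * norm v + h * norm w" using that by (auto intro!: add_mono mult_right_mono)
      also have "\<dots> \<le> h * (norm v + norm w + 1)" using h by (simp add: algebra_simps)
      also have "\<dots> = d / 2"
      proof -
        have "d / (2 * y) * y = d / 2" if "y > 0" for y using that by simp
        from this[OF nn] show ?thesis unfolding h_def .
      qed
      finally show ?thesis using d by simp
    qed
    have sub: "x + s *\<^sub>R v + r *\<^sub>R w \<in> U" if "0 \<le> s" "s \<le> h" "0 \<le> r" "r \<le> h" for s r
      using near[OF that] d3(2) by (auto simp: d_def dist_commute subset_iff)
    have sub': "x + s *\<^sub>R w + r *\<^sub>R v \<in> U" if "0 \<le> s" "s \<le> h" "0 \<le> r" "r \<le> h" for s r
      using sub[of r s] that by (simp add: algebra_simps)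
    obtain s r where 1: "0 < s" "s < h" "0 < r" "r < h"
      "g (x + h *\<^sub>R v + h *\<^sub>R w) - g (x + h *\<^sub>R v) - g (x + h *\<^sub>R w) + g x = h\<^sup>2 * A (x + s *\<^sub>R v + r *\<^sub>R w)"
      using second_difference_mvt[OF assms(1,2) h sub] unfolding A_def by blast
    obtain s' r' where 2: "0 < s'" "s' < h" "0 < r'" "r' < h"
      "g (x + h *\<^sub>R w + h *\<^sub>R v) - g (x + h *\<^sub>R w) - g (x + h *\<^sub>R v) + g x = h\<^sup>2 * B (x + s' *\<^sub>R w + r' *\<^sub>R v)"
      using second_difference_mvt[OF assms(1,2) h sub'] unfolding B_def by blast
    have "h\<^sup>2 * A (x + s *\<^sub>R v + r *\<^sub>R w) = h\<^sup>2 * B (x + s' *\<^sub>R w + r' *\<^sub>R v)"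
      using 1(5) 2(5) by (simp add: algebra_simps)
    then have eq: "A (x + s *\<^sub>R v + r *\<^sub>R w) = B (x + r' *\<^sub>R v + s' *\<^sub>R w)"
      using h by (simp add: algebra_simps)
    have "\<bar>A (x + s *\<^sub>R v + r *\<^sub>R w) - A x\<bar> < e" using d1(2) near[of s r] 1 by (simp add: d_def)
    moreover have "\<bar>B (x + r' *\<^sub>R v + s' *\<^sub>R w) - B x\<bar> < e" using d2(2) near[of r' s'] 2 by (simp add: d_def)
    ultimately show ?thesis using eq by linarith
  qed
  from this[of "\<bar>A x - B x\<bar> / 2"] have "A x = B x" by (cases "A x = B x") auto
  then show ?thesis by (simp add: A_def B_def)
qed

lemma mixed_derivatives:
  fixes G :: "'a::euclidean_space \<Rightarrow> 'b::euclidean_space"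
  assumes "open U" "smooth U G" "x \<in> U"
  shows "frechet_derivative (\<lambda>y. frechet_derivative G (at y) v) (at x) w
       = frechet_derivative (\<lambda>y. frechet_derivative G (at y) w) (at x) v"
proof (rule euclidean_eqI)
  fix b :: 'b assume b: "b \<in> Basis"
  have *: "frechet_derivative (\<lambda>y. frechet_derivative G (at y) v) (at x) w \<bullet> b
      = frechet_derivative (\<lambda>y. frechet_derivative (\<lambda>x. G x \<bullet> b) (at y) v) (at x) w" for v w
  proof -
    have "frechet_derivative (\<lambda>y. frechet_derivative G (at y) v) (at x) w \<bullet> b
      = frechet_derivative (\<lambda>y. frechet_derivative G (at y) v \<bullet> b) (at x) w"
      using frechet_derivative_inner smooth_differentiable[OF assms(1) smooth_deriv[OF assms(1,2)] assms(3)]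
      by metis
    also have "\<dots> = frechet_derivative (\<lambda>y. frechet_derivative (\<lambda>x. G x \<bullet> b) (at y) v) (at x) w"
    proof -
      have "((\<lambda>y. frechet_derivative G (at y) v \<bullet> b) has_derivative
          frechet_derivative (\<lambda>y. frechet_derivative G (at y) v \<bullet> b) (at x)) (at x)"
        by (intro smooth_has_derivative[OF assms(1)] smooth_inner smooth_deriv smooth_const assms)
      then have *: "((\<lambda>y. frechet_derivative (\<lambda>x. G x \<bullet> b) (at y) v) has_derivative
          frechet_derivative (\<lambda>y. frechet_derivative G (at y) v \<bullet> b) (at x)) (at x)"
        by (rule has_derivative_transform_within_open[OF _ assms(1,3)])
           (simp add: frechet_derivative_inner smooth_differentiable[OF assms(1,2)])
      from frechet_derivative_at[OF *] show ?thesis by simp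
    qed
    finally show ?thesis .
  qed
  show "frechet_derivative (\<lambda>y. frechet_derivative G (at y) v) (at x) w \<bullet> b
     = frechet_derivative (\<lambda>y. frechet_derivative G (at y) w) (at x) v \<bullet> b"
    unfolding * by (rule mixed_derivatives_real[OF assms(1) smooth_inner[OF assms(2) smooth_const] assms(3)])
qed

section \<open>Hypersurfaces given by a local equation\<close>

definition local_equation ::
    "'a::euclidean_space set \<Rightarrow> 'a set \<Rightarrow> ('a \<Rightarrow> real) \<Rightarrow> ('a \<Rightarrow> 'a \<Rightarrow> real) \<Rightarrow> bool" where
  "local_equation S U f D \<longleftrightarrow> open U \<and> S \<inter> U = {q \<in> U. f q = 0} \<and>
     (\<forall>x\<in>U. (f has_derivative D x) (at x)) \<and> (\<forall>v. continuous_on U (\<lambda>x. D x v)) \<and>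
     (\<forall>x\<in>U. D x \<noteq> (\<lambda>v. 0))"

text \<open>Some basis vector \<open>a\<close> has \<open>D p a \<noteq> 0\<close>, so replacing the
  coordinate along \<open>a\<close> by \<open>f\<close> is a local diffeomorphism; it flattens
  \<open>S\<close> into the hyperplane orthogonal to \<open>a\<close>. The last clause says that
  \<open>\<psi>'\<close> inverts the derivative of \<open>\<Phi>\<close> at
  \<open>p\<close>.\<close>

lemma hypersurface_chart:
  fixes f :: "'a::euclidean_space \<Rightarrow> real"
  assumes eq: "local_equation S U f D" and "p \<in> U"
  obtains W r \<Phi> \<psi> \<psi>' a where "open W" "p \<in> W" "W \<subseteq> U" "0 < r"
    "homeomorphism W (ball (\<Phi> p) r) \<Phi> \<psi>"
    "\<And>y. y \<in> ball (\<Phi> p) r \<Longrightarrow> (\<psi> has_derivative \<psi>' y) (at y)"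
    "norm a = 1" "\<And>x. x \<in> W \<Longrightarrow> \<Phi> x \<bullet> a = f x"
    "\<And>v. \<psi>' (\<Phi> p) (v + (D p v - v \<bullet> a) *\<^sub>R a) = v"
proof -
  have U: "open U" and D: "\<And>x. x \<in> U \<Longrightarrow> (f has_derivative D x) (at x)"
    and contD: "\<And>v. continuous_on U (\<lambda>x. D x v)" and nz: "D p \<noteq> (\<lambda>v. 0)"
    using assms unfolding local_equation_def by auto
  have linD: "bounded_linear (D x)" if "x \<in> U" for x
    using D[OF that] has_derivative_bounded_linear by blast
  obtain a where a: "a \<in> Basis" "D p a \<noteq> 0"
  proof -
    have "\<exists>a\<in>Basis. D p a \<noteq> 0"
    proof (rule ccontr)
      assume "\<not> ?thesis"
      then have "\<And>b. b \<in> Basis \<Longrightarrow> D p b = (\<lambda>v. 0) b" by simp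
      from linear_eq_stdbasis[OF bounded_linear.linear[OF linD[OF \<open>p \<in> U\<close>]] _ this]
      have "D p = (\<lambda>v. 0)" by (simp add: module_hom_zero)
      then show False using nz by simp
    qed
    then show ?thesis using that by blast
  qed
  have na: "norm a = 1" "a \<bullet> a = 1" using a(1) by (auto simp: inner_Basis)
  define \<Phi> where "\<Phi> x = x + (f x - x \<bullet> a) *\<^sub>R a" for x
  define \<Phi>' where "\<Phi>' x = Blinfun (\<lambda>v. v + (D x v - v \<bullet> a) *\<^sub>R a)" for x
  have bl: "bounded_linear (\<lambda>v. v + (D x v - v \<bullet> a) *\<^sub>R a)" if "x \<in> U" for x
    by (intro bounded_linear_add bounded_linear_ident bounded_linear_scaleR_const
        bounded_linear_sub linD[OF that] bounded_linear_inner_left)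
  have app: "blinfun_apply (\<Phi>' x) v = v + (D x v - v \<bullet> a) *\<^sub>R a" if "x \<in> U" for x v
    unfolding \<Phi>'_def using bounded_linear_Blinfun_apply[OF bl[OF that]] by metis
  have der: "(\<Phi> has_derivative blinfun_apply (\<Phi>' x)) (at x)" if "x \<in> U" for x
  proof -
    have "blinfun_apply (\<Phi>' x) = (\<lambda>v. v + (D x v - v \<bullet> a) *\<^sub>R a)" using app[OF that] by auto
    then show ?thesis unfolding \<Phi>_def by (auto intro!: derivative_eq_intros D[OF that])
  qed
  have cont: "continuous_on U \<Phi>'"
  proof (rule continuous_on_blinfun_componentwise)
    fix i :: 'a assume "i \<in> Basis"
    have "continuous_on U (\<lambda>x. i + (D x i - i \<bullet> a) *\<^sub>R a)"
      by (intro continuous_intros contD)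
    then show "continuous_on U (\<lambda>x. blinfun_apply (\<Phi>' x) i)"
      using app by (simp cong: continuous_on_cong)
  qed
  define J where "J = Blinfun (\<lambda>w. w + ((w \<bullet> a - D p w) / D p a) *\<^sub>R a)"
  have blJ: "bounded_linear (\<lambda>w. w + ((w \<bullet> a - D p w) / D p a) *\<^sub>R a)"
    using linD[OF \<open>p \<in> U\<close>]
    by (intro bounded_linear_add bounded_linear_ident bounded_linear_scaleR_const
        bounded_linear_divide bounded_linear_compose[OF bounded_linear_divide] bounded_linear_sub bounded_linear_inner_left)
  have J: "blinfun_apply J w = w + ((w \<bullet> a - D p w) / D p a) *\<^sub>R a" for w
    unfolding J_def using bounded_linear_Blinfun_apply[OF blJ] by metis
  have inv: "J o\<^sub>L \<Phi>' p = id_blinfun"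
  proof (rule blinfun_eqI)
    fix v
    have lin: "linear (D p)" using linD[OF \<open>p \<in> U\<close>] bounded_linear.linear by blast
    define s where "s = D p v - v \<bullet> a"
    have "((v + s *\<^sub>R a) \<bullet> a - D p (v + s *\<^sub>R a)) / D p a = - s"
    proof -
      have 1: "D p (v + s *\<^sub>R a) = D p v + s * D p a" by (simp add: linear_add[OF lin] linear_cmul[OF lin])
      have 2: "(v + s *\<^sub>R a) \<bullet> a = D p v" using na(2) by (simp add: inner_simps s_def)
      show ?thesis unfolding 1 2 using a(2) by simp
    qed
    then show "blinfun_apply (J o\<^sub>L \<Phi>' p) v = blinfun_apply id_blinfun v"
      by (simp add: J app[OF \<open>p \<in> U\<close>] flip: s_def)
  qed
  obtain U' V \<psi> \<psi>' where UV: "open U'" "U' \<subseteq> U" "p \<in> U'" "open V" "\<Phi> p \<in> V"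
    "homeomorphism U' V \<Phi> \<psi>" "\<And>y. y \<in> V \<Longrightarrow> (\<psi> has_derivative (\<psi>' y)) (at y)"
    "\<And>y. y \<in> V \<Longrightarrow> \<psi>' y = inv (blinfun_apply (\<Phi>'(\<psi> y)))"
    "\<And>y. y \<in> V \<Longrightarrow> bij (blinfun_apply (\<Phi>'(\<psi> y)))"
    by (rule inverse_function_theorem[OF U der cont \<open>p \<in> U\<close> inv]) blast+
  obtain r where r: "0 < r" "ball (\<Phi> p) r \<subseteq> V" using UV(4,5) openE by blast
  define W where "W = \<psi> ` ball (\<Phi> p) r"
  have W: "W = U' \<inter> \<Phi> -` ball (\<Phi> p) r"
    unfolding W_def using UV(6) r(2) unfolding homeomorphism_def by force
  have "continuous_on U' \<Phi>" using UV(6) homeomorphism_def by blast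
  then have "open W"
    unfolding W by (simp add: UV(1) continuous_open_preimage)
  moreover have "p \<in> W" using W UV(3) r(1) by simp
  moreover have "W \<subseteq> U" using W UV(2) by blast
  moreover have "homeomorphism W (ball (\<Phi> p) r) \<Phi> \<psi>"
  proof (rule homeomorphism_of_subsets[OF UV(6)])
    show "W \<subseteq> U'" using W by blast
    show "ball (\<Phi> p) r \<subseteq> V" by fact
    have "\<And>y. y \<in> ball (\<Phi> p) r \<Longrightarrow> \<Phi> (\<psi> y) = y" using homeomorphism_apply2[OF UV(6)] r(2) by blast
    then show "\<Phi> ` W = ball (\<Phi> p) r" unfolding W_def image_image by simp
  qed
  moreover have "\<psi>' (\<Phi> p) (v + (D p v - v \<bullet> a) *\<^sub>R a) = v" for v
  proof -
    have "\<psi> (\<Phi> p) = p" using UV(3,6) homeomorphism_apply1 by metis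
    then have "\<psi>' (\<Phi> p) = inv (blinfun_apply (\<Phi>' p))" "bij (blinfun_apply (\<Phi>' p))"
      using UV(5,8,9) by metis+
    then have "\<psi>' (\<Phi> p) (blinfun_apply (\<Phi>' p) v) = v"
      by (simp add: bij_is_inj)
    then show ?thesis using app[OF \<open>p \<in> U\<close>] by simp
  qed
  moreover have "\<Phi> x \<bullet> a = f x" for x using na(2) by (simp add: \<Phi>_def inner_simps)
  ultimately show ?thesis using that[of W r \<Phi> \<psi> \<psi>' a] r UV(7) na(1) by blast
qed

lemma has_vector_derivative_along_curve:
  assumes "\<epsilon> > 0" "\<gamma> ` {-\<epsilon><..<\<epsilon>} \<subseteq> S" "(\<gamma> has_vector_derivative v) (at (0::real))"
    and "(h has_derivative D) (at (\<gamma> 0) within S)"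
  shows "((\<lambda>t. h (\<gamma> t)) has_vector_derivative D v) (at 0)"
proof -
  have 1: "(\<gamma> has_derivative (\<lambda>t. t *\<^sub>R v)) (at 0 within {-\<epsilon><..<\<epsilon>})"
    using assms(3) unfolding has_vector_derivative_def by (rule has_derivative_at_withinI)
  have 2: "(h has_derivative D) (at (\<gamma> 0) within \<gamma> ` {-\<epsilon><..<\<epsilon>})"
    by (rule has_derivative_subset[OF assms(4,2)])
  have "((\<lambda>t. h (\<gamma> t)) has_derivative (\<lambda>t. D (t *\<^sub>R v))) (at 0 within {-\<epsilon><..<\<epsilon>})"
    using has_derivative_in_compose[OF 1 2] .
  moreover have "D (t *\<^sub>R v) = t *\<^sub>R D v" for t
    using linear_cmul[OF has_derivative_linear[OF assms(4)]] .
  ultimately show ?thesis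
    using assms(1) at_within_open[of 0 "{-\<epsilon><..<\<epsilon>}"] by (simp add: has_vector_derivative_def)
qed

text \<open>Derivatives within \<open>S\<close> need not be unique as linear maps, but composing
  with a curve in \<open>S\<close> leaves only their value on its velocity.\<close>

lemma derivative_within_unique_on_tangent:
  assumes "v \<in> tangent_space S p"
    and "(h has_derivative D) (at p within S)" "(h has_derivative D') (at p within S)"
  shows "D v = D' v"
proof -
  obtain \<gamma> \<epsilon> where g: "\<epsilon> > 0" "\<gamma> ` {-\<epsilon><..<\<epsilon>} \<subseteq> S" "\<gamma> 0 = p" "(\<gamma> has_vector_derivative v) (at 0)"
    using assms(1) unfolding tangent_space_def by blast
  note chain = has_vector_derivative_along_curve[OF g(1,2,4), unfolded g(3)]
  show ?thesis using vector_derivative_unique_at[OF chain[OF assms(2)] chain[OF assms(3)]] .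
qed

lemma derivative_along_curve_max:
  fixes h :: "'a::real_normed_vector \<Rightarrow> real"
  assumes "\<epsilon> > 0" "\<gamma> ` {-\<epsilon><..<\<epsilon>} \<subseteq> S" "\<And>q. q \<in> S \<Longrightarrow> h q \<le> h (\<gamma> 0)"
    and "((\<lambda>t. h (\<gamma> t)) has_real_derivative d) (at (0::real))"
  shows "d = 0"
proof (rule DERIV_local_max[OF assms(4,1)], intro allI impI)
  fix t :: real assume "\<bar>0 - t\<bar> < \<epsilon>"
  then have "t \<in> {-\<epsilon><..<\<epsilon>}" by auto
  then show "h (\<gamma> t) \<le> h (\<gamma> 0)" using assms(2,3) by blast
qed

lemma derivative_within_max_tangent:
  fixes h :: "'a::euclidean_space \<Rightarrow> real"
  assumes "v \<in> tangent_space S p" "(h has_derivative D) (at p within S)"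
    and "\<And>q. q \<in> S \<Longrightarrow> h q \<le> h p"
  shows "D v = 0"
proof -
  obtain \<gamma> \<epsilon> where g: "\<epsilon> > 0" "\<gamma> ` {-\<epsilon><..<\<epsilon>} \<subseteq> S" "\<gamma> 0 = p" "(\<gamma> has_vector_derivative v) (at 0)"
    using assms(1) unfolding tangent_space_def by blast
  have "((\<lambda>t. h (\<gamma> t)) has_vector_derivative D v) (at 0)"
    using has_vector_derivative_along_curve[OF g(1,2,4), unfolded g(3)] assms(2) .
  then show ?thesis
    using derivative_along_curve_max[OF g(1,2), of h] assms(3)
    by (simp add: g(3) has_real_derivative_iff_has_vector_derivative)
qed

text \<open>On \<open>S\<close> the function \<open>f\<close> agrees with zero, which gives one
  inclusion. For the other, the chart pulls back a straight line in the hyperplane orthogonal to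
  \<open>a\<close>; its direction \<open>w\<close> is \<open>v\<close> without the component along
  \<open>a\<close>.\<close>

lemma tangent_space_eq_kernel:
  assumes eq: "local_equation S U f D" and p: "p \<in> S" "p \<in> U"
  shows "tangent_space S p = {v. D p v = 0}"
proof (intro equalityI subsetI)
  have U: "open U" and D: "(f has_derivative D p) (at p)" and S: "S \<inter> U = {q \<in> U. f q = 0}"
    using assms unfolding local_equation_def by auto
  fix v assume v: "v \<in> tangent_space S p"
  have "((\<lambda>q. 0) has_derivative (\<lambda>v. 0)) (at p within S)" by simp
  moreover have "((\<lambda>q. 0) has_derivative D p) (at p within S)"
  proof -
    obtain d where d: "d > 0" "ball p d \<subseteq> U" using U p openE by blast
    show ?thesis
  proof (rule has_derivative_transform_within[where f = f and d = d])
    show "(f has_derivative D p) (at p within S)" using D by (rule has_derivative_at_withinI)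
    show "0 < d" by fact
    show "p \<in> S" by fact
    fix x assume "x \<in> S" "dist x p < d"
    then have "x \<in> S \<inter> U" using d(2) by (auto simp: dist_commute)
    then show "f x = 0" unfolding S by simp
  qed
  qed
  ultimately show "v \<in> {v. D p v = 0}" using derivative_within_unique_on_tangent[OF v, of "\<lambda>q. 0" "\<lambda>v. 0" "D p"] by simp
next
  fix v assume v: "v \<in> {v. D p v = 0}"
  obtain W r \<Phi> \<psi> \<psi>' a where c: "open W" "p \<in> W" "W \<subseteq> U" "0 < r"
    "homeomorphism W (ball (\<Phi> p) r) \<Phi> \<psi>"
    "\<And>y. y \<in> ball (\<Phi> p) r \<Longrightarrow> (\<psi> has_derivative \<psi>' y) (at y)"
    "norm a = 1" "\<And>x. x \<in> W \<Longrightarrow> \<Phi> x \<bullet> a = f x"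
    "\<And>v. \<psi>' (\<Phi> p) (v + (D p v - v \<bullet> a) *\<^sub>R a) = v"
    by (rule hypersurface_chart[OF eq p(2)]) (rule that)
  have S: "S \<inter> U = {q \<in> U. f q = 0}" using eq unfolding local_equation_def by auto
  have fp: "f p = 0" using S p by auto
  define w where "w = v - (v \<bullet> a) *\<^sub>R a"
  have wa: "w \<bullet> a = 0" using c(7) by (simp add: w_def inner_simps dot_square_norm)
  have ww: "\<psi>' (\<Phi> p) w = v" using c(9)[of v] v by (simp add: w_def)
  define \<gamma> where "\<gamma> t = \<psi> (\<Phi> p + t *\<^sub>R w)" for t :: real
  define \<epsilon> where "\<epsilon> = r / (norm w + 1)"
  have nw: "norm w + 1 > 0" by (simp add: add_nonneg_pos)
  have "\<epsilon> > 0" using c(4) nw by (simp add: \<epsilon>_def)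
  moreover have "\<gamma> t \<in> S" if "t \<in> {-\<epsilon><..<\<epsilon>}" for t
  proof -
    have "norm (t *\<^sub>R w) \<le> \<bar>t\<bar> * (norm w + 1)" by (simp add: algebra_simps)
    also have "\<dots> < \<epsilon> * (norm w + 1)" using that nw by (intro mult_strict_right_mono) auto
    also have "\<dots> = r" using nw by (simp add: \<epsilon>_def)
    finally have y: "\<Phi> p + t *\<^sub>R w \<in> ball (\<Phi> p) r" by (simp add: dist_norm)
    then have "\<gamma> t \<in> W" using c(5) unfolding \<gamma>_def homeomorphism_def by blast
    moreover have "\<Phi> (\<gamma> t) = \<Phi> p + t *\<^sub>R w" unfolding \<gamma>_def using y homeomorphism_apply2[OF c(5)] by blast
    ultimately have "f (\<gamma> t) = 0" using c(8)[of "\<gamma> t"] c(8)[OF c(2)] fp wa by (simp add: inner_simps)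
    then have "\<gamma> t \<in> S \<inter> U" unfolding S using \<open>\<gamma> t \<in> W\<close> c(3) by auto
    then show ?thesis by simp
  qed
  moreover have "\<gamma> 0 = p" unfolding \<gamma>_def using homeomorphism_apply1[OF c(5) c(2)] by simp
  moreover have "(\<gamma> has_vector_derivative v) (at 0)"
  proof -
    have "((\<lambda>t. \<Phi> p + t *\<^sub>R w) has_derivative (\<lambda>t. t *\<^sub>R w)) (at 0)"
      by (auto intro!: derivative_eq_intros)
    moreover have D: "(\<psi> has_derivative \<psi>' (\<Phi> p)) (at (\<Phi> p + 0 *\<^sub>R w))" using c(6)[of "\<Phi> p"] c(4) by simp
    ultimately have "(\<gamma> has_derivative (\<lambda>t. \<psi>' (\<Phi> p) (t *\<^sub>R w))) (at 0)"
      unfolding \<gamma>_def by (rule has_derivative_compose)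
    then show ?thesis
      using linear_cmul[OF has_derivative_linear[OF D]] ww by (simp add: has_vector_derivative_def)
  qed
  ultimately show "v \<in> tangent_space S p" unfolding tangent_space_def by blast
qed

text \<open>The chart followed by the orthogonal projection along \<open>a\<close>; \<open>y \<bullet> a\<close> is the lost coordinate.\<close>
lemma hypersurface_retraction:
  fixes f :: "'a::euclidean_space \<Rightarrow> real"
  assumes eq: "local_equation S U f D" and p: "p \<in> S" "p \<in> U"
  obtains g :: "'a \<Rightarrow> 'a" and g' c r a W where "S \<inter> W \<subseteq> g ` ball c r" "c \<bullet> a = 0" "0 < r" "g c = p" "open W" "p \<in> W"
    "\<And>y. y \<in> ball c r \<Longrightarrow> g y \<in> S \<inter> U"
    "\<And>y. y \<in> ball c r \<Longrightarrow> (g has_derivative g' y) (at y)"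
    "\<And>y y'. y \<in> ball c r \<Longrightarrow> y' \<in> ball c r \<Longrightarrow> g y = g y' \<Longrightarrow> y \<bullet> a = y' \<bullet> a \<Longrightarrow> y = y'"
proof -
  obtain W r \<Phi> \<psi> \<psi>' a where c: "open W" "p \<in> W" "W \<subseteq> U" "0 < r"
    "homeomorphism W (ball (\<Phi> p) r) \<Phi> \<psi>"
    "\<And>y. y \<in> ball (\<Phi> p) r \<Longrightarrow> (\<psi> has_derivative \<psi>' y) (at y)"
    "norm a = 1" "\<And>x. x \<in> W \<Longrightarrow> \<Phi> x \<bullet> a = f x"
    "\<And>v. \<psi>' (\<Phi> p) (v + (D p v - v \<bullet> a) *\<^sub>R a) = v"
    by (rule hypersurface_chart[OF eq p(2)]) (rule that)
  let ?B = "ball (\<Phi> p) r"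
  have S: "S \<inter> U = {q \<in> U. f q = 0}"
    using eq unfolding local_equation_def by auto
  have fp: "\<Phi> p \<bullet> a = 0" using S p c(2,8) by auto
  have aa: "a \<bullet> a = 1" using c(7) by (simp add: dot_square_norm)
  define \<pi> where "\<pi> y = y - (y \<bullet> a) *\<^sub>R a" for y
  have \<pi>: "\<pi> y \<in> ?B" "\<pi> y \<bullet> a = 0" if "y \<in> ?B" for y
  proof -
    have "\<Phi> p - \<pi> y = \<pi> (\<Phi> p - y)" using fp by (simp add: \<pi>_def inner_simps algebra_simps)
    moreover have "norm (\<pi> z) \<le> norm z" for z
    proof (rule power2_le_imp_le)
      have "(norm (\<pi> z))\<^sup>2 = (norm z)\<^sup>2 - (z \<bullet> a)\<^sup>2"
        unfolding power2_norm_eq_inner \<pi>_def using aa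
        by (simp add: inner_simps power2_eq_square inner_commute)
      then show "(norm (\<pi> z))\<^sup>2 \<le> (norm z)\<^sup>2" by simp
    qed simp
    ultimately show "\<pi> y \<in> ?B" using that by (metis dist_norm le_less_trans mem_ball)
    show "\<pi> y \<bullet> a = 0" using aa by (simp add: \<pi>_def inner_simps)
  qed
  have inS: "\<psi> (\<pi> y) \<in> S \<inter> U" if "y \<in> ?B" for y
  proof -
    have "\<psi> (\<pi> y) \<in> W" using c(5) \<pi>[OF that] unfolding homeomorphism_def by blast
    moreover have "\<Phi> (\<psi> (\<pi> y)) = \<pi> y" using homeomorphism_apply2[OF c(5)] \<pi>[OF that] by blast
    ultimately have "\<psi> (\<pi> y) \<in> U" "f (\<psi> (\<pi> y)) = 0"
      using c(3) c(8)[of "\<psi> (\<pi> y)"] \<pi>(2)[OF that] by auto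
    then show ?thesis unfolding S by simp
  qed
  have der: "((\<lambda>y. \<psi> (\<pi> y)) has_derivative (\<lambda>w. \<psi>' (\<pi> y) (\<pi> w))) (at y)" if "y \<in> ?B" for y
  proof -
    have "(\<pi> has_derivative \<pi>) (at y)" unfolding \<pi>_def by (auto intro!: derivative_eq_intros)
    from has_derivative_compose[OF this c(6)[OF \<pi>(1)[OF that]]] show ?thesis .
  qed
  have \<pi>\<Phi>: "\<pi> (\<Phi> q) = \<Phi> q" if "q \<in> S \<inter> W" for q using that c(3,8) S by (auto simp: \<pi>_def)
  have sub: "S \<inter> W \<subseteq> (\<lambda>y. \<psi> (\<pi> y)) ` ?B"
  proof
    fix q assume q: "q \<in> S \<inter> W"
    then have "\<Phi> q \<in> ?B" "\<psi> (\<pi> (\<Phi> q)) = q"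
      using c(5) \<pi>\<Phi>[OF q] homeomorphism_apply1[OF c(5)] unfolding homeomorphism_def by auto
    then show "q \<in> (\<lambda>y. \<psi> (\<pi> y)) ` ?B" by (metis imageI)
  qed
  have inj: "y = y'" if "y \<in> ?B" "y' \<in> ?B" "\<psi> (\<pi> y) = \<psi> (\<pi> y')" "y \<bullet> a = y' \<bullet> a" for y y'
  proof -
    have "\<pi> y = \<pi> y'" using that(3) \<pi>(1)[OF that(1)] \<pi>(1)[OF that(2)] homeomorphism_apply2[OF c(5)] by metis
    then show ?thesis using that(4) by (simp add: \<pi>_def)
  qed
  have "\<psi> (\<pi> (\<Phi> p)) = p" using \<pi>\<Phi>[of p] c(2) p homeomorphism_apply1[OF c(5)] by simp
  then show ?thesis
    by (rule that[where g = "\<lambda>y. \<psi> (\<pi> y)", OF sub fp c(4) _ c(1,2) inS der inj])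
qed

text \<open>The map \<open>g\<close> of \<open>hypersurface_retraction\<close> pulls
  \<open>h\<close> back to a ball. As \<open>f\<close> vanishes on the values of \<open>g\<close>,
  the derivative of \<open>g\<close> maps into tangent spaces, so the pullback has derivative zero
  on a convex set.\<close>

lemma locally_constant_on_hypersurface:
  fixes S :: "'a::euclidean_space set"
  assumes eq: "local_equation S U f D" and p: "p \<in> S" "p \<in> U"
    and h: "\<And>q. q \<in> S \<inter> U \<Longrightarrow> \<exists>E. (h has_derivative E) (at q within S) \<and> (\<forall>v\<in>tangent_space S q. E v = 0)"
  obtains W where "open W" "p \<in> W" "\<And>q. q \<in> S \<inter> W \<Longrightarrow> h q = h p"
proof -
  obtain g :: "'a \<Rightarrow> 'a" and g' c r a W where c: "S \<inter> W \<subseteq> g ` ball c r" "c \<bullet> a = 0" "0 < r" "g c = p" "open W" "p \<in> W"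
    "\<And>y. y \<in> ball c r \<Longrightarrow> g y \<in> S \<inter> U"
    "\<And>y. y \<in> ball c r \<Longrightarrow> (g has_derivative g' y) (at y)"
    "\<And>y y'. y \<in> ball c r \<Longrightarrow> y' \<in> ball c r \<Longrightarrow> g y = g y' \<Longrightarrow> y \<bullet> a = y' \<bullet> a \<Longrightarrow> y = y'"
    by (rule hypersurface_retraction[OF eq p]) (rule that)
  have S: "S \<inter> U = {q \<in> U. f q = 0}" and Df: "\<And>x. x \<in> U \<Longrightarrow> (f has_derivative D x) (at x)"
    using eq unfolding local_equation_def by auto
  have "((\<lambda>y. h (g y)) has_derivative (\<lambda>w. 0)) (at y within ball c r)" if y: "y \<in> ball c r" for y
  proof -
    have tan: "g' y w \<in> tangent_space S (g y)" for w
    proof -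
      have "((\<lambda>x. f (g x)) has_derivative (\<lambda>w. D (g y) (g' y w))) (at y)"
        using has_derivative_compose[OF c(8)[OF y] Df] c(7)[OF y] by simp
      moreover have "((\<lambda>x. f (g x)) has_derivative (\<lambda>w. 0)) (at y)"
        by (rule has_derivative_transform_within_open[OF _ open_ball y, where f = "\<lambda>x. 0"])
           (use c(7) S in auto)
      ultimately have "D (g y) (g' y w) = 0"
        using has_derivative_unique by (metis (no_types, lifting))
      then show ?thesis using tangent_space_eq_kernel[OF eq] c(7)[OF y] by simp
    qed
    obtain E where E: "(h has_derivative E) (at (g y) within S)" "\<forall>v\<in>tangent_space S (g y). E v = 0"
      using h c(7)[OF y] by blast
    have "(h has_derivative E) (at (g y) within g ` ball c r)"
      by (rule has_derivative_subset[OF E(1)]) (use c(7) in auto)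
    from has_derivative_in_compose[OF has_derivative_at_withinI[OF c(8)[OF y]] this]
    show ?thesis using E(2) tan by simp
  qed
  from has_derivative_zero_constant[OF convex_ball this]
  obtain k where k: "\<And>y. y \<in> ball c r \<Longrightarrow> h (g y) = k" by blast
  have "h q = k" if "q \<in> S \<inter> W" for q using c(1) that k by blast
  then show ?thesis using that[of W] c(5,6) p(1) by auto
qed

lemma hypersurface_at_local_equation:
  assumes "hypersurface_at k S p" "1 \<le> k"
  obtains U f where "p \<in> U" "local_equation S U f (\<lambda>x. frechet_derivative f (at x))" "C_on k f U"
proof -
  obtain U f D where U: "open U" "p \<in> U" "C_on k f U" "S \<inter> U = {q \<in> U. f q = 0}"
    "(f has_derivative D) (at p)" "D \<noteq> (\<lambda>v. 0)"
    using assms(1) unfolding hypersurface_at_def by blast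
  have "times_cont_diff (Suc 0) f U" using U(3) assms(2) unfolding C_on_def
    by (metis One_nat_def one_enat_def)
  then obtain E where E: "\<And>x. x \<in> U \<Longrightarrow> (f has_derivative E x) (at x)"
    "\<And>v. continuous_on U (\<lambda>x. E x v)"
    by (rule times_cont_diff_SucE) auto
  have fr: "frechet_derivative f (at x) = E x" if "x \<in> U" for x
    using frechet_derivative_at[OF E(1)[OF that]] by simp
  have "E p = D" using has_derivative_unique[OF E(1)[OF U(2)] U(5)] .
  then obtain v where v: "E p v \<noteq> 0" using U(6) by auto
  \<comment> \<open>The derivative of \<open>f\<close> is assumed nonzero at \<open>p\<close> only;
    a fixed direction \<open>v\<close> with \<open>E p v \<noteq> 0\<close> keeps it nonzero
    nearby.\<close>
  define U' where "U' = {x \<in> U. E x v \<noteq> 0}"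
  have "U' = U \<inter> (\<lambda>x. E x v) -` (- {0})" by (auto simp: U'_def)
  then have op: "open U'" using continuous_open_preimage[OF E(2) U(1), of "- {0}" v] by auto
  have "p \<in> U'" "U' \<subseteq> U" using v U(2) by (auto simp: U'_def)
  have 1: "continuous_on U' (\<lambda>x. frechet_derivative f (at x) v)" for v
  proof -
    have "continuous_on U' (\<lambda>x. E x v)" using E(2) \<open>U' \<subseteq> U\<close> continuous_on_subset by blast
    moreover have "\<And>x. x \<in> U' \<Longrightarrow> frechet_derivative f (at x) v = E x v" using fr \<open>U' \<subseteq> U\<close> by auto
    ultimately show ?thesis by (simp cong: continuous_on_cong)
  qed
  have "local_equation S U' f (\<lambda>x. frechet_derivative f (at x))"
    unfolding local_equation_def
  proof (intro conjI ballI allI op 1)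
    show "S \<inter> U' = {q \<in> U'. f q = 0}" using U(4) \<open>U' \<subseteq> U\<close> by blast
    fix x assume x: "x \<in> U'"
    then show "(f has_derivative frechet_derivative f (at x)) (at x)" using fr E(1) \<open>U' \<subseteq> U\<close> by auto
    have "frechet_derivative f (at x) v \<noteq> 0" using fr x by (auto simp: U'_def)
    then show "frechet_derivative f (at x) \<noteq> (\<lambda>v. 0)" by (metis (mono_tags))
  qed
  moreover have "C_on k f U'" using U(3) \<open>U' \<subseteq> U\<close> times_cont_diff_subset unfolding C_on_def by blast
  ultimately show ?thesis using that \<open>p \<in> U'\<close> by blast
qed

section \<open>Left-invariant derivatives\<close>

text \<open>The complex structure \<open>J\<close> of the contact plane, acting on coefficients in
  the left-invariant frame.\<close>

definition rot :: "(complex, 'n::finite) vec \<Rightarrow> (complex, 'n) vec" where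
  "rot x = \<i> *s x"

lemma rot_nth: "rot x $ b = \<i> * x $ b"
  by (simp add: rot_def)

lemma linear_rot: "linear rot"
  by (rule linearI) (simp_all add: vec_eq_iff rot_nth algebra_simps)

lemma bounded_linear_rot: "bounded_linear rot"
  using linear_rot linear_conv_bounded_linear by blast

lemma rot_add: "rot (x + y) = rot x + rot y"
  and rot_diff: "rot (x - y) = rot x - rot y"
  and rot_minus: "rot (- x) = - rot x"
  and rot_scaleR: "rot (r *\<^sub>R x) = r *\<^sub>R rot x"
  and rot_zero: "rot 0 = 0"
  and rot_rot: "rot (rot x) = - x"
  by (simp_all add: vec_eq_iff rot_nth algebra_simps)

lemmas rot_simps = rot_add rot_diff rot_minus rot_scaleR rot_zero rot_rot

lemma inner_rot_rot [simp]: "rot x \<bullet> rot y = x \<bullet> y"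
  by (simp add: inner_vec_def inner_complex_def rot_nth algebra_simps)

lemma inner_rot_left: "rot x \<bullet> y = - (x \<bullet> rot y)"
  by (simp add: inner_vec_def inner_complex_def rot_nth sum_negf[symmetric] algebra_simps)

lemma inner_rot_self [simp]: "rot x \<bullet> x = 0" "x \<bullet> rot x = 0"
  by (simp_all add: inner_vec_def inner_complex_def rot_nth)

text \<open>The vector of the contact plane at \<open>p\<close> whose coefficients in the
  left-invariant frame are \<open>w\<close>. It lets horizontal vectors be handled through their
  coefficients alone.\<close>

definition hor :: "'n::finite heis \<Rightarrow> (complex, 'n) vec \<Rightarrow> 'n heis" where
  "hor p w = (w, - (rot (fst p) \<bullet> w))"

lemma contact_form_eq: "contact_form p v = snd v + rot (fst p) \<bullet> fst v"
  unfolding contact_form_def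
  by (simp add: inner_vec_def inner_complex_def rot_nth algebra_simps)

lemma hor_decompose: "v = hor p (fst v) + contact_form p v *\<^sub>R (0, 1)"
  by (simp add: prod_eq_iff hor_def contact_form_eq)

lemma hor_add: "hor p (a + b) = hor p a + hor p b"
  and hor_scaleR: "hor p (r *\<^sub>R a) = r *\<^sub>R hor p a"
  by (simp_all add: hor_def inner_simps)

text \<open>
  \<open>L a\<close> differentiates along the left-invariant horizontal field with constant coefficients \<open>a\<close> in the frame.
  As the frame is parallel, iterating \<open>L\<close> gives the higher covariant derivatives.
\<close>
definition L :: "(complex, 'n::finite) vec \<Rightarrow> ('n heis \<Rightarrow> 'b::euclidean_space) \<Rightarrow> 'n heis \<Rightarrow> 'b" where
  "L a G p = frechet_derivative G (at p) (hor p a)"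

definition T :: "('n::finite heis \<Rightarrow> 'b::euclidean_space) \<Rightarrow> 'n heis \<Rightarrow> 'b" where
  "T G p = frechet_derivative G (at p) (0, 1)"

lemma L_eqI: "(G has_derivative G') (at p) \<Longrightarrow> L a G p = G' (hor p a)"
  unfolding L_def using frechet_derivative_at by metis

lemma T_eqI: "(G has_derivative G') (at p) \<Longrightarrow> T G p = G' (0, 1)"
  unfolding T_def using frechet_derivative_at by metis

locale smooth_domain =
  fixes U :: "'n::finite heis set"
  assumes open_U: "open U"
begin

lemma derivative_at: "smooth U G \<Longrightarrow> p \<in> U \<Longrightarrow> (G has_derivative frechet_derivative G (at p)) (at p)"
  using smooth_has_derivative open_U by blast

lemma linear_derivative: "smooth U G \<Longrightarrow> p \<in> U \<Longrightarrow> linear (frechet_derivative G (at p))"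
  using derivative_at has_derivative_linear by blast

lemma L_add: "smooth U G \<Longrightarrow> p \<in> U \<Longrightarrow> L (a + b) G p = L a G p + L b G p"
  by (simp add: L_def hor_add linear_add[OF linear_derivative])

lemma L_scaleR: "smooth U G \<Longrightarrow> p \<in> U \<Longrightarrow> L (r *\<^sub>R a) G p = r *\<^sub>R L a G p"
  by (simp add: L_def hor_scaleR linear_cmul[OF linear_derivative])

lemma L_zero: "smooth U G \<Longrightarrow> p \<in> U \<Longrightarrow> L 0 G p = 0"
  using L_scaleR[of G p 0 0] by simp

lemma frechet_derivative_decompose:
  assumes "smooth U G" "p \<in> U"
  shows "frechet_derivative G (at p) v = L (fst v) G p + contact_form p v *\<^sub>R T G p"
  unfolding L_def T_def
  by (subst hor_decompose[of v p]) (simp only: linear_add[OF linear_derivative[OF assms]] linear_cmul[OF linear_derivative[OF assms]])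

lemma L_eq: "smooth U G \<Longrightarrow> p \<in> U \<Longrightarrow>
    L a G p = frechet_derivative G (at p) (a, 0) - (rot (fst p) \<bullet> a) *\<^sub>R T G p"
proof -
  assume 1: "smooth U G" "p \<in> U"
  have "hor p a = (a, 0) - (rot (fst p) \<bullet> a) *\<^sub>R (0, 1)" by (simp add: hor_def)
  then show ?thesis
    unfolding L_def T_def by (simp only: linear_diff[OF linear_derivative[OF 1]] linear_cmul[OF linear_derivative[OF 1]])
qed

lemma smooth_T: "smooth U G \<Longrightarrow> smooth U (T G)"
  using smooth_deriv[OF open_U] unfolding T_def by blast

lemma smooth_fst: "smooth U fst"
  by (rule smooth_linear[OF bounded_linear_fst])

lemma smooth_rot: "smooth U G \<Longrightarrow> smooth U (\<lambda>p. rot (G p))"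
  by (rule smooth_linear_compose[OF bounded_linear_rot])

lemma smooth_neg: "smooth U G \<Longrightarrow> smooth U (\<lambda>p. - G p)"
  by (rule smooth_linear_compose[OF bounded_linear_minus[OF bounded_linear_ident]])

lemma smooth_sub: "smooth U F \<Longrightarrow> smooth U G \<Longrightarrow> smooth U (\<lambda>p. F p - G p)"
  using smooth_add[OF _ smooth_neg] by fastforce

lemma smooth_L:
  assumes "smooth U G"
  shows "smooth U (L a G)"
proof (rule smooth_cong[OF open_U])
  show "smooth U (\<lambda>p. frechet_derivative G (at p) (a, 0) - (rot (fst p) \<bullet> a) *\<^sub>R T G p)"
    by (intro smooth_sub smooth_deriv[OF open_U assms] smooth_scaleR smooth_inner smooth_rot smooth_fst
        smooth_const smooth_T assms)
qed (simp add: L_eq assms)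

lemma L_sum_Basis:
  assumes "smooth U G" "p \<in> U"
  shows "L a G p = (\<Sum>b\<in>Basis. (a \<bullet> b) *\<^sub>R L b G p)"
proof -
  have "linear (\<lambda>a. L a G p)"
    by (rule linearI) (simp_all add: L_add L_scaleR assms)
  from linear_sum[OF this, of "\<lambda>b. (a \<bullet> b) *\<^sub>R b" Basis] show ?thesis
    by (simp add: euclidean_representation L_scaleR assms)
qed

lemma smooth_L_field:
  assumes "smooth U G" "smooth U \<xi>"
  shows "smooth U (\<lambda>q. L (\<xi> q) G q)"
proof (rule smooth_cong[OF open_U])
  show "smooth U (\<lambda>q. \<Sum>b\<in>Basis. (\<xi> q \<bullet> b) *\<^sub>R L b G q)"
    by (intro smooth_sum smooth_scaleR smooth_inner smooth_const smooth_L assms finite_Basis)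
qed (simp add: L_sum_Basis[OF assms(1), symmetric])

lemma L_cong:
  assumes "smooth U F" "p \<in> U" "\<And>q. q \<in> U \<Longrightarrow> F q = G q"
  shows "L a F p = L a G p" "T F p = T G p"
proof -
  have "(G has_derivative frechet_derivative F (at p)) (at p)"
    using has_derivative_transform_within_open[OF derivative_at[OF assms(1,2)] open_U assms(2)] assms(3) by blast
  from L_eqI[OF this] T_eqI[OF this] show "L a F p = L a G p" "T F p = T G p"
    by (simp_all add: L_def T_def)
qed

lemma L_scale_field:
  assumes "smooth U g" "smooth U G" "p \<in> U"
  shows "L a (\<lambda>q. g q *\<^sub>R G q) p = g p *\<^sub>R L a G p + L a g p *\<^sub>R G p"
    and "T (\<lambda>q. g q *\<^sub>R G q) p = g p *\<^sub>R T G p + T g p *\<^sub>R G p"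
  using has_derivative_scaleR[OF derivative_at[OF assms(1,3)] derivative_at[OF assms(2,3)]]
  by (simp_all add: L_eqI T_eqI) (simp_all add: L_def T_def)

lemma L_mult_field:
  assumes "smooth U g" "smooth U h" "p \<in> U"
  shows "L a (\<lambda>q. g q * h q) p = g p * L a h p + L a g p * (h p :: real)"
    and "T (\<lambda>q. g q * h q) p = g p * T h p + T g p * (h p :: real)"
  using L_scale_field[OF assms] by simp_all

lemma L_inner_field:
  assumes "smooth U F" "smooth U G" "p \<in> U"
  shows "L a (\<lambda>q. F q \<bullet> G q) p = F p \<bullet> L a G p + L a F p \<bullet> G p"
    and "T (\<lambda>q. F q \<bullet> G q) p = F p \<bullet> T G p + T F p \<bullet> G p"
  using has_derivative_inner[OF derivative_at[OF assms(1,3)] derivative_at[OF assms(2,3)]]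
  by (simp_all add: L_eqI T_eqI) (simp_all add: L_def T_def)

lemma L_add_field:
  assumes "smooth U F" "smooth U G" "p \<in> U"
  shows "L a (\<lambda>q. F q + G q) p = L a F p + L a G p" "T (\<lambda>q. F q + G q) p = T F p + T G p"
  using has_derivative_add[OF derivative_at[OF assms(1,3)] derivative_at[OF assms(2,3)]]
  by (simp_all add: L_eqI T_eqI) (simp_all add: L_def T_def)

lemma L_diff_field:
  assumes "smooth U F" "smooth U G" "p \<in> U"
  shows "L a (\<lambda>q. F q - G q) p = L a F p - L a G p" "T (\<lambda>q. F q - G q) p = T F p - T G p"
  using has_derivative_diff[OF derivative_at[OF assms(1,3)] derivative_at[OF assms(2,3)]]
  by (simp_all add: L_eqI T_eqI) (simp_all add: L_def T_def)

lemma L_const [simp]: "L a (\<lambda>q. C) p = 0" "T (\<lambda>q. C) p = 0"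
  by (simp_all add: L_def T_def)

lemma L_minus_field:
  assumes "smooth U F" "p \<in> U"
  shows "L a (\<lambda>q. - F q) p = - L a F p" "T (\<lambda>q. - F q) p = - T F p"
  using has_derivative_minus[OF derivative_at[OF assms]]
  by (simp_all add: L_eqI T_eqI) (simp_all add: L_def T_def)

lemma L_rot_field:
  assumes "smooth U F" "p \<in> U"
  shows "L a (\<lambda>q. rot (F q)) p = rot (L a F p)"
  using bounded_linear.has_derivative[OF bounded_linear_rot derivative_at[OF assms]]
  by (simp add: L_eqI) (simp add: L_def)

lemma derivative_of_L:
  assumes "smooth U G" "p \<in> U"
  shows "(L b G has_derivative (\<lambda>v. frechet_derivative (\<lambda>q. frechet_derivative G (at q) (b, 0)) (at p) v
     - ((rot (fst p) \<bullet> b) *\<^sub>R frechet_derivative (T G) (at p) v + (rot (fst v) \<bullet> b) *\<^sub>R T G p))) (at p)"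
proof -
  have "((\<lambda>q. frechet_derivative G (at q) (b, 0) - (rot (fst q) \<bullet> b) *\<^sub>R T G q) has_derivative
     (\<lambda>v. frechet_derivative (\<lambda>q. frechet_derivative G (at q) (b, 0)) (at p) v
     - ((rot (fst p) \<bullet> b) *\<^sub>R frechet_derivative (T G) (at p) v + (rot (fst v) \<bullet> b) *\<^sub>R T G p))) (at p)"
    by (intro has_derivative_diff has_derivative_scaleR derivative_at smooth_deriv open_U smooth_T assms
        has_derivative_inner_left bounded_linear.has_derivative[OF bounded_linear_rot]
        has_derivative_fst has_derivative_ident)
  then show ?thesis
    by (rule has_derivative_transform_within_open[OF _ open_U assms(2)]) (simp add: L_eq assms)
qed

text \<open>Second derivatives of \<open>G\<close> cancel by symmetry. What remains comes from
  differentiating the coefficient \<open>rot (fst p) \<bullet> b\<close> of \<open>T\<close> in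
  \<open>L b\<close>: the bracket relation of the Heisenberg algebra.\<close>

lemma commutator:
  assumes "smooth U G" "p \<in> U"
  shows "L a (L b G) p - L b (L a G) p = (- 2 * (rot a \<bullet> b)) *\<^sub>R T G p"
proof -
  define g where "g b = (\<lambda>q. frechet_derivative G (at q) (b, 0))" for b
  have sg: "smooth U (g b)" for b unfolding g_def by (rule smooth_deriv[OF open_U assms(1)])
  have gg: "frechet_derivative (g b) (at p) (a, 0) = frechet_derivative (g a) (at p) (b, 0)" for a b
    unfolding g_def by (rule mixed_derivatives[OF open_U assms])
  have gT: "T (g b) p = frechet_derivative (T G) (at p) (b, 0)" for b
    unfolding T_def g_def by (rule mixed_derivatives[OF open_U assms])
  have *: "L a (L b G) p = frechet_derivative (g b) (at p) (a, 0) - (rot (fst p) \<bullet> a) *\<^sub>R T (g b) p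
     - (rot (fst p) \<bullet> b) *\<^sub>R (T (g a) p - (rot (fst p) \<bullet> a) *\<^sub>R T (T G) p) - (rot a \<bullet> b) *\<^sub>R T G p" for a b
  proof -
    have "L a (L b G) p = frechet_derivative (g b) (at p) (hor p a)
     - ((rot (fst p) \<bullet> b) *\<^sub>R frechet_derivative (T G) (at p) (hor p a) + (rot (fst (hor p a)) \<bullet> b) *\<^sub>R T G p)"
      unfolding g_def by (rule L_eqI[OF derivative_of_L[OF assms]])
    also have "frechet_derivative (g b) (at p) (hor p a) = L a (g b) p" by (simp add: L_def)
    also have "frechet_derivative (T G) (at p) (hor p a) = L a (T G) p" by (simp add: L_def)
    also have "L a (g b) p = frechet_derivative (g b) (at p) (a, 0) - (rot (fst p) \<bullet> a) *\<^sub>R T (g b) p"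
      by (rule L_eq[OF sg assms(2)])
    also have "L a (T G) p = T (g a) p - (rot (fst p) \<bullet> a) *\<^sub>R T (T G) p"
      unfolding gT by (rule L_eq[OF smooth_T[OF assms(1)] assms(2)])
    finally show ?thesis by (simp add: hor_def)
  qed
  have anti: "rot b \<bullet> a = - (rot a \<bullet> b)" by (metis inner_rot_left inner_commute)
  show ?thesis unfolding *[of a b] *[of b a] gg[of b a] anti
    by (simp add: algebra_simps) (simp add: scaleR_2 flip: scaleR_add_left)
qed

lemma T_L_commute:
  assumes "smooth U G" "p \<in> U"
  shows "T (L b G) p = L b (T G) p"
proof -
  have "T (L b G) p = frechet_derivative (\<lambda>q. frechet_derivative G (at q) (b, 0)) (at p) (0, 1)
     - ((rot (fst p) \<bullet> b) *\<^sub>R frechet_derivative (T G) (at p) (0, 1) + (rot (fst (0::(complex, 'n) vec, 1::real)) \<bullet> b) *\<^sub>R T G p)"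
    by (rule T_eqI[OF derivative_of_L[OF assms]])
  also have "frechet_derivative (\<lambda>q. frechet_derivative G (at q) (b, 0)) (at p) (0, 1)
     = frechet_derivative (T G) (at p) (b, 0)"
    unfolding T_def by (rule mixed_derivatives[OF open_U assms])
  finally show ?thesis
    by (simp add: rot_zero L_eq[OF smooth_T[OF assms(1)] assms(2)]) (simp add: T_def)
qed

text \<open>The direction is itself a field here; the first summand is the price of differentiating
  it.\<close>

lemma L_L_field:
  assumes "smooth U G" "smooth U \<xi>" "p \<in> U"
  shows "L a (\<lambda>q. L (\<xi> q) G q) p = L (L a \<xi> p) G p + L a (L (\<xi> p) G) p"
proof -
  have d: "((\<lambda>q. \<Sum>b\<in>Basis. (\<xi> q \<bullet> b) *\<^sub>R L b G q) has_derivative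
     (\<lambda>v. \<Sum>b\<in>Basis. (\<xi> p \<bullet> b) *\<^sub>R frechet_derivative (L b G) (at p) v +
        (frechet_derivative \<xi> (at p) v \<bullet> b) *\<^sub>R L b G p)) (at p)"
    by (intro has_derivative_sum has_derivative_scaleR has_derivative_inner_left derivative_at assms smooth_L)
  have d2: "(L w G has_derivative (\<lambda>v. \<Sum>b\<in>Basis. (w \<bullet> b) *\<^sub>R frechet_derivative (L b G) (at p) v)) (at p)" for w
  proof (rule has_derivative_transform_within_open[OF _ open_U assms(3)])
    show "((\<lambda>q. \<Sum>b\<in>Basis. (w \<bullet> b) *\<^sub>R L b G q) has_derivative
       (\<lambda>v. \<Sum>b\<in>Basis. (w \<bullet> b) *\<^sub>R frechet_derivative (L b G) (at p) v)) (at p)"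
      by (intro has_derivative_sum has_derivative_scaleR_right derivative_at assms smooth_L)
  qed (simp add: L_sum_Basis[OF assms(1), symmetric])
  have "((\<lambda>q. L (\<xi> q) G q) has_derivative
     (\<lambda>v. \<Sum>b\<in>Basis. (\<xi> p \<bullet> b) *\<^sub>R frechet_derivative (L b G) (at p) v +
        (frechet_derivative \<xi> (at p) v \<bullet> b) *\<^sub>R L b G p)) (at p)"
    by (rule has_derivative_transform_within_open[OF d open_U assms(3)])
       (simp add: L_sum_Basis[OF assms(1), symmetric])
  from L_eqI[OF this] have "L a (\<lambda>q. L (\<xi> q) G q) p =
    (\<Sum>b\<in>Basis. (\<xi> p \<bullet> b) *\<^sub>R L a (L b G) p) + (\<Sum>b\<in>Basis. (L a \<xi> p \<bullet> b) *\<^sub>R L b G p)"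
    by (simp add: sum.distrib L_def)
  also have "(\<Sum>b\<in>Basis. (\<xi> p \<bullet> b) *\<^sub>R L a (L b G) p) = L a (L (\<xi> p) G) p"
    using L_eqI[OF d2, of a "\<xi> p"] by (simp add: L_def)
  also have "(\<Sum>b\<in>Basis. (L a \<xi> p \<bullet> b) *\<^sub>R L b G p) = L (L a \<xi> p) G p"
    by (rule L_sum_Basis[OF assms(1,3), symmetric])
  finally show ?thesis by simp
qed

end

section \<open>The Codazzi equations\<close>

lemma vec_double: "(x :: (complex, 'n::finite) vec) * 2 = 2 *\<^sub>R x" "2 * x = 2 *\<^sub>R x"
  by (simp_all add: vec_eq_iff scaleR_conv_of_real)

text \<open>Provides nonzero vectors of \<open>\<xi>'\<close>: the two given vectors span at most
  two of at least four real dimensions.\<close>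

lemma exists_complex_orthogonal:
  assumes "CARD('n::finite) \<ge> 2"
  shows "\<exists>X::(complex, 'n) vec. X \<noteq> 0 \<and> X \<bullet> \<nu> = 0 \<and> X \<bullet> rot \<nu> = 0"
proof -
  have "dim {\<nu>, rot \<nu>} \<le> card {\<nu>, rot \<nu>}" by (intro dim_le_card) (auto intro: span_superset[THEN subsetD])
  also have "\<dots> \<le> 2" by (simp add: card_insert_if)
  also have "2 < DIM((complex, 'n) vec)" using assms by simp
  finally have "dim {\<nu>, rot \<nu>} < DIM((complex, 'n) vec)" .
  from orthogonal_to_subspace_exists[OF this] obtain X :: "(complex, 'n) vec" where "X \<noteq> 0" "\<forall>y\<in>span {\<nu>, rot \<nu>}. orthogonal X y"
    by (metis orthogonal_commute)
  moreover have "\<nu> \<in> span {\<nu>, rot \<nu>}" "rot \<nu> \<in> span {\<nu>, rot \<nu>}" by (auto intro: span_base)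
  ultimately show ?thesis by (auto simp: orthogonal_def)
qed

text \<open>All fields are extended to an open set so that the commutators of left-invariant
  derivatives apply to them. The shape equations hold on \<open>S\<close> only, so they may be
  differentiated only in tangential directions; the other identities hold on all of
  \<open>U\<close>. The factor \<open>\<rho>\<close> is the length of the horizontal gradient of
  \<open>f\<close>.\<close>

locale umbilic_patch = smooth_domain U
  for U :: "'n::finite heis set" +
  fixes S :: "'n heis set" and f \<rho> \<alpha> k l :: "'n heis \<Rightarrow> real" and \<nu> :: "'n heis \<Rightarrow> (complex, 'n) vec"
    and c :: real
  assumes n2: "CARD('n) \<ge> 2"
    and leq: "local_equation S U f (\<lambda>x. frechet_derivative f (at x))"
    and smooth_f: "smooth U f" and smooth_\<rho>: "smooth U \<rho>" and smooth_\<alpha>: "smooth U \<alpha>"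
    and smooth_k: "smooth U k" and smooth_l: "smooth U l" and smooth_\<nu>: "smooth U \<nu>"
    and \<rho>_pos: "q \<in> U \<Longrightarrow> \<rho> q > 0"
    and L_f: "q \<in> U \<Longrightarrow> L a f q = \<rho> q * (\<nu> q \<bullet> a)"
    and T_f: "q \<in> U \<Longrightarrow> T f q = - (\<rho> q * \<alpha> q)"
    and \<nu>_unit: "q \<in> U \<Longrightarrow> \<nu> q \<bullet> \<nu> q = 1"
    and mean: "q \<in> U \<Longrightarrow> l q + (2 * real CARD('n) - 2) * k q = c"
    and shape_xi: "q \<in> S \<inter> U \<Longrightarrow> X \<bullet> \<nu> q = 0 \<Longrightarrow> X \<bullet> rot (\<nu> q) = 0 \<Longrightarrow>
        L X \<nu> q = - k q *\<^sub>R X + \<alpha> q *\<^sub>R rot X"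
    and shape_e: "q \<in> S \<inter> U \<Longrightarrow> L (rot (\<nu> q)) \<nu> q = - l q *\<^sub>R rot (\<nu> q)"
begin

lemma tangent_iff: "p \<in> S \<inter> U \<Longrightarrow> v \<in> tangent_space S p \<longleftrightarrow> frechet_derivative f (at p) v = 0"
  using tangent_space_eq_kernel[OF leq] by auto

text \<open>By \<open>L_f\<close>, horizontal directions orthogonal to \<open>\<nu>\<close> are
  tangent to \<open>S\<close>, and there the derivative of \<open>G\<close> agrees with that of the
  zero function.\<close>

lemma L_vanish:
  assumes "smooth U G" "\<And>q. q \<in> S \<inter> U \<Longrightarrow> G q = 0" "p \<in> S \<inter> U" "a \<bullet> \<nu> p = 0"
  shows "L a G p = 0"
proof -
  have t: "hor p a \<in> tangent_space S p"
    using L_f[of p a] assms(3,4) by (simp add: tangent_iff L_def inner_commute)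
  have pU: "p \<in> U" "p \<in> S" using assms(3) by auto
  obtain d where d: "d > 0" "ball p d \<subseteq> U" using open_U pU openE by blast
  have "((\<lambda>q. 0) has_derivative frechet_derivative G (at p)) (at p within S)"
  proof (rule has_derivative_transform_within[OF has_derivative_at_withinI[OF derivative_at[OF assms(1) pU(1)]] d(1) pU(2)])
    fix x assume "x \<in> S" "dist x p < d"
    then have "x \<in> S \<inter> U" using d(2) by (auto simp: dist_commute)
    then show "G x = 0" using assms(2) by blast
  qed
  from derivative_within_unique_on_tangent[OF t this, of "\<lambda>v. 0"] show ?thesis
    by (simp add: L_def)
qed

lemma L_\<nu>_\<nu>: "p \<in> U \<Longrightarrow> L a \<nu> p \<bullet> \<nu> p = 0"
proof -
  assume p: "p \<in> U"
  have "L a (\<lambda>q. \<nu> q \<bullet> \<nu> q) p = L a (\<lambda>q. 1 :: real) p"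
    using \<nu>_unit by (intro L_cong smooth_inner smooth_\<nu> p) auto
  then show ?thesis
    by (simp add: L_inner_field[OF smooth_\<nu> smooth_\<nu> p] inner_commute)
qed

text \<open>Extends a vector \<open>w\<close> of \<open>\<xi>'\<close> at \<open>p\<close> to a
  field in \<open>\<xi>'\<close>, so that \<open>shape_xi\<close> can be applied at nearby points
  and then differentiated.\<close>

definition P :: "(complex, 'n) vec \<Rightarrow> 'n heis \<Rightarrow> (complex, 'n) vec" where
  "P w q = w - ((w \<bullet> \<nu> q) *\<^sub>R \<nu> q + (w \<bullet> rot (\<nu> q)) *\<^sub>R rot (\<nu> q))"

lemma smooth_P: "smooth U (P w)"
  unfolding P_def
  by (intro smooth_sub smooth_add smooth_scaleR smooth_inner smooth_const smooth_rot smooth_\<nu>)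

lemma P_orth: "q \<in> U \<Longrightarrow> P w q \<bullet> \<nu> q = 0" "q \<in> U \<Longrightarrow> P w q \<bullet> rot (\<nu> q) = 0"
  by (simp_all add: P_def inner_simps \<nu>_unit)

lemma P_id: "w \<bullet> \<nu> p = 0 \<Longrightarrow> w \<bullet> rot (\<nu> p) = 0 \<Longrightarrow> P w p = w"
  by (simp add: P_def)

lemma L_P:
  assumes "p \<in> U" "w \<bullet> \<nu> p = 0" "w \<bullet> rot (\<nu> p) = 0"
  shows "L a (P w) p = - ((w \<bullet> L a \<nu> p) *\<^sub>R \<nu> p + (w \<bullet> rot (L a \<nu> p)) *\<^sub>R rot (\<nu> p))"
  unfolding P_def
  by (simp add: L_diff_field L_add_field L_scale_field L_inner_field L_rot_field smooth_sub smooth_add smooth_scaleR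
      smooth_inner smooth_const smooth_rot smooth_\<nu> assms)

text \<open>The derivative along \<open>a\<close> of \<open>shape_xi\<close> for the field
  \<open>P w\<close>; the first term appears because this field varies.\<close>

lemma xi_equation:
  assumes "p \<in> S \<inter> U" "w \<bullet> \<nu> p = 0" "w \<bullet> rot (\<nu> p) = 0" "a \<bullet> \<nu> p = 0"
  shows "L (L a (P w) p) \<nu> p + L a (L w \<nu>) p
     + (k p *\<^sub>R L a (P w) p + L a k p *\<^sub>R w)
     - (\<alpha> p *\<^sub>R rot (L a (P w) p) + L a \<alpha> p *\<^sub>R rot w) = 0"
proof -
  have p: "p \<in> U" using assms by simp
  define E where "E q = (L (P w q) \<nu> q + k q *\<^sub>R P w q) - \<alpha> q *\<^sub>R rot (P w q)" for q
  have "L a E p = 0"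
  proof (rule L_vanish[OF _ _ assms(1,4)])
    show "smooth U E" unfolding E_def
      by (intro smooth_sub smooth_add smooth_L_field smooth_scaleR smooth_rot smooth_P smooth_\<nu> smooth_k smooth_\<alpha>)
    show "E q = 0" if "q \<in> S \<inter> U" for q
      using shape_xi[OF that P_orth] that by (simp add: E_def)
  qed
  then show ?thesis
    using P_id[OF assms(2,3)]
    unfolding E_def
    by (simp add: L_diff_field L_add_field L_scale_field L_rot_field L_L_field smooth_sub smooth_add smooth_scaleR
      smooth_L_field smooth_rot smooth_\<nu> smooth_k smooth_\<alpha> smooth_P p)
qed

lemma e_equation:
  assumes "p \<in> S \<inter> U" "a \<bullet> \<nu> p = 0"
  shows "L (rot (L a \<nu> p)) \<nu> p + L a (L (rot (\<nu> p)) \<nu>) p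
     + (l p *\<^sub>R rot (L a \<nu> p) + L a l p *\<^sub>R rot (\<nu> p)) = 0"
proof -
  have p: "p \<in> U" using assms by simp
  define E where "E q = L (rot (\<nu> q)) \<nu> q + l q *\<^sub>R rot (\<nu> q)" for q
  have "L a E p = 0"
  proof (rule L_vanish[OF _ _ assms])
    show "smooth U E" unfolding E_def
      by (intro smooth_add smooth_L_field smooth_scaleR smooth_rot smooth_\<nu> smooth_l)
    show "E q = 0" if "q \<in> S \<inter> U" for q
      using shape_e[OF that] by (simp add: E_def)
  qed
  then show ?thesis
    unfolding E_def
    by (simp add: L_add_field L_scale_field L_rot_field L_L_field smooth_add smooth_scaleR
      smooth_L_field smooth_rot smooth_\<nu> smooth_l p)
qed

text \<open>From differentiating \<open>shape_e\<close> along \<open>X\<close> and \<open>shape_xi\<close> along \<open>J\<nu>\<close>.\<close>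
lemma codazzi_e:
  assumes p: "p \<in> S \<inter> U" and X: "X \<bullet> \<nu> p = 0" "X \<bullet> rot (\<nu> p) = 0"
  shows "(- L (rot (\<nu> p)) k p + (2 * k p - l p) * \<alpha> p) *\<^sub>R X
     + (L (rot (\<nu> p)) \<alpha> p - (\<alpha> p)\<^sup>2 - k p * (l p - k p)) *\<^sub>R rot X
     + L X l p *\<^sub>R rot (\<nu> p) = 0"
proof -
  have pU: "p \<in> U" using p by simp
  let ?Y = "rot (\<nu> p)"
  define Z where "Z = - k p *\<^sub>R X + \<alpha> p *\<^sub>R rot X"
  have LX: "L X \<nu> p = Z" unfolding Z_def by (rule shape_xi[OF p X])
  have X': "rot X \<bullet> \<nu> p = 0" "rot X \<bullet> ?Y = 0" using X by (simp_all add: inner_rot_left rot_rot)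
  have LY: "L ?Y \<nu> p = - l p *\<^sub>R ?Y" by (rule shape_e[OF p])
  have LP: "L ?Y (P X) p = 0"
    using X by (simp add: L_P[OF pU X] LY rot_simps)
  have Z': "rot Z \<bullet> \<nu> p = 0" "rot Z \<bullet> ?Y = 0"
    using X X' by (simp_all add: Z_def rot_simps inner_simps)
  have LZ: "L (rot Z) \<nu> p = - k p *\<^sub>R rot Z - \<alpha> p *\<^sub>R Z"
    using shape_xi[OF p Z'] by (simp add: rot_simps)
  have 1: "L X (L ?Y \<nu>) p - L ?Y (L X \<nu>) p = 0"
    using commutator[OF smooth_\<nu> pU, of X ?Y] X by simp
  have 2: "L ?Y (L X \<nu>) p + L ?Y k p *\<^sub>R X - L ?Y \<alpha> p *\<^sub>R rot X = 0"
    using xi_equation[OF p X, of ?Y] LP by (simp add: L_zero smooth_\<nu> pU rot_zero)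
  have 3: "- k p *\<^sub>R rot Z - \<alpha> p *\<^sub>R Z + L X (L ?Y \<nu>) p + (l p *\<^sub>R rot Z + L X l p *\<^sub>R ?Y) = 0"
    using e_equation[OF p X(1)] by (simp add: LX LZ)
  have "- L ?Y k p *\<^sub>R X + L ?Y \<alpha> p *\<^sub>R rot X + (l p - k p) *\<^sub>R rot Z - \<alpha> p *\<^sub>R Z + L X l p *\<^sub>R ?Y
    = (- k p *\<^sub>R rot Z - \<alpha> p *\<^sub>R Z + L X (L ?Y \<nu>) p + (l p *\<^sub>R rot Z + L X l p *\<^sub>R ?Y))
    - (L ?Y (L X \<nu>) p + L ?Y k p *\<^sub>R X - L ?Y \<alpha> p *\<^sub>R rot X)
    - (L X (L ?Y \<nu>) p - L ?Y (L X \<nu>) p)"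
    by (simp add: algebra_simps)
  also have "\<dots> = 0" unfolding 1 2 3 by simp
  finally have "- L ?Y k p *\<^sub>R X + L ?Y \<alpha> p *\<^sub>R rot X + (l p - k p) *\<^sub>R rot Z - \<alpha> p *\<^sub>R Z
    + L X l p *\<^sub>R ?Y = 0" .
  then show ?thesis
    by (simp add: vec_double Z_def rot_simps algebra_simps power2_eq_square)
qed

text \<open>The vectors \<open>X\<close>, \<open>rot X\<close> and \<open>rot (\<nu> p)\<close> are
  orthogonal, so each coefficient in \<open>codazzi_e\<close> vanishes separately; the last two
  parts use some nonzero \<open>X\<close>.\<close>

lemma codazzi_e_components:
  assumes p: "p \<in> S \<inter> U"
  shows "X \<bullet> \<nu> p = 0 \<Longrightarrow> X \<bullet> rot (\<nu> p) = 0 \<Longrightarrow> L X l p = 0"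
    and "L (rot (\<nu> p)) k p = (2 * k p - l p) * \<alpha> p"
    and "L (rot (\<nu> p)) \<alpha> p = (\<alpha> p)\<^sup>2 - (k p)\<^sup>2 + k p * l p"
proof -
  have pU: "p \<in> U" using p by simp
  show "L X l p = 0" if X: "X \<bullet> \<nu> p = 0" "X \<bullet> rot (\<nu> p) = 0"
  proof -
    have "rot X \<bullet> rot (\<nu> p) = 0" using X by simp
    then show ?thesis
      using arg_cong[OF codazzi_e[OF p X], of "\<lambda>x. x \<bullet> rot (\<nu> p)"] X \<nu>_unit[OF pU] by (simp add: inner_simps)
  qed
  obtain X where X: "X \<noteq> 0" "X \<bullet> \<nu> p = 0" "X \<bullet> rot (\<nu> p) = 0"
    using exists_complex_orthogonal[OF n2] by blast
  have XX: "X \<bullet> X \<noteq> 0" using X(1) by simp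
  have "rot (\<nu> p) \<bullet> X = 0" using X(3) by (simp add: inner_commute)
  then show "L (rot (\<nu> p)) k p = (2 * k p - l p) * \<alpha> p"
    using arg_cong[OF codazzi_e[OF p X(2,3)], of "\<lambda>x. x \<bullet> X"] XX by (simp add: inner_simps)
  have "rot (\<nu> p) \<bullet> rot X = 0" using X(2) by (simp add: inner_commute)
  show "L (rot (\<nu> p)) \<alpha> p = (\<alpha> p)\<^sup>2 - (k p)\<^sup>2 + k p * l p"
  proof -
    have "(X \<bullet> X) * (L (rot (\<nu> p)) \<alpha> p - ((\<alpha> p)\<^sup>2 - (k p)\<^sup>2 + k p * l p)) = 0"
      using arg_cong[OF codazzi_e[OF p X(2,3)], of "\<lambda>x. x \<bullet> rot X"] \<open>rot (\<nu> p) \<bullet> rot X = 0\<close>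
      by (simp add: inner_simps algebra_simps power2_eq_square)
    then show ?thesis using XX by simp
  qed
qed

text \<open>\<open>mean\<close> determines \<open>k\<close> from \<open>l\<close>, whose derivative
  along \<open>X\<close> vanishes by \<open>codazzi_e_components\<close>.\<close>

lemma L_k_xi:
  assumes p: "p \<in> S \<inter> U" and X: "X \<bullet> \<nu> p = 0" "X \<bullet> rot (\<nu> p) = 0"
  shows "L X k p = 0"
proof -
  have pU: "p \<in> U" using p by simp
  have "L X (\<lambda>q. l q + (2 * real CARD('n) - 2) * k q) p = L X (\<lambda>q. c) p"
    by (intro L_cong smooth_add smooth_mult smooth_const smooth_k smooth_l pU mean)
  then have "(2 * real CARD('n) - 2) * L X k p = 0"
    using codazzi_e_components(1)[OF p X]
    by (simp add: L_add_field L_mult_field smooth_mult smooth_const smooth_k smooth_l pU)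
  then show ?thesis using n2 by simp
qed

text \<open>The derivative of \<open>\<nu>\<close> along the tangent field \<open>\<alpha> e\<^sub>2\<^sub>n + T\<close>.\<close>
definition V0\<nu> :: "'n heis \<Rightarrow> (complex, 'n) vec" where
  "V0\<nu> p = T \<nu> p + \<alpha> p *\<^sub>R L (\<nu> p) \<nu> p"

text \<open>An integrability condition of \<open>f\<close>: the commutator of \<open>L X\<close> and
  \<open>L (\<nu> p)\<close> on \<open>f\<close> gives the derivative of \<open>\<rho>\<close> along
  \<open>X\<close>, and then commuting \<open>T\<close> with \<open>L X\<close> gives that of
  \<open>\<alpha>\<close>.\<close>

lemma L_\<alpha>_xi_V0:
  assumes p: "p \<in> U" and X: "X \<bullet> \<nu> p = 0" "X \<bullet> rot (\<nu> p) = 0"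
  shows "L X \<alpha> p = - (V0\<nu> p \<bullet> X)"
proof -
  have sLf: "smooth U (\<lambda>q. \<rho> q * (\<nu> q \<bullet> a))" for a
    by (intro smooth_mult smooth_inner smooth_const smooth_\<rho> smooth_\<nu>)
  have sTf: "smooth U (\<lambda>q. \<rho> q * \<alpha> q)"
    by (intro smooth_mult smooth_\<rho> smooth_\<alpha>)
  have LL: "L b (L a f) p = \<rho> p * (L b \<nu> p \<bullet> a) + L b \<rho> p * (\<nu> p \<bullet> a)" for a b
  proof -
    have "L b (L a f) p = L b (\<lambda>q. \<rho> q * (\<nu> q \<bullet> a)) p"
      using L_f by (intro L_cong(1) smooth_L smooth_f p) auto
    then show ?thesis
      by (simp add: L_mult_field L_inner_field smooth_inner smooth_const smooth_\<rho> smooth_\<nu> p)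
  qed
  have TL: "T (L a f) p = \<rho> p * (T \<nu> p \<bullet> a) + T \<rho> p * (\<nu> p \<bullet> a)" for a
  proof -
    have "T (L a f) p = T (\<lambda>q. \<rho> q * (\<nu> q \<bullet> a)) p"
      using L_f by (intro L_cong(2) smooth_L smooth_f p) auto
    then show ?thesis
      by (simp add: L_mult_field L_inner_field smooth_inner smooth_const smooth_\<rho> smooth_\<nu> p)
  qed
  have LT: "L a (T f) p = - (\<rho> p * L a \<alpha> p + L a \<rho> p * \<alpha> p)" for a
  proof -
    have "L a (T f) p = L a (\<lambda>q. - (\<rho> q * \<alpha> q)) p"
      using T_f by (intro L_cong(1) smooth_T smooth_f p) auto
    then show ?thesis
      by (simp add: L_mult_field L_minus_field sTf smooth_\<rho> smooth_\<alpha> p)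
  qed
  have nX: "\<nu> p \<bullet> X = 0" using X(1) by (simp add: inner_commute)
  have "L X (L (\<nu> p) f) p - L (\<nu> p) (L X f) p = 0"
    using commutator[OF smooth_f p, of X "\<nu> p"] X(2) by (simp add: inner_rot_left)
  then have "L X \<rho> p = \<rho> p * (L (\<nu> p) \<nu> p \<bullet> X)"
    by (simp add: LL nX L_\<nu>_\<nu>[OF p] \<nu>_unit[OF p])
  moreover have "\<rho> p * (T \<nu> p \<bullet> X) = - (\<rho> p * L X \<alpha> p + L X \<rho> p * \<alpha> p)"
    using T_L_commute[OF smooth_f p, of X] by (simp add: TL LT nX)
  ultimately have "\<rho> p * L X \<alpha> p = \<rho> p * (- (V0\<nu> p \<bullet> X))"
    by (simp add: V0\<nu>_def inner_simps algebra_simps)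
  then show ?thesis unfolding mult_cancel_left using \<rho>_pos[OF p] by auto
qed

text \<open>The two derivatives are opposite. With the commutator of \<open>L X\<close> and
  \<open>L (rot X)\<close> they make the bracket of the fields \<open>P X\<close> and
  \<open>P (rot X)\<close> equal to \<open>- 2 (X \<bullet> X) V\<close> at \<open>p\<close>, where
  \<open>V = \<alpha> \<nu> - k J\<nu> + T\<close>. This is the origin of \<open>V\<close>.\<close>

lemma L_P_rot:
  assumes p: "p \<in> S \<inter> U" and X: "X \<bullet> \<nu> p = 0" "X \<bullet> rot (\<nu> p) = 0"
  shows "L X (P (rot X)) p = (X \<bullet> X) *\<^sub>R (k p *\<^sub>R rot (\<nu> p) - \<alpha> p *\<^sub>R \<nu> p)"
    and "L (rot X) (P X) p = - ((X \<bullet> X) *\<^sub>R (k p *\<^sub>R rot (\<nu> p) - \<alpha> p *\<^sub>R \<nu> p))"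
proof -
  have pU: "p \<in> U" using p by simp
  have X': "rot X \<bullet> \<nu> p = 0" "rot X \<bullet> rot (\<nu> p) = 0" using X by (simp_all add: inner_rot_left rot_rot)
  show "L X (P (rot X)) p = (X \<bullet> X) *\<^sub>R (k p *\<^sub>R rot (\<nu> p) - \<alpha> p *\<^sub>R \<nu> p)"
    by (simp add: L_P[OF pU X'] shape_xi[OF p X] rot_simps inner_simps algebra_simps)
  show "L (rot X) (P X) p = - ((X \<bullet> X) *\<^sub>R (k p *\<^sub>R rot (\<nu> p) - \<alpha> p *\<^sub>R \<nu> p))"
    by (simp add: L_P[OF pU X] shape_xi[OF p X'] rot_simps inner_simps algebra_simps)
qed

text \<open>From differentiating \<open>shape_xi\<close> for \<open>J X\<close> along \<open>X\<close> and vice versa.\<close>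
lemma codazzi_xi:
  assumes p: "p \<in> S \<inter> U" and X: "X \<bullet> \<nu> p = 0" "X \<bullet> rot (\<nu> p) = 0"
  shows "(2 * (X \<bullet> X)) *\<^sub>R V0\<nu> p =
     (2 * (X \<bullet> X) * ((k p)\<^sup>2 + (\<alpha> p)\<^sup>2 - k p * l p)) *\<^sub>R rot (\<nu> p) + L X \<alpha> p *\<^sub>R X + L (rot X) \<alpha> p *\<^sub>R rot X"
proof -
  have pU: "p \<in> U" using p by simp
  have X': "rot X \<bullet> \<nu> p = 0" "rot X \<bullet> rot (\<nu> p) = 0" using X by (simp_all add: inner_rot_left rot_rot)
  let ?m = "X \<bullet> X"
  define W where "W = k p *\<^sub>R rot (\<nu> p) - \<alpha> p *\<^sub>R \<nu> p"
  note LP = L_P_rot[OF p X, folded W_def]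
  have LW: "L (r *\<^sub>R W) \<nu> p = r *\<^sub>R L W \<nu> p" for r by (simp add: L_scaleR smooth_\<nu> pU)
  have LW': "L W \<nu> p = - (k p * l p) *\<^sub>R rot (\<nu> p) - \<alpha> p *\<^sub>R L (\<nu> p) \<nu> p"
  proof -
    have "W = k p *\<^sub>R rot (\<nu> p) + (- \<alpha> p) *\<^sub>R \<nu> p" by (simp add: W_def)
    then have "L W \<nu> p = k p *\<^sub>R L (rot (\<nu> p)) \<nu> p + (- \<alpha> p) *\<^sub>R L (\<nu> p) \<nu> p"
      by (simp only: L_add[OF smooth_\<nu> pU] L_scaleR[OF smooth_\<nu> pU])
    then show ?thesis by (simp add: shape_e[OF p])
  qed
  have E1: "?m *\<^sub>R L W \<nu> p + L X (L (rot X) \<nu>) p + k p *\<^sub>R ?m *\<^sub>R W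
     - (\<alpha> p *\<^sub>R ?m *\<^sub>R rot W - L X \<alpha> p *\<^sub>R X) = 0"
    using xi_equation[OF p X' X(1)] L_k_xi[OF p X] by (simp add: LP LW rot_simps)
  have E2: "- (?m *\<^sub>R L W \<nu> p) + L (rot X) (L X \<nu>) p - k p *\<^sub>R ?m *\<^sub>R W
     + \<alpha> p *\<^sub>R ?m *\<^sub>R rot W - L (rot X) \<alpha> p *\<^sub>R rot X = 0"
    using xi_equation[OF p X X'(1)] L_k_xi[OF p X'] LW[of "- ?m"] by (simp add: LP rot_simps)
  have C: "L X (L (rot X) \<nu>) p - L (rot X) (L X \<nu>) p = - (2 * ?m) *\<^sub>R T \<nu> p"
    using commutator[OF smooth_\<nu> pU, of X "rot X"] by simp
  have "2 *\<^sub>R ?m *\<^sub>R L W \<nu> p - (2 * ?m) *\<^sub>R T \<nu> p + 2 *\<^sub>R k p *\<^sub>R ?m *\<^sub>R W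
     - 2 *\<^sub>R \<alpha> p *\<^sub>R ?m *\<^sub>R rot W + L X \<alpha> p *\<^sub>R X + L (rot X) \<alpha> p *\<^sub>R rot X = 0"
  proof -
    have "(?m *\<^sub>R L W \<nu> p + L X (L (rot X) \<nu>) p + k p *\<^sub>R ?m *\<^sub>R W
     - (\<alpha> p *\<^sub>R ?m *\<^sub>R rot W - L X \<alpha> p *\<^sub>R X)) - (- (?m *\<^sub>R L W \<nu> p) + L (rot X) (L X \<nu>) p - k p *\<^sub>R ?m *\<^sub>R W
     + \<alpha> p *\<^sub>R ?m *\<^sub>R rot W - L (rot X) \<alpha> p *\<^sub>R rot X) = 0" unfolding E1 E2 by simp
    moreover have "L (rot X) (L X \<nu>) p = L X (L (rot X) \<nu>) p + (2 * ?m) *\<^sub>R T \<nu> p"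
      using C by (simp add: algebra_simps)
    ultimately show ?thesis by (simp add: vec_double algebra_simps)
  qed
  then show ?thesis
    unfolding LW' unfolding V0\<nu>_def W_def
    by (simp add: vec_double rot_simps algebra_simps power2_eq_square)
qed

text \<open>For nonzero \<open>X\<close>, \<open>codazzi_xi\<close> makes
  \<open>V0\<nu> p \<bullet> X\<close> half of \<open>L X \<alpha> p\<close>, while
  \<open>L_\<alpha>_xi_V0\<close> makes it the negative of \<open>L X \<alpha> p\<close>.\<close>

lemma L_\<alpha>_xi:
  assumes p: "p \<in> S \<inter> U" and X: "X \<bullet> \<nu> p = 0" "X \<bullet> rot (\<nu> p) = 0"
  shows "L X \<alpha> p = 0"
proof -
  have pU: "p \<in> U" using p by simp
  have "rot (\<nu> p) \<bullet> X = 0" using X by (simp add: inner_commute)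
  then have "2 * (X \<bullet> X) * (V0\<nu> p \<bullet> X) = L X \<alpha> p * (X \<bullet> X)"
    using arg_cong[OF codazzi_xi[OF p X], of "\<lambda>x. x \<bullet> X"] by (simp add: inner_simps)
  then have "(X \<bullet> X) * L X \<alpha> p = 0" using L_\<alpha>_xi_V0[OF pU X] by (simp add: algebra_simps)
  moreover have "X = 0 \<Longrightarrow> L X \<alpha> p = 0" by (simp add: L_zero smooth_\<alpha> pU)
  ultimately show ?thesis by auto
qed

lemma V0\<nu>_eq:
  assumes p: "p \<in> S \<inter> U"
  shows "V0\<nu> p = ((k p)\<^sup>2 + (\<alpha> p)\<^sup>2 - k p * l p) *\<^sub>R rot (\<nu> p)"
proof -
  obtain X where X: "X \<noteq> 0" "X \<bullet> \<nu> p = 0" "X \<bullet> rot (\<nu> p) = 0"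
    using exists_complex_orthogonal[OF n2] by blast
  have X': "rot X \<bullet> \<nu> p = 0" "rot X \<bullet> rot (\<nu> p) = 0" using X by (simp_all add: inner_rot_left rot_rot)
  have "(2 * (X \<bullet> X)) *\<^sub>R V0\<nu> p = (2 * (X \<bullet> X)) *\<^sub>R ((k p)\<^sup>2 + (\<alpha> p)\<^sup>2 - k p * l p) *\<^sub>R rot (\<nu> p)"
    using codazzi_xi[OF p X(2,3)] L_\<alpha>_xi[OF p X(2,3)] L_\<alpha>_xi[OF p X'] by simp
  then show ?thesis using X(1) unfolding scaleR_cancel_left by simp
qed

text \<open>What is constant along the fields of \<open>\<xi>'\<close> is constant along their
  brackets, and \<open>L_P_rot\<close> finds \<open>V\<close> among these up to a nonzero
  factor.\<close>

lemma V_derivative_zero: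
  fixes g :: "'n heis \<Rightarrow> real"
  assumes p: "p \<in> S \<inter> U" and g: "smooth U g"
    and xi: "\<And>q X. q \<in> S \<inter> U \<Longrightarrow> X \<bullet> \<nu> q = 0 \<Longrightarrow> X \<bullet> rot (\<nu> q) = 0 \<Longrightarrow> L X g q = 0"
  shows "T g p + \<alpha> p * L (\<nu> p) g p - k p * L (rot (\<nu> p)) g p = 0"
proof -
  have pU: "p \<in> U" using p by simp
  obtain X where X: "X \<noteq> 0" "X \<bullet> \<nu> p = 0" "X \<bullet> rot (\<nu> p) = 0"
    using exists_complex_orthogonal[OF n2] by blast
  have X': "rot X \<bullet> \<nu> p = 0" "rot X \<bullet> rot (\<nu> p) = 0" using X by (simp_all add: inner_rot_left rot_rot)
  have eq: "L (L a (P w) p) g p + L a (L w g) p = 0"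
    if "w \<bullet> \<nu> p = 0" "w \<bullet> rot (\<nu> p) = 0" "a \<bullet> \<nu> p = 0" for w a
  proof -
    have "L a (\<lambda>q. L (P w q) g q) p = 0"
      by (rule L_vanish[OF smooth_L_field[OF g smooth_P] _ p that(3)]) (use xi P_orth in auto)
    then show ?thesis by (simp add: L_L_field g smooth_P pU P_id that)
  qed
  let ?m = "X \<bullet> X"
  define W where "W = k p *\<^sub>R rot (\<nu> p) - \<alpha> p *\<^sub>R \<nu> p"
  note LP = L_P_rot[OF p X(2,3), folded W_def]
  have LW: "L (r *\<^sub>R W) g p = r * L W g p" for r by (simp add: L_scaleR g pU)
  have LW': "L W g p = k p * L (rot (\<nu> p)) g p - \<alpha> p * L (\<nu> p) g p"
  proof -
    have "W = k p *\<^sub>R rot (\<nu> p) + (- \<alpha> p) *\<^sub>R \<nu> p" by (simp add: W_def)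
    then have "L W g p = k p *\<^sub>R L (rot (\<nu> p)) g p + (- \<alpha> p) *\<^sub>R L (\<nu> p) g p"
      by (simp only: L_add[OF g pU] L_scaleR[OF g pU])
    then show ?thesis by simp
  qed
  have E1: "?m * L W g p + L X (L (rot X) g) p = 0"
    using eq[OF X' X(2)] by (simp add: LP LW)
  have E2: "- (?m * L W g p) + L (rot X) (L X g) p = 0"
    using eq[OF X(2,3) X'(1)] LW[of "- ?m"] by (simp add: LP)
  have C: "L X (L (rot X) g) p - L (rot X) (L X g) p = - (2 * ?m) * T g p"
    using commutator[OF g pU, of X "rot X"] by simp
  have "2 * ?m * (T g p - L W g p) = 0" unfolding right_diff_distrib using E1 E2 C by linarith
  then show ?thesis using X(1) by (simp add: LW')
qed

text \<open>Tangency forces the component of \<open>v\<close> along \<open>\<nu>\<close>, which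
  gives \<open>v = X + s J\<nu> + \<theta> V\<close>. For \<open>\<nu>\<close> the direction
  \<open>V\<close> contributes \<open>V0\<nu>\<close> minus \<open>k\<close> times the derivative
  along \<open>J\<nu>\<close>; the terms \<open>k l\<close> cancel and
  \<open>k^2 + \<alpha>^2\<close> is left.\<close>

theorem derivative_on_tangent:
  assumes p: "p \<in> S \<inter> U" and v: "v \<in> tangent_space S p"
  defines "\<theta> \<equiv> contact_form p v"
  defines "s \<equiv> fst v \<bullet> rot (\<nu> p) + k p * \<theta>"
  defines "X \<equiv> fst v - ((\<alpha> p * \<theta>) *\<^sub>R \<nu> p + (s - k p * \<theta>) *\<^sub>R rot (\<nu> p))"
  shows "X \<bullet> \<nu> p = 0" "X \<bullet> rot (\<nu> p) = 0"
    and "frechet_derivative \<nu> (at p) v = - k p *\<^sub>R X + \<alpha> p *\<^sub>R rot X - (s * l p) *\<^sub>R rot (\<nu> p)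
       + (\<theta> * ((k p)\<^sup>2 + (\<alpha> p)\<^sup>2)) *\<^sub>R rot (\<nu> p)"
    and "frechet_derivative k (at p) v = s * ((2 * k p - l p) * \<alpha> p)"
    and "frechet_derivative \<alpha> (at p) v = s * ((\<alpha> p)\<^sup>2 - (k p)\<^sup>2 + k p * l p)"
proof -
  have pU: "p \<in> U" using p by simp
  have "frechet_derivative f (at p) v = 0" using v p tangent_iff by blast
  then have "\<rho> p * (\<nu> p \<bullet> fst v) = \<rho> p * (\<alpha> p * \<theta>)"
    unfolding frechet_derivative_decompose[OF smooth_f pU] by (simp add: L_f T_f pU \<theta>_def algebra_simps)
  then have av: "fst v \<bullet> \<nu> p = \<alpha> p * \<theta>" using \<rho>_pos[OF pU] by (simp add: inner_commute)
  show X: "X \<bullet> \<nu> p = 0" "X \<bullet> rot (\<nu> p) = 0"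
    by (simp_all add: X_def s_def inner_simps av \<nu>_unit[OF pU])
  have fv: "fst v = X + ((\<alpha> p * \<theta>) *\<^sub>R \<nu> p + (s - k p * \<theta>) *\<^sub>R rot (\<nu> p))" by (simp add: X_def)
  have dec: "frechet_derivative G (at p) v = L X G p + s *\<^sub>R L (rot (\<nu> p)) G p
     + \<theta> *\<^sub>R (T G p + \<alpha> p *\<^sub>R L (\<nu> p) G p - k p *\<^sub>R L (rot (\<nu> p)) G p)" if G: "smooth U G"
    for G :: "'n heis \<Rightarrow> 'b::euclidean_space"
    unfolding frechet_derivative_decompose[OF G pU] \<theta>_def[symmetric] fv
    by (simp add: L_add L_scaleR G pU) (simp add: algebra_simps)
  show "frechet_derivative \<nu> (at p) v = - k p *\<^sub>R X + \<alpha> p *\<^sub>R rot X - (s * l p) *\<^sub>R rot (\<nu> p)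
       + (\<theta> * ((k p)\<^sup>2 + (\<alpha> p)\<^sup>2)) *\<^sub>R rot (\<nu> p)"
    using V0\<nu>_eq[OF p] unfolding dec[OF smooth_\<nu>] V0\<nu>_def
    by (simp add: shape_xi[OF p X] shape_e[OF p] algebra_simps)
  have "T k p + \<alpha> p *\<^sub>R L (\<nu> p) k p - k p *\<^sub>R L (rot (\<nu> p)) k p = 0"
    unfolding real_scaleR_def by (rule V_derivative_zero[OF p smooth_k]) (rule L_k_xi)
  then show "frechet_derivative k (at p) v = s * ((2 * k p - l p) * \<alpha> p)"
    unfolding dec[OF smooth_k] by (simp only: L_k_xi[OF p X] codazzi_e_components(2)[OF p]) simp
  have "T \<alpha> p + \<alpha> p *\<^sub>R L (\<nu> p) \<alpha> p - k p *\<^sub>R L (rot (\<nu> p)) \<alpha> p = 0"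
    unfolding real_scaleR_def by (rule V_derivative_zero[OF p smooth_\<alpha>]) (rule L_\<alpha>_xi)
  then show "frechet_derivative \<alpha> (at p) v = s * ((\<alpha> p)\<^sup>2 - (k p)\<^sup>2 + k p * l p)"
    unfolding dec[OF smooth_\<alpha>] by (simp only: L_\<alpha>_xi[OF p X] codazzi_e_components(3)[OF p]) simp
qed

end

section \<open>Contact geometry of a hypersurface\<close>

lemma selfadjoint_max_eigenvalue:
  fixes A :: "'a::euclidean_space \<Rightarrow> 'a"
  assumes "linear A" "subspace W" "A ` W \<subseteq> W" "w \<in> W" "w \<noteq> 0"
    and sym: "\<And>x y. x \<in> W \<Longrightarrow> y \<in> W \<Longrightarrow> A x \<bullet> y = x \<bullet> A y"
  obtains x \<mu> where "x \<in> W" "x \<noteq> 0" "A x = \<mu> *\<^sub>R x" "\<And>y. y \<in> W \<Longrightarrow> A y \<bullet> y \<le> \<mu> * (y \<bullet> y)"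
proof -
  let ?K = "W \<inter> sphere 0 1"
  have "compact ?K" using closed_subspace[OF assms(2)] by (simp add: closed_Int_compact)
  moreover have "(1 / norm w) *\<^sub>R w \<in> ?K" using assms(4,5) subspace_scale[OF assms(2)] by simp
  moreover have "continuous_on ?K (\<lambda>x. A x \<bullet> x)"
    by (intro continuous_intros linear_continuous_on) (use assms(1) linear_conv_bounded_linear in blast)
  ultimately obtain x where x: "x \<in> ?K" "\<And>y. y \<in> ?K \<Longrightarrow> A y \<bullet> y \<le> A x \<bullet> x"
    using continuous_attains_sup[of ?K "\<lambda>x. A x \<bullet> x"] by blast
  define \<mu> where "\<mu> = A x \<bullet> x"
  have xW: "x \<in> W" "x \<bullet> x = 1" using x(1) by (auto simp: dot_square_norm)
  have le: "A y \<bullet> y \<le> \<mu> * (y \<bullet> y)" if y: "y \<in> W" for y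
  proof (cases "y = 0")
    case False
    have "(1 / norm y) *\<^sub>R y \<in> ?K" using y False subspace_scale[OF assms(2)] by simp
    from x(2)[OF this] have "(A y \<bullet> y) / (norm y)\<^sup>2 \<le> \<mu>"
      by (simp add: linear_cmul[OF assms(1)] \<mu>_def power2_eq_square)
    then show ?thesis using False by (simp add: divide_le_eq dot_square_norm)
  qed (simp add: linear_0[OF assms(1)])
  \<comment> \<open>\<open>B\<close> is positive semidefinite on \<open>W\<close> and
    \<open>B x \<bullet> x = 0\<close>; testing it on \<open>x + t B x\<close> for a small negative
    \<open>t\<close> forces \<open>B x = 0\<close>.\<close>
  define B where "B y = \<mu> *\<^sub>R y - A y" for y
  have linB: "linear B"
    by (rule linearI) (simp_all add: B_def linear_add[OF assms(1)] linear_cmul[OF assms(1)] algebra_simps)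
  have symB: "B u \<bullet> v = u \<bullet> B v" if "u \<in> W" "v \<in> W" for u v
    using sym[OF that] by (simp add: B_def inner_diff_left inner_diff_right)
  have posB: "0 \<le> B y \<bullet> y" if "y \<in> W" for y
    using le[OF that] by (simp add: B_def inner_diff_left)
  have BW: "B x \<in> W" unfolding B_def using xW assms(2,3) by (intro subspace_diff subspace_scale) auto
  define b where "b = B x \<bullet> B x"
  define d where "d = B (B x) \<bullet> B x"
  have d: "d \<ge> 0" using posB[OF BW] by (simp add: d_def)
  have quad: "0 \<le> 2 * t * b + t\<^sup>2 * d" for t
  proof -
    have "x + t *\<^sub>R B x \<in> W" using xW BW assms(2) by (intro subspace_add subspace_scale) auto
    from posB[OF this] have "0 \<le> B (x + t *\<^sub>R B x) \<bullet> (x + t *\<^sub>R B x)" .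
    also have "B (x + t *\<^sub>R B x) = B x + t *\<^sub>R B (B x)"
      by (simp add: linear_add[OF linB] linear_cmul[OF linB])
    also have "(B x + t *\<^sub>R B (B x)) \<bullet> (x + t *\<^sub>R B x) = B x \<bullet> x + t * b + t * (B (B x) \<bullet> x) + t\<^sup>2 * d"
      by (simp add: inner_simps b_def d_def power2_eq_square algebra_simps)
    also have "B x \<bullet> x = 0" using xW by (simp add: B_def \<mu>_def inner_simps)
    also have "B (B x) \<bullet> x = b"
      using symB[OF BW xW(1)] by (simp add: b_def)
    finally show ?thesis by (simp add: algebra_simps)
  qed
  have "b = 0"
  proof (rule ccontr)
    assume "b \<noteq> 0"
    then have b: "b > 0" by (simp add: b_def)
    \<comment> \<open>At \<open>t = - u\<close> the quadratic becomes \<open>- u^2 (d + 2)\<close>;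
      the summand 1 covers \<open>d = 0\<close>.\<close>
    define u where "u = b / (d + 1)"
    have bu: "b = u * (d + 1)" and u: "u > 0" using b d by (simp_all add: u_def)
    have "0 \<le> 2 * (- u) * b + (- u)\<^sup>2 * d" by (rule quad)
    also have "\<dots> = - (u\<^sup>2 * (d + 2))"
      unfolding bu by (simp add: power2_eq_square algebra_simps)
    also have "\<dots> < 0" using u d by simp
    finally show False by simp
  qed
  then have "A x = \<mu> *\<^sub>R x" by (simp add: b_def B_def)
  then show ?thesis using that[of x \<mu>] xW le by force
qed

text \<open>\<open>umbilic_at\<close> speaks only of eigenvalues that occur; this turns it into the
  shape operator being a multiple of the identity on \<open>\<xi>'\<close>. The largest Rayleigh
  quotients of \<open>A\<close> and \<open>- A\<close> are eigenvalues, so \<open>B = A - k\<close>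
  has zero quadratic form; evaluating it at \<open>y + B y\<close> gives
  \<open>B y = 0\<close>.\<close>

lemma selfadjoint_single_eigenvalue:
  fixes A :: "'a::euclidean_space \<Rightarrow> 'a"
  assumes "linear A" "subspace W" "A ` W \<subseteq> W"
    and sym: "\<And>x y. x \<in> W \<Longrightarrow> y \<in> W \<Longrightarrow> A x \<bullet> y = x \<bullet> A y"
    and eig: "\<And>x \<mu>. x \<in> W \<Longrightarrow> x \<noteq> 0 \<Longrightarrow> A x = \<mu> *\<^sub>R x \<Longrightarrow> \<mu> = k"
    and y: "y \<in> W"
  shows "A y = k *\<^sub>R y"
proof (cases "y = 0")
  case False
  have k1: "A z \<bullet> z \<le> k * (z \<bullet> z)" if z: "z \<in> W" for z
    by (rule selfadjoint_max_eigenvalue[OF assms(1-3) y False sym]) (use eig z in auto)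
  have k2: "A z \<bullet> z \<ge> k * (z \<bullet> z)" if z: "z \<in> W" for z
  proof -
    have "linear (\<lambda>x. - A x)" using assms(1) by (simp add: linear_compose_neg)
    moreover have "(\<lambda>x. - A x) ` W \<subseteq> W" using assms(2,3) subspace_neg by blast
    moreover have "- A x \<bullet> y = x \<bullet> - A y" if "x \<in> W" "y \<in> W" for x y using sym[OF that] by simp
    ultimately obtain x \<mu> where x: "x \<in> W" "x \<noteq> 0" "- A x = \<mu> *\<^sub>R x"
      "\<And>y. y \<in> W \<Longrightarrow> - A y \<bullet> y \<le> \<mu> * (y \<bullet> y)"
      using selfadjoint_max_eigenvalue[of "\<lambda>x. - A x" W y] assms(2) y False by metis
    have "A x = (- \<mu>) *\<^sub>R x" using x(3) by (metis add.inverse_inverse scaleR_minus_left)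
    then have "- \<mu> = k" using eig x(1,2) by blast
    then show ?thesis using x(4)[OF z] by auto
  qed
  define B where "B z = A z - k *\<^sub>R z" for z
  have linB: "linear B"
    by (rule linearI) (simp_all add: B_def linear_add[OF assms(1)] linear_cmul[OF assms(1)] algebra_simps)
  have symB: "B u \<bullet> v = u \<bullet> B v" if "u \<in> W" "v \<in> W" for u v
    using sym[OF that] by (simp add: B_def inner_diff_left inner_diff_right)
  have BB: "B z \<bullet> z = 0" if "z \<in> W" for z using k1[OF that] k2[OF that] by (simp add: B_def inner_diff_left)
  have BW: "B y \<in> W" unfolding B_def using y assms(2,3) by (intro subspace_diff subspace_scale) auto
  have "B (y + B y) \<bullet> (y + B y) = 0" using BB subspace_add[OF assms(2) y BW] by blast
  moreover have "B (B y) \<bullet> y = B y \<bullet> B y"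
    by (rule symB[OF BW y])
  ultimately have "B y \<bullet> B y = 0" using BB[OF y] BB[OF BW] by (simp add: linear_add[OF linB] inner_simps)
  then show ?thesis by (simp add: B_def)
qed (simp add: linear_0[OF assms(1)])

section \<open>Frame formulas and the horizontal gradient of a local equation\<close>

lemma hor_eq_frame_sum:
  "hor p w = (\<Sum>\<beta>\<in>UNIV. Re (w $ \<beta>) *\<^sub>R frame_x \<beta> p + Im (w $ \<beta>) *\<^sub>R frame_y \<beta> p)"
proof (rule prod_eqI)
  have "(\<Sum>\<beta>\<in>UNIV. Re (w $ \<beta>) *\<^sub>R axis \<beta> 1 + Im (w $ \<beta>) *\<^sub>R axis \<beta> \<i>) = w"
  proof (rule vec_eq_iff[THEN iffD2], rule allI)
    fix i
    have "(\<Sum>\<beta>\<in>UNIV. Re (w $ \<beta>) *\<^sub>R axis \<beta> 1 + Im (w $ \<beta>) *\<^sub>R axis \<beta> \<i>) $ i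
      = (\<Sum>\<beta>\<in>UNIV. if \<beta> = i then w $ \<beta> else 0)"
      unfolding sum_component by (rule sum.cong) (auto simp: axis_def complex_eq_iff)
    then show "(\<Sum>\<beta>\<in>UNIV. Re (w $ \<beta>) *\<^sub>R axis \<beta> 1 + Im (w $ \<beta>) *\<^sub>R axis \<beta> \<i>) $ i = w $ i" by simp
  qed
  then show "fst (hor p w) = fst (\<Sum>\<beta>\<in>UNIV. Re (w $ \<beta>) *\<^sub>R frame_x \<beta> p + Im (w $ \<beta>) *\<^sub>R frame_y \<beta> p)"
    by (simp add: hor_def fst_sum frame_x_def frame_y_def)
  show "snd (hor p w) = snd (\<Sum>\<beta>\<in>UNIV. Re (w $ \<beta>) *\<^sub>R frame_x \<beta> p + Im (w $ \<beta>) *\<^sub>R frame_y \<beta> p)"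
    by (simp add: hor_def snd_sum frame_x_def frame_y_def inner_vec_def inner_complex_def rot_nth
        algebra_simps flip: sum_negf)
qed

lemma J_eq: "J p v = hor p (rot (fst v))"
  unfolding J_def hor_eq_frame_sum by (simp add: rot_nth algebra_simps)

lemma levi_eq: "levi v w = fst v \<bullet> fst w"
  by (simp add: levi_def inner_vec_def inner_complex_def)

lemma cov_deriv_eq: "cov_deriv S p v V = hor p (frechet_derivative (\<lambda>q. fst (V q)) (at p within S) v)"
  by (simp add: cov_deriv_def hor_eq_frame_sum Let_def)

lemma fst_hor [simp]: "fst (hor p w) = w"
  by (simp add: hor_def)

lemma contact_form_hor [simp]: "contact_form p (hor p w) = 0"
  by (simp add: contact_form_eq hor_def)

lemma contact_plane_eq: "contact_plane p = range (hor p)"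
proof (intro equalityI subsetI)
  fix v assume "v \<in> contact_plane p"
  then have "v = hor p (fst v)" using hor_decompose[of v p] by (simp add: contact_plane_def flip: zero_prod_def)
  then show "v \<in> range (hor p)" by blast
qed (auto simp: contact_plane_def)

definition hgrad :: "('n::finite heis \<Rightarrow> real) \<Rightarrow> 'n heis \<Rightarrow> (complex, 'n) vec" where
  "hgrad f q = (\<Sum>b\<in>Basis. L b f q *\<^sub>R b)"

context
  fixes S U :: "'n::finite heis set" and f :: "'n heis \<Rightarrow> real"
  assumes leq: "local_equation S U f (\<lambda>x. frechet_derivative f (at x))"
begin

lemma leq_linear: "q \<in> U \<Longrightarrow> linear (frechet_derivative f (at q))"
  using leq has_derivative_linear unfolding local_equation_def by blast

lemma hgrad_inner: "q \<in> U \<Longrightarrow> L a f q = hgrad f q \<bullet> a"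
proof -
  assume q: "q \<in> U"
  have "linear (\<lambda>a. L a f q)"
    unfolding L_def by (rule linearI) (simp_all add: hor_add hor_scaleR linear_add[OF leq_linear[OF q]]
        linear_cmul[OF leq_linear[OF q]])
  from linear_sum[OF this, of "\<lambda>b. (a \<bullet> b) *\<^sub>R b" Basis] linear_cmul[OF this]
  have "L a f q = (\<Sum>b\<in>Basis. (a \<bullet> b) * L b f q)"
    by (simp add: euclidean_representation)
  then show ?thesis
    by (simp add: hgrad_def inner_sum_left mult.commute inner_commute[of a])
qed

lemma leq_derivative: "q \<in> U \<Longrightarrow> frechet_derivative f (at q) v = hgrad f q \<bullet> fst v + contact_form q v * T f q"
proof -
  assume q: "q \<in> U"
  have "frechet_derivative f (at q) v = L (fst v) f q + contact_form q v *\<^sub>R T f q"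
    unfolding L_def T_def
    by (subst hor_decompose[of v q])
       (simp only: linear_add[OF leq_linear[OF q]] linear_cmul[OF leq_linear[OF q]])
  then show ?thesis using hgrad_inner[OF q] by simp
qed

lemma leq_tangent: "q \<in> S \<inter> U \<Longrightarrow> tangent_space S q = {v. hgrad f q \<bullet> fst v + contact_form q v * T f q = 0}"
  using tangent_space_eq_kernel[OF leq] leq_derivative by auto

lemma continuous_on_T_hgrad: "continuous_on U (T f)" "continuous_on U (hgrad f)"
proof -
  have c: "continuous_on U (\<lambda>q. frechet_derivative f (at q) v)" for v
    using leq unfolding local_equation_def by blast
  show T: "continuous_on U (T f)" unfolding T_def by (rule c)
  have "continuous_on U (\<lambda>q. L b f q)" for b
  proof -
    have "L b f q = frechet_derivative f (at q) (b, 0) - (rot (fst q) \<bullet> b) * T f q" if "q \<in> U" for q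
    proof -
      have "hor q b = (b, 0) - (rot (fst q) \<bullet> b) *\<^sub>R (0, 1)" by (simp add: hor_def)
      then show ?thesis
        unfolding L_def T_def
        by (simp only: linear_diff[OF leq_linear[OF that]] linear_cmul[OF leq_linear[OF that]] real_scaleR_def)
    qed
    moreover have "continuous_on U (\<lambda>q. frechet_derivative f (at q) (b, 0) - (rot (fst q) \<bullet> b) * T f q)"
      by (intro continuous_intros c T bounded_linear.continuous_on[OF bounded_linear_rot])
    ultimately show ?thesis by (simp cong: continuous_on_cong)
  qed
  then show "continuous_on U (hgrad f)" unfolding hgrad_def by (intro continuous_intros)
qed

lemma hgrad_or_T_nonzero: "q \<in> U \<Longrightarrow> hgrad f q \<noteq> 0 \<or> T f q \<noteq> 0"
proof (rule ccontr)
  assume q: "q \<in> U" "\<not> (hgrad f q \<noteq> 0 \<or> T f q \<noteq> 0)"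
  then have "frechet_derivative f (at q) = (\<lambda>v. 0)" using leq_derivative[OF q(1)] by auto
  then show False using leq q(1) unfolding local_equation_def by blast
qed

text \<open>The differential of \<open>f\<close> is nonzero, so where the horizontal gradient
  vanishes it is a nonzero multiple of the contact form.\<close>

lemma regular_iff: "q \<in> S \<inter> U \<Longrightarrow> q \<in> regular_points S \<longleftrightarrow> hgrad f q \<noteq> 0"
proof
  assume q: "q \<in> S \<inter> U"
  show "hgrad f q \<noteq> 0" if "q \<in> regular_points S"
  proof
    assume "hgrad f q = 0"
    then have "T f q \<noteq> 0" using hgrad_or_T_nonzero q by blast
    then have "tangent_space S q = contact_plane q"
      unfolding leq_tangent[OF q] contact_plane_def using \<open>hgrad f q = 0\<close> by auto
    then show False using that by (simp add: regular_points_def)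
  qed
  show "q \<in> regular_points S" if "hgrad f q \<noteq> 0"
  proof -
    have "hor q (hgrad f q) \<in> contact_plane q" by (simp add: contact_plane_eq)
    moreover have "hor q (hgrad f q) \<notin> tangent_space S q"
      unfolding leq_tangent[OF q] using that by simp
    ultimately have "contact_plane q \<noteq> tangent_space S q" by blast
    then show ?thesis using q by (auto simp: regular_points_def)
  qed
qed

lemma horizontal_tangent_eq:
  "q \<in> S \<inter> U \<Longrightarrow> horizontal_tangent S q = hor q ` {a. a \<bullet> hgrad f q = 0}"
  unfolding horizontal_tangent_def contact_plane_eq
  by (auto simp: leq_tangent inner_commute)

lemma xi'_eq:
  "q \<in> S \<inter> U \<Longrightarrow> xi' S q = hor q ` {a. a \<bullet> hgrad f q = 0 \<and> a \<bullet> rot (hgrad f q) = 0}"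
proof -
  assume q: "q \<in> S \<inter> U"
  have inj: "hor q a = hor q b \<longleftrightarrow> a = b" for a b by (metis fst_hor)
  have "J q ` hor q ` {a. a \<bullet> hgrad f q = 0} = hor q ` {a. a \<bullet> rot (hgrad f q) = 0}"
  proof (intro equalityI subsetI)
    fix v assume "v \<in> J q ` hor q ` {a. a \<bullet> hgrad f q = 0}"
    then show "v \<in> hor q ` {a. a \<bullet> rot (hgrad f q) = 0}" by (auto simp: J_eq)
  next
    fix v assume "v \<in> hor q ` {a. a \<bullet> rot (hgrad f q) = 0}"
    then obtain a where a: "v = hor q a" "a \<bullet> rot (hgrad f q) = 0" by blast
    have "v = J q (hor q (- rot a))" by (simp add: a(1) J_eq rot_simps)
    moreover have "(- rot a) \<bullet> hgrad f q = 0" using a(2) by (simp add: inner_rot_left)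
    ultimately show "v \<in> J q ` hor q ` {a. a \<bullet> hgrad f q = 0}" by blast
  qed
  then show ?thesis
    unfolding xi'_def horizontal_tangent_eq[OF q] using inj by auto
qed

text \<open>Removing from \<open>e q\<close> its component along \<open>rot n\<close> leaves a
  vector of \<open>\<xi>'\<close>. It is orthogonal to \<open>e q\<close> by assumption and to
  \<open>rot n\<close> by construction, hence zero. Only a sign stays open.\<close>

lemma characteristic_direction:
  assumes q: "q \<in> S \<inter> U" and reg: "q \<in> regular_points S"
    and e: "characteristic_field S e"
  defines "n \<equiv> (1 / norm (hgrad f q)) *\<^sub>R hgrad f q"
  defines "\<nu> \<equiv> fst (horizontal_normal e q)"
  shows "e q = hor q (- rot \<nu>)" "\<nu> = n \<or> \<nu> = - n"
proof -
  have N: "hgrad f q \<noteq> 0" using regular_iff[OF q] reg by blast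
  have nn: "n \<bullet> n = 1" using N by (simp add: n_def dot_square_norm power2_eq_square)
  have par: "a \<bullet> hgrad f q = norm (hgrad f q) * (a \<bullet> n)" "a \<bullet> rot (hgrad f q) = norm (hgrad f q) * (a \<bullet> rot n)" for a
    using N by (simp_all add: n_def rot_simps)
  have eq: "e q \<in> horizontal_tangent S q" "levi (e q) (e q) = 1" "\<forall>v\<in>xi' S q. levi (e q) v = 0"
    using e reg unfolding characteristic_field_def by auto
  obtain w where w: "e q = hor q w" "w \<bullet> hgrad f q = 0"
    using eq(1) unfolding horizontal_tangent_eq[OF q] by blast
  have wn: "w \<bullet> n = 0" using w(2) N by (simp add: par)
  have ww: "w \<bullet> w = 1" using eq(2) w(1) by (simp add: levi_eq)
  define s where "s = w \<bullet> rot n"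
  define u where "u = w - s *\<^sub>R rot n"
  have u: "u \<bullet> n = 0" "u \<bullet> rot n = 0" using wn nn by (simp_all add: u_def s_def inner_simps)
  have "hor q u \<in> xi' S q" unfolding xi'_eq[OF q] using u by (simp add: par)
  then have "w \<bullet> u = 0" using eq(3) w(1) by (auto simp: levi_eq)
  moreover have "u \<bullet> u = w \<bullet> u - s * (u \<bullet> rot n)"
    by (metis u_def inner_diff_left inner_scaleR_left inner_commute)
  ultimately have "u = 0" using u by simp
  then have ws: "w = s *\<^sub>R rot n" by (simp add: u_def)
  have "s * s = 1" using ww nn by (simp add: ws[THEN arg_cong[where f = "\<lambda>w. w \<bullet> w"]])
  then have s: "s = 1 \<or> s = -1" by (simp add: square_eq_1_iff)
  have \<nu>: "\<nu> = rot w" by (simp add: \<nu>_def horizontal_normal_def J_eq w(1))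
  show "e q = hor q (- rot \<nu>)" by (simp add: \<nu> w(1) rot_simps)
  show "\<nu> = n \<or> \<nu> = - n" using s by (auto simp: \<nu> ws rot_simps)
qed

end

section \<open>Umbilic hypersurfaces\<close>

lemma has_derivative_within_agreeing:
  assumes "(g has_derivative D) (at p)" "open U" "p \<in> S \<inter> U" "\<And>q. q \<in> S \<inter> U \<Longrightarrow> g q = h q"
  shows "(h has_derivative D) (at p within S)"
proof -
  obtain d where d: "d > 0" "ball p d \<subseteq> U" using assms(2,3) openE by blast
  show ?thesis
  proof (rule has_derivative_transform_within[OF has_derivative_at_withinI[OF assms(1)] d(1)])
    show "p \<in> S" using assms(3) by blast
    fix x assume "x \<in> S" "dist x p < d"
    then have "x \<in> S \<inter> U" using d(2) by (auto simp: dist_commute)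
    then show "g x = h x" by (rule assms(4))
  qed
qed

text \<open>Serves to reverse the sign of a local equation and, with \<open>s = 1\<close>, to shrink
  its domain.\<close>

lemma local_equation_scaled:
  assumes leq: "local_equation S U f (\<lambda>x. frechet_derivative f (at x))"
    and "s \<noteq> 0" "open W" "W \<subseteq> U"
  shows "local_equation S W (\<lambda>x. s * f x) (\<lambda>x. frechet_derivative (\<lambda>x. s * f x) (at x))"
    and "q \<in> U \<Longrightarrow> frechet_derivative (\<lambda>x. s * f x) (at q) v = s * frechet_derivative f (at q) v"
proof -
  have D: "((\<lambda>x. s * f x) has_derivative (\<lambda>v. s * frechet_derivative f (at q) v)) (at q)" if "q \<in> U" for q
    using leq that unfolding local_equation_def by (intro has_derivative_mult_right) blast
  show fr: "frechet_derivative (\<lambda>x. s * f x) (at q) v = s * frechet_derivative f (at q) v" if "q \<in> U" for q v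
    using frechet_derivative_at[OF D[OF that]] by metis
  show "local_equation S W (\<lambda>x. s * f x) (\<lambda>x. frechet_derivative (\<lambda>x. s * f x) (at x))"
    unfolding local_equation_def
  proof (intro conjI ballI allI)
    show "open W" by fact
    show "S \<inter> W = {q \<in> W. s * f q = 0}" using leq assms(2,4) unfolding local_equation_def by auto
    fix x assume x: "x \<in> W"
    then have xU: "x \<in> U" using assms(4) by blast
    have eq: "frechet_derivative (\<lambda>x. s * f x) (at x) = (\<lambda>v. s * frechet_derivative f (at x) v)"
      using fr[OF xU] by auto
    show "((\<lambda>x. s * f x) has_derivative frechet_derivative (\<lambda>x. s * f x) (at x)) (at x)"
      unfolding eq by (rule D[OF xU])
    have "frechet_derivative f (at x) \<noteq> (\<lambda>v. 0)" using leq xU unfolding local_equation_def by blast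
    then obtain v where "frechet_derivative f (at x) v \<noteq> 0" by auto
    then have "frechet_derivative (\<lambda>x. s * f x) (at x) v \<noteq> 0" using fr[OF xU] assms(2) by simp
    then show "frechet_derivative (\<lambda>x. s * f x) (at x) \<noteq> (\<lambda>v. 0)" by (metis (mono_tags))
  next
    fix v
    have "continuous_on W (\<lambda>x. frechet_derivative f (at x) v)"
      using leq assms(4) continuous_on_subset unfolding local_equation_def by blast
    then have "continuous_on W (\<lambda>x. s * frechet_derivative f (at x) v)" by (intro continuous_intros)
    moreover have "\<And>x. x \<in> W \<Longrightarrow> frechet_derivative (\<lambda>x. s * f x) (at x) v = s * frechet_derivative f (at x) v"
      using fr assms(4) by blast
    ultimately show "continuous_on W (\<lambda>x. frechet_derivative (\<lambda>x. s * f x) (at x) v)"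
      by (simp cong: continuous_on_cong)
  qed
qed

text \<open>Up to the factor \<open>\<rho>\<close>, the antisymmetric part of the derivative of
  \<open>\<nu>\<close> is a commutator of horizontal derivatives of \<open>f\<close>. The term with
  \<open>\<alpha>\<close> in the shape operator compensates for it and makes that operator
  symmetric.\<close>

lemma (in smooth_domain) horizontal_hessian_symmetry:
  assumes f: "smooth U f" and \<rho>: "smooth U \<rho>" and \<nu>: "smooth U \<nu>" and q: "q \<in> U"
    and L_f: "\<And>q a. q \<in> U \<Longrightarrow> L a f q = \<rho> q * (\<nu> q \<bullet> a)"
    and T_f: "T f q = - (\<rho> q * \<alpha>)" and pos: "\<rho> q > 0"
    and X: "X \<bullet> \<nu> q = 0" "Y \<bullet> \<nu> q = 0"
  shows "L X \<nu> q \<bullet> Y - L Y \<nu> q \<bullet> X = 2 * \<alpha> * (rot X \<bullet> Y)"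
proof -
  have LL: "L b (L a f) q = \<rho> q * (L b \<nu> q \<bullet> a) + L b \<rho> q * (\<nu> q \<bullet> a)" for a b
  proof -
    have "L b (L a f) q = L b (\<lambda>q. \<rho> q * (\<nu> q \<bullet> a)) q"
      using L_f by (intro L_cong(1) smooth_L f q) auto
    then show ?thesis
      by (simp add: L_mult_field L_inner_field smooth_inner smooth_const \<rho> \<nu> q)
  qed
  have "L X (L Y f) q - L Y (L X f) q = 2 * (rot X \<bullet> Y) * (\<rho> q * \<alpha>)"
    using commutator[OF f q, of X Y] T_f by simp
  then have "\<rho> q * (L X \<nu> q \<bullet> Y - L Y \<nu> q \<bullet> X) = \<rho> q * (2 * \<alpha> * (rot X \<bullet> Y))"
    using X by (simp add: LL inner_commute[of "\<nu> q"] algebra_simps)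
  then show ?thesis unfolding mult_cancel_left using pos by auto
qed

locale umbilic_hypersurface =
  fixes \<Sigma> :: "'n::finite heis set" and e :: "'n heis \<Rightarrow> 'n heis" and c :: real
  assumes n2: "CARD('n) \<ge> 2"
    and hyp: "closed_embedded_hypersurface \<Sigma>"
    and conn: "connected \<Sigma>"
    and char: "characteristic_field \<Sigma> e"
    and c_pos: "c > 0"
    and mean_curv: "\<forall>p\<in>regular_points \<Sigma>. has_p_mean_curvature \<Sigma> e p c"
    and umb: "umbilic \<Sigma> e"
begin

abbreviation "R \<equiv> regular_points \<Sigma>"

definition \<nu> :: "'n heis \<Rightarrow> (complex, 'n) vec" where "\<nu> p = fst (horizontal_normal e p)"
definition \<alpha> :: "'n heis \<Rightarrow> real" where "\<alpha> p = alpha \<Sigma> e p"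
text \<open>An inner product for \<open>l\<close> and the mean curvature equation for
  \<open>k\<close> avoid a choice of eigenvalues, and both inherit smoothness from
  \<open>\<nu>\<close>.\<close>

definition l :: "'n heis \<Rightarrow> real" where "l p = fst (shape_op \<Sigma> e p (e p)) \<bullet> fst (e p)"
definition k :: "'n heis \<Rightarrow> real" where "k p = (c - l p) / (2 * real CARD('n) - 2)"

lemma horizontal_normal_eq: "horizontal_normal e p = hor p (\<nu> p)"
  by (simp add: \<nu>_def horizontal_normal_def J_eq)

lemma continuous_on_\<nu>: "continuous_on R \<nu>"
proof -
  have "continuous_on R e" using char by (simp add: characteristic_field_def)
  then have "continuous_on R (\<lambda>p. rot (fst (e p)))"
    by (intro bounded_linear.continuous_on[OF bounded_linear_rot] continuous_intros)
  then show ?thesis by (simp add: \<nu>_def[abs_def] horizontal_normal_def J_eq)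
qed

text \<open>\<open>e\<close> is only assumed continuous, but its normal \<open>\<nu>\<close> is the
  normalised horizontal gradient of \<open>f\<close> up to sign. Continuity of
  \<open>\<nu> q \<bullet> hgrad f q\<close> fixes the sign near \<open>p\<close>, and
  \<open>f\<close> is multiplied by it. So \<open>\<nu>\<close> has a smooth extension.\<close>

lemma oriented_equation:
  assumes p: "p \<in> R"
  obtains W f where "open W" "p \<in> W" "smooth W f"
    "local_equation \<Sigma> W f (\<lambda>x. frechet_derivative f (at x))"
    "\<And>q. q \<in> W \<Longrightarrow> hgrad f q \<noteq> 0"
    "\<And>q. q \<in> \<Sigma> \<inter> W \<Longrightarrow> q \<in> R \<and> \<nu> q = (1 / norm (hgrad f q)) *\<^sub>R hgrad f q \<and> e q = hor q (- rot (\<nu> q))"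
proof -
  have pS: "p \<in> \<Sigma>" using p by (simp add: regular_points_def)
  have "hypersurface_at \<infinity> \<Sigma> p" using hyp p unfolding closed_embedded_hypersurface_def by blast
  then obtain U f where U: "p \<in> U" "local_equation \<Sigma> U f (\<lambda>x. frechet_derivative f (at x))" "C_on \<infinity> f U"
    by (rule hypersurface_at_local_equation) auto
  note leq = U(2)
  have opU: "open U" using leq unfolding local_equation_def by blast
  have sf: "smooth U f" using U(3) by (simp add: smooth_real_iff C_on_def)
  define U1 where "U1 = {q \<in> U. hgrad f q \<noteq> 0}"
  have "U1 = U \<inter> hgrad f -` (- {0})" by (auto simp: U1_def)
  then have opU1: "open U1"
    using continuous_open_preimage[OF continuous_on_T_hgrad(2)[OF leq] opU, of "- {0}"] by auto
  have pU1: "p \<in> U1" using regular_iff[OF leq] p pS U(1) by (auto simp: U1_def)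
  have reg: "q \<in> R" if "q \<in> \<Sigma> \<inter> U1" for q using regular_iff[OF leq] that by (auto simp: U1_def)
  define s where "s = (if \<nu> p = (1 / norm (hgrad f p)) *\<^sub>R hgrad f p then 1 else - 1 :: real)"
  define g where "g q = s * (\<nu> q \<bullet> hgrad f q)" for q
  have dir: "\<nu> q = (1 / norm (hgrad f q)) *\<^sub>R hgrad f q \<or> \<nu> q = - ((1 / norm (hgrad f q)) *\<^sub>R hgrad f q)"
    "e q = hor q (- rot (\<nu> q))" if "q \<in> \<Sigma> \<inter> U1" for q
    using characteristic_direction[OF leq _ reg[OF that] char] that unfolding \<nu>_def U1_def by auto
  have gp: "g p > 0"
    using dir(1)[of p] pS pU1 by (auto simp: g_def s_def U1_def dot_square_norm power2_eq_square)
  have "continuous_on (\<Sigma> \<inter> U1) \<nu>" using continuous_on_subset[OF continuous_on_\<nu>] reg by blast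
  moreover have "continuous_on (\<Sigma> \<inter> U1) (hgrad f)"
    by (rule continuous_on_subset[OF continuous_on_T_hgrad(2)[OF leq]]) (auto simp: U1_def)
  ultimately have "continuous_on (\<Sigma> \<inter> U1) g" unfolding g_def by (intro continuous_intros)
  from continuous_openin_preimage_gen[OF this open_greaterThan, of 0]
  obtain O' where O': "open O'" "(\<Sigma> \<inter> U1) \<inter> g -` {0<..} = (\<Sigma> \<inter> U1) \<inter> O'"
    unfolding openin_open by blast
  define W where "W = U1 \<inter> O'"
  have W: "open W" "W \<subseteq> U" "W \<subseteq> U1" using opU1 O'(1) by (auto simp: W_def U1_def)
  have s0: "s \<noteq> 0" "s * s = 1" "\<bar>s\<bar> = 1" by (simp_all add: s_def)
  have pW: "p \<in> W" using O'(2) gp pS pU1 by (auto simp: W_def)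
  have hg: "hgrad (\<lambda>x. s * f x) q = s *\<^sub>R hgrad f q" if "q \<in> W" for q
  proof -
    have "q \<in> U" using that W(2) by blast
    from local_equation_scaled(2)[OF leq s0(1) W(1,2) this] show ?thesis
      by (simp only: hgrad_def scaleR_sum_right L_def scaleR_scaleR)
  qed
  show ?thesis
  proof (rule that[of W "\<lambda>x. s * f x"])
    show "open W" "p \<in> W" by fact+
    show "smooth W (\<lambda>x. s * f x)" by (intro smooth_mult smooth_const smooth_subset[OF W(2)] sf)
    show "local_equation \<Sigma> W (\<lambda>x. s * f x) (\<lambda>x. frechet_derivative (\<lambda>x. s * f x) (at x))"
      by (rule local_equation_scaled(1)[OF leq s0(1) W(1,2)])
    show "hgrad (\<lambda>x. s * f x) q \<noteq> 0" if "q \<in> W" for q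
      using hg[OF that] that s0 W(3) by (auto simp: U1_def)
    fix q assume q: "q \<in> \<Sigma> \<inter> W"
    then have q1: "q \<in> \<Sigma> \<inter> U1" using W by blast
    have "g q > 0" using O'(2) q q1 unfolding W_def by blast
    moreover have "hgrad f q \<noteq> 0" using q1 by (simp add: U1_def)
    ultimately have "\<nu> q = s *\<^sub>R (1 / norm (hgrad f q)) *\<^sub>R hgrad f q"
      using dir(1)[OF q1] s0(3) by (auto simp: g_def s_def dot_square_norm power2_eq_square split: if_splits)
    then show "q \<in> R \<and> \<nu> q = (1 / norm (hgrad (\<lambda>x. s * f x) q)) *\<^sub>R hgrad (\<lambda>x. s * f x) q
        \<and> e q = hor q (- rot (\<nu> q))"
      using reg[OF q1] dir(2)[OF q1] hg q s0(3) by simp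
  qed
qed

lemma patch:
  assumes p: "p \<in> R"
  obtains U f \<rho> \<alpha>' k' l' \<nu>' where "p \<in> U" "umbilic_patch U \<Sigma> f \<rho> \<alpha>' k' l' \<nu>' c"
    "\<And>q. q \<in> \<Sigma> \<inter> U \<Longrightarrow> q \<in> R \<and> \<nu> q = \<nu>' q \<and> \<alpha> q = \<alpha>' q \<and> k q = k' q \<and> l q = l' q"
proof -
  obtain W f where W: "open W" "p \<in> W" "smooth W f"
    "local_equation \<Sigma> W f (\<lambda>x. frechet_derivative f (at x))"
    "\<And>q. q \<in> W \<Longrightarrow> hgrad f q \<noteq> 0"
    "\<And>q. q \<in> \<Sigma> \<inter> W \<Longrightarrow> q \<in> R \<and> \<nu> q = (1 / norm (hgrad f q)) *\<^sub>R hgrad f q \<and> e q = hor q (- rot (\<nu> q))"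
    using oriented_equation[OF p] by blast
  note leq = W(4)
  interpret smooth_domain W by unfold_locales fact
  define N where "N = hgrad f"
  have sN: "smooth W N" unfolding N_def hgrad_def
    by (intro smooth_sum smooth_scaleR smooth_const smooth_L[OF W(3), unfolded smooth_def[symmetric]] finite_Basis)
  \<comment> \<open>Written as powers so that \<open>smooth_powr\<close> applies; the values are
    \<open>norm (N q)\<close> and its inverse.\<close>
  define \<rho> where "\<rho> q = (N q \<bullet> N q) powr (1 / 2)" for q
  define r where "r q = (N q \<bullet> N q) powr (- 1 / 2)" for q
  have NN: "N q \<bullet> N q > 0" if "q \<in> W" for q using W(5)[OF that] by (simp add: N_def)
  have \<rho>: "\<rho> q = norm (N q)" for q
    by (simp add: \<rho>_def powr_half_sqrt norm_eq_sqrt_inner)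
  have r: "r q = 1 / norm (N q)" for q
  proof -
    have "r q = inverse (\<rho> q)" unfolding r_def \<rho>_def by (simp add: powr_minus flip: minus_divide_left)
    then show ?thesis by (simp add: \<rho> divide_inverse)
  qed
  have s\<rho>: "smooth W \<rho>" and sr: "smooth W r"
    unfolding \<rho>_def[abs_def] r_def[abs_def] using NN by (auto intro!: smooth_powr smooth_inner sN)
  define \<nu>' where "\<nu>' q = r q *\<^sub>R N q" for q
  define \<alpha>' where "\<alpha>' q = - (T f q * r q)" for q
  \<comment> \<open>These extend the shape data off \<open>\<Sigma>\<close>; \<open>k'\<close> is
    computed from \<open>l'\<close> so that the mean curvature identity holds on all of
    \<open>W\<close>.\<close>
  define l' where "l' q = - (L (rot (\<nu>' q)) \<nu>' q \<bullet> rot (\<nu>' q))" for q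
  define k' where "k' q = (c - l' q) * (1 / (2 * real CARD('n) - 2))" for q
  have s\<nu>: "smooth W \<nu>'" unfolding \<nu>'_def[abs_def] by (intro smooth_scaleR sr sN)
  have s\<alpha>: "smooth W \<alpha>'" unfolding \<alpha>'_def[abs_def] by (intro smooth_neg smooth_mult smooth_T sr W(3))
  have sl: "smooth W l'" unfolding l'_def[abs_def]
    by (intro smooth_neg smooth_inner smooth_L_field smooth_rot s\<nu>)
  have sk: "smooth W k'" unfolding k'_def[abs_def]
    by (intro smooth_mult smooth_sub smooth_const sl)
  have n0: "2 * real CARD('n) - 2 \<noteq> 0" using n2 by simp
  have N0: "norm (N q) \<noteq> 0" if "q \<in> W" for q using W(5)[OF that] by (simp add: N_def)
  have N_\<nu>: "N q = norm (N q) *\<^sub>R \<nu>' q" if "q \<in> W" for q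
    using N0[OF that] by (simp add: \<nu>'_def r)
  have Lf: "L a f q = \<rho> q * (\<nu>' q \<bullet> a)" if "q \<in> W" for q a
    using hgrad_inner[OF leq that, of a] N_\<nu>[OF that] by (metis N_def \<rho> inner_scaleR_left)
  have Tf: "T f q = - (\<rho> q * \<alpha>' q)" if "q \<in> W" for q
    using N0[OF that] by (simp add: \<rho> \<alpha>'_def r)
  have unit: "\<nu>' q \<bullet> \<nu>' q = 1" if "q \<in> W" for q
    using N0[OF that] by (simp add: \<nu>'_def r dot_square_norm power2_eq_square)
  have on: "q \<in> R" "\<nu> q = \<nu>' q" "e q = hor q (- rot (\<nu>' q))" if "q \<in> \<Sigma> \<inter> W" for q
    using W(6)[OF that] by (auto simp: \<nu>'_def r N_def)
  have tan: "v \<in> tangent_space \<Sigma> q \<longleftrightarrow> \<nu>' q \<bullet> fst v = contact_form q v * \<alpha>' q" if q: "q \<in> \<Sigma> \<inter> W" for q v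
  proof -
    have qW: "q \<in> W" using q by blast
    have "v \<in> tangent_space \<Sigma> q \<longleftrightarrow> norm (N q) * (\<nu>' q \<bullet> fst v - contact_form q v * \<alpha>' q) = 0"
    proof -
      have "N q \<bullet> fst v = norm (N q) * (\<nu>' q \<bullet> fst v)"
        using arg_cong[OF N_\<nu>[OF qW], of "\<lambda>x. x \<bullet> fst v"] by simp
      then have "N q \<bullet> fst v + contact_form q v * T f q = norm (N q) * (\<nu>' q \<bullet> fst v - contact_form q v * \<alpha>' q)"
        using Tf[OF qW] by (simp add: \<rho> algebra_simps)
      then show ?thesis unfolding leq_tangent[OF leq q] N_def by simp
    qed
    then show ?thesis using N0[OF qW] by simp
  qed
  have \<alpha>: "\<alpha> q = \<alpha>' q" if q: "q \<in> \<Sigma> \<inter> W" for q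
  proof -
    have "a *\<^sub>R horizontal_normal e q + frame_t \<in> tangent_space \<Sigma> q \<longleftrightarrow> a = \<alpha>' q" for a
      using unit q
      by (simp add: tan[OF q] horizontal_normal_eq on(2)[OF q] frame_t_def contact_form_eq hor_def inner_simps)
    then show ?thesis by (simp add: \<alpha>_def alpha_def)
  qed
  have shape: "shape_op \<Sigma> e q v = hor q (- frechet_derivative \<nu>' (at q) v
      + \<alpha>' q *\<^sub>R rot (fst v - (fst v \<bullet> rot (\<nu>' q)) *\<^sub>R rot (\<nu>' q)))"
    if q: "q \<in> \<Sigma> \<inter> W" and v: "v \<in> tangent_space \<Sigma> q" for q v
  proof -
    have qW: "q \<in> W" using q by blast
    have 1: "(\<nu> has_derivative frechet_derivative \<nu>' (at q)) (at q within \<Sigma>)"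
      by (rule has_derivative_within_agreeing[OF derivative_at[OF s\<nu> qW] open_U q]) (simp add: on)
    then have 2: "(\<nu> has_derivative frechet_derivative \<nu> (at q within \<Sigma>)) (at q within \<Sigma>)"
      using differentiableI frechet_derivative_works by blast
    \<comment> \<open>\<open>cov_deriv\<close> uses some derivative within \<open>\<Sigma>\<close>;
      on tangent vectors it must agree with that of the smooth extension
      \<open>\<nu>'\<close>.\<close>
    have "frechet_derivative (\<lambda>q. fst (horizontal_normal e q)) (at q within \<Sigma>) v = frechet_derivative \<nu>' (at q) v"
      using derivative_within_unique_on_tangent[OF v 2 1] by (simp add: \<nu>_def[abs_def])
    then show ?thesis
      unfolding shape_op_def cov_deriv_eq J'_def J_eq levi_eq \<alpha>_def[symmetric] \<alpha>[OF q] on(3)[OF q]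
      by (simp add: hor_def inner_simps algebra_simps)
  qed
  have pt: "L (rot (\<nu>' q)) \<nu>' q = - l' q *\<^sub>R rot (\<nu>' q)"
    "X \<bullet> \<nu>' q = 0 \<Longrightarrow> X \<bullet> rot (\<nu>' q) = 0 \<Longrightarrow> L X \<nu>' q = - k' q *\<^sub>R X + \<alpha>' q *\<^sub>R rot X"
    "l q = l' q" if q: "q \<in> \<Sigma> \<inter> W" for q X
  proof -
    have qW: "q \<in> W" using q by blast
    have linL: "linear (\<lambda>a. L a \<nu>' q)"
      by (rule linearI) (simp_all add: L_add L_scaleR s\<nu> qW)
    obtain k0 l0 where kl: "xi'_eigenvalue \<Sigma> e q k0" "shape_op \<Sigma> e q (e q) = l0 *\<^sub>R e q"
      "c = l0 + (2 * real CARD('n) - 2) * k0"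
      using mean_curv on(1)[OF q] unfolding has_p_mean_curvature_def by blast
    have et: "e q \<in> tangent_space \<Sigma> q"
      by (simp add: tan[OF q] on(3)[OF q])
    have "fst (shape_op \<Sigma> e q (e q)) = L (rot (\<nu>' q)) \<nu>' q"
      unfolding shape[OF q et] using linear_neg[OF linL, of "rot (\<nu>' q)"]
      by (simp add: on(3)[OF q] unit[OF qW] rot_simps flip: L_def)
    then have Ll0: "L (rot (\<nu>' q)) \<nu>' q = - l0 *\<^sub>R rot (\<nu>' q)"
      unfolding kl(2) by (simp add: on(3)[OF q])
    then have l0: "l' q = l0" by (simp add: l'_def unit[OF qW])
    show "L (rot (\<nu>' q)) \<nu>' q = - l' q *\<^sub>R rot (\<nu>' q)" using Ll0 l0 by simp
    show "l q = l' q" unfolding l_def kl(2) l0 by (simp add: on(3)[OF q] unit[OF qW])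
    have k0: "k' q = k0" using kl(3) n0 by (simp add: k'_def l0)
    define W0 where "W0 = {a. a \<bullet> \<nu>' q = 0 \<and> a \<bullet> rot (\<nu>' q) = 0}"
    have xi: "xi' \<Sigma> q = hor q ` W0"
      unfolding xi'_eq[OF leq q] W0_def N_def[symmetric]
      using N_\<nu>[OF qW] N0[OF qW] by (metis (no_types, lifting) inner_scaleR_right mult_eq_0_iff rot_scaleR)
    define A where "A X = - L X \<nu>' q + \<alpha>' q *\<^sub>R rot X" for X
    have shapeA: "shape_op \<Sigma> e q (hor q X) = hor q (A X)" if "X \<in> W0" for X
    proof -
      have "hor q X \<in> tangent_space \<Sigma> q" using that by (simp add: tan[OF q] W0_def inner_commute)
      from shape[OF q this] show ?thesis using that by (simp add: A_def W0_def L_def)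
    qed
    have um: "shape_op \<Sigma> e q ` xi' \<Sigma> q \<subseteq> xi' \<Sigma> q" "\<exists>k. \<forall>\<mu>. xi'_eigenvalue \<Sigma> e q \<mu> \<longrightarrow> \<mu> = k"
      using umb on(1)[OF q] unfolding umbilic_def umbilic_at_def by blast+
    have eigk: "\<mu> = k0" if "xi'_eigenvalue \<Sigma> e q \<mu>" for \<mu> using um(2) kl(1) that by blast
    \<comment> \<open>\<open>A\<close> is the shape operator on coefficients; its symmetry comes
      from \<open>horizontal_hessian_symmetry\<close>.\<close>
    have AX: "A X = k0 *\<^sub>R X" if "X \<in> W0" for X
    proof (rule selfadjoint_single_eigenvalue[OF _ _ _ _ _ that])
      show "linear A"
        unfolding A_def by (rule linearI) (simp_all add: linear_add[OF linL] linear_cmul[OF linL] rot_simps algebra_simps)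
      show "subspace W0" unfolding W0_def by (auto simp: subspace_def inner_simps)
      show "A ` W0 \<subseteq> W0"
      proof
        fix a assume "a \<in> A ` W0"
        then obtain X where X: "a = A X" "X \<in> W0" by blast
        have "hor q X \<in> xi' \<Sigma> q" unfolding xi using X(2) by simp
        then have "shape_op \<Sigma> e q (hor q X) \<in> xi' \<Sigma> q" using um(1) by (simp add: image_subset_iff)
        then have "hor q a \<in> hor q ` W0" unfolding shapeA[OF X(2)] xi X(1) .
        then obtain b where b: "hor q a = hor q b" "b \<in> W0" by blast
        from arg_cong[OF b(1), of fst] have "a = b" by (simp only: fst_hor)
        then show "a \<in> W0" using b(2) by simp
      qed
      show "A X \<bullet> Y = X \<bullet> A Y" if "X \<in> W0" "Y \<in> W0" for X Y
      proof -
        have XY: "X \<bullet> \<nu>' q = 0" "Y \<bullet> \<nu>' q = 0" using that by (auto simp: W0_def)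
        have "L X \<nu>' q \<bullet> Y - L Y \<nu>' q \<bullet> X = 2 * \<alpha>' q * (rot X \<bullet> Y)"
          by (rule horizontal_hessian_symmetry[OF W(3) s\<rho> s\<nu> qW Lf Tf[OF qW] _ XY])
             (use N0[OF qW] in \<open>simp_all add: \<rho>\<close>)
        then show ?thesis
          by (simp add: A_def inner_simps inner_rot_left inner_commute[of X "L Y \<nu>' q"])
      qed
      show "\<mu> = k0" if "X \<in> W0" "X \<noteq> 0" "A X = \<mu> *\<^sub>R X" for X \<mu>
      proof (rule eigk)
        have "hor q X \<noteq> 0" using that(2) by (simp add: hor_def zero_prod_def)
        then show "xi'_eigenvalue \<Sigma> e q \<mu>"
          unfolding xi'_eigenvalue_def xi using that shapeA[OF that(1)] by (auto simp: hor_scaleR)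
      qed
    qed
    show "L X \<nu>' q = - k' q *\<^sub>R X + \<alpha>' q *\<^sub>R rot X" if "X \<bullet> \<nu>' q = 0" "X \<bullet> rot (\<nu>' q) = 0"
      using AX[of X] that by (simp add: W0_def A_def k0 algebra_simps)
  qed
  show ?thesis
  proof (rule that[of W f \<rho> \<alpha>' k' l' \<nu>'])
    show "p \<in> W" by fact
    show "umbilic_patch W \<Sigma> f \<rho> \<alpha>' k' l' \<nu>' c"
    proof unfold_locales
      show "l' q + (2 * real CARD('n) - 2) * k' q = c" for q using n0 by (simp add: k'_def)
      show "0 < \<rho> q" if "q \<in> W" for q using N0[OF that] by (simp add: \<rho>)
    qed (fact n2 leq W(3) s\<rho> s\<alpha> sk sl s\<nu> Lf Tf unit pt)+
    show "q \<in> R \<and> \<nu> q = \<nu>' q \<and> \<alpha> q = \<alpha>' q \<and> k q = k' q \<and> l q = l' q" if "q \<in> \<Sigma> \<inter> W" for q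
      using on[OF that] \<alpha>[OF that] pt(3)[OF that] by (simp add: k_def k'_def)
  qed
qed


section \<open>The structure equations on the regular points\<close>

lemma compact_\<Sigma>: "compact \<Sigma>" and nonempty_\<Sigma>: "\<Sigma> \<noteq> {}"
  using hyp by (simp_all add: closed_embedded_hypersurface_def)

lemma R_subset: "R \<subseteq> \<Sigma>"
  by (auto simp: regular_points_def)

lemma l_eq: "l p = c - (2 * real CARD('n) - 2) * k p"
  using n2 by (simp add: k_def field_simps)

text \<open>Equals \<open>l - 2 k\<close>, and vanishes exactly where \<open>k\<close> has the value
  it takes on a Pansu sphere.\<close>

definition \<delta> :: "'n heis \<Rightarrow> real" where "\<delta> p = c - 2 * real CARD('n) * k p"

text \<open>The squared modulus of \<open>\<kappa>\<close>.\<close>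

definition K :: "'n heis \<Rightarrow> real" where "K p = (k p)\<^sup>2 + (\<alpha> p)\<^sup>2"

lemma l_eq_\<delta>: "l p = \<delta> p + 2 * k p"
  by (simp add: l_eq \<delta>_def algebra_simps)

lemma \<nu>_unit: "p \<in> R \<Longrightarrow> \<nu> p \<bullet> \<nu> p = 1"
  and tangent_iff: "p \<in> R \<Longrightarrow> v \<in> tangent_space \<Sigma> p \<longleftrightarrow> \<nu> p \<bullet> fst v = contact_form p v * \<alpha> p"
proof -
  assume p: "p \<in> R"
  obtain U f \<rho> \<alpha>' k' l' \<nu>' where U: "p \<in> U" "umbilic_patch U \<Sigma> f \<rho> \<alpha>' k' l' \<nu>' c"
    "\<And>q. q \<in> \<Sigma> \<inter> U \<Longrightarrow> q \<in> R \<and> \<nu> q = \<nu>' q \<and> \<alpha> q = \<alpha>' q \<and> k q = k' q \<and> l q = l' q"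
    by (rule patch[OF p]) (rule that)
  interpret P: umbilic_patch U \<Sigma> f \<rho> \<alpha>' k' l' \<nu>' c by fact
  have pU: "p \<in> \<Sigma> \<inter> U" using U(1) p R_subset by blast
  note eq = U(3)[OF pU]
  show "\<nu> p \<bullet> \<nu> p = 1" using eq P.\<nu>_unit[OF U(1)] by simp
  have "frechet_derivative f (at p) v = \<rho> p * (\<nu> p \<bullet> fst v - contact_form p v * \<alpha> p)"
    using eq by (simp add: P.frechet_derivative_decompose[OF P.smooth_f U(1)] P.L_f[OF U(1)] P.T_f[OF U(1)] algebra_simps)
  then show "v \<in> tangent_space \<Sigma> p \<longleftrightarrow> \<nu> p \<bullet> fst v = contact_form p v * \<alpha> p"
    using P.tangent_iff[OF pU] P.\<rho>_pos[OF U(1)] by auto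
qed

text \<open>
  The derivatives of \<open>\<nu>\<close>, \<open>k\<close>, \<open>\<alpha>\<close> along \<open>v = X + s J\<nu> + \<theta> V\<close>, where \<open>V = \<alpha> \<nu> - k J\<nu> + T\<close> spans, together with
  \<open>\<xi>'\<close>, the directions in which \<open>k\<close> and \<open>\<alpha>\<close> are constant.
\<close>
definition structure_equations ::
    "'n heis \<Rightarrow> 'n heis \<Rightarrow> (complex, 'n) vec \<Rightarrow> real \<Rightarrow> real \<Rightarrow> bool" where
  "structure_equations p v d\<nu> dk d\<alpha> \<longleftrightarrow> (\<exists>X s \<theta>.
     \<theta> = contact_form p v \<and> X \<bullet> \<nu> p = 0 \<and> X \<bullet> rot (\<nu> p) = 0 \<and>
     fst v = X + ((\<alpha> p * \<theta>) *\<^sub>R \<nu> p + (s - k p * \<theta>) *\<^sub>R rot (\<nu> p)) \<and>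
     d\<nu> = - k p *\<^sub>R X + \<alpha> p *\<^sub>R rot X + (\<theta> * K p - s * l p) *\<^sub>R rot (\<nu> p) \<and>
     dk = - (s * \<delta> p * \<alpha> p) \<and> d\<alpha> = s * (K p + k p * \<delta> p))"

theorem derivatives:
  assumes p: "p \<in> R"
  obtains D\<nu> Dk D\<alpha> where
    "(\<nu> has_derivative D\<nu>) (at p within \<Sigma>)" "(k has_derivative Dk) (at p within \<Sigma>)"
    "(\<alpha> has_derivative D\<alpha>) (at p within \<Sigma>)"
    "\<And>v. v \<in> tangent_space \<Sigma> p \<Longrightarrow> structure_equations p v (D\<nu> v) (Dk v) (D\<alpha> v)"
proof -
  obtain U f \<rho> \<alpha>' k' l' \<nu>' where U: "p \<in> U" "umbilic_patch U \<Sigma> f \<rho> \<alpha>' k' l' \<nu>' c"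
    "\<And>q. q \<in> \<Sigma> \<inter> U \<Longrightarrow> q \<in> R \<and> \<nu> q = \<nu>' q \<and> \<alpha> q = \<alpha>' q \<and> k q = k' q \<and> l q = l' q"
    by (rule patch[OF p]) (rule that)
  interpret P: umbilic_patch U \<Sigma> f \<rho> \<alpha>' k' l' \<nu>' c by fact
  have pU: "p \<in> \<Sigma> \<inter> U" using U(1) p R_subset by blast
  note eq = U(3)[OF pU]
  show ?thesis
  proof (rule that)
    show "(\<nu> has_derivative frechet_derivative \<nu>' (at p)) (at p within \<Sigma>)"
      by (rule has_derivative_within_agreeing[OF P.derivative_at[OF P.smooth_\<nu> U(1)] P.open_U pU]) (use U(3) in simp)
    show "(k has_derivative frechet_derivative k' (at p)) (at p within \<Sigma>)"
      by (rule has_derivative_within_agreeing[OF P.derivative_at[OF P.smooth_k U(1)] P.open_U pU]) (use U(3) in simp)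
    show "(\<alpha> has_derivative frechet_derivative \<alpha>' (at p)) (at p within \<Sigma>)"
      by (rule has_derivative_within_agreeing[OF P.derivative_at[OF P.smooth_\<alpha> U(1)] P.open_U pU]) (use U(3) in simp)
    fix v assume v: "v \<in> tangent_space \<Sigma> p"
    define \<theta> where "\<theta> = contact_form p v"
    define s where "s = fst v \<bullet> rot (\<nu> p) + k p * \<theta>"
    define X where "X = fst v - ((\<alpha> p * \<theta>) *\<^sub>R \<nu> p + (s - k p * \<theta>) *\<^sub>R rot (\<nu> p))"
    note d = P.derivative_on_tangent[OF pU v]
    have "X \<bullet> \<nu> p = 0" "X \<bullet> rot (\<nu> p) = 0"
      using d(1,2) eq by (simp_all add: X_def s_def \<theta>_def)
    moreover have "frechet_derivative \<nu>' (at p) v = - k p *\<^sub>R X + \<alpha> p *\<^sub>R rot X + (\<theta> * K p - s * l p) *\<^sub>R rot (\<nu> p)"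
      using d(3) eq by (simp add: X_def s_def \<theta>_def K_def algebra_simps)
    moreover have "frechet_derivative k' (at p) v = - (s * \<delta> p * \<alpha> p)"
    proof -
      have "frechet_derivative k' (at p) v = s * ((2 * k p - l p) * \<alpha> p)"
        using d(4) eq by (simp add: s_def \<theta>_def)
      then show ?thesis by (simp add: l_eq_\<delta>)
    qed
    moreover have "frechet_derivative \<alpha>' (at p) v = s * (K p + k p * \<delta> p)"
    proof -
      have "frechet_derivative \<alpha>' (at p) v = s * ((\<alpha> p)\<^sup>2 - (k p)\<^sup>2 + k p * l p)"
        using d(5) eq by (simp add: s_def \<theta>_def)
      then show ?thesis by (simp add: l_eq_\<delta> K_def algebra_simps power2_eq_square)
    qed
    moreover have "fst v = X + ((\<alpha> p * \<theta>) *\<^sub>R \<nu> p + (s - k p * \<theta>) *\<^sub>R rot (\<nu> p))" by (simp add: X_def)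
    ultimately show "structure_equations p v (frechet_derivative \<nu>' (at p) v)
        (frechet_derivative k' (at p) v) (frechet_derivative \<alpha>' (at p) v)"
      unfolding structure_equations_def
      using \<theta>_def by blast
  qed
qed

section \<open>Local constancy, singular points and clopen subsets\<close>

lemma continuous_on_k: "continuous_on R k" and continuous_on_\<alpha>: "continuous_on R \<alpha>"
proof -
  have "continuous (at p within \<Sigma>) k \<and> continuous (at p within \<Sigma>) \<alpha>" if "p \<in> R" for p
    by (rule derivatives[OF that]) (blast intro: has_derivative_continuous)
  then show "continuous_on R k" "continuous_on R \<alpha>"
    using R_subset continuous_within_subset unfolding continuous_on_eq_continuous_within by blast+
qed

text \<open>The open set \<open>A\<close> confines the hypothesis to a neighbourhood of
  \<open>p\<close>, for functions such as \<open>F\<close> that have a denominator.\<close>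

lemma locally_constant:
  assumes p: "p \<in> R" and A: "open A" "p \<in> A"
    and h: "\<And>q. q \<in> R \<inter> A \<Longrightarrow> \<exists>E. (h has_derivative E) (at q within \<Sigma>) \<and> (\<forall>v\<in>tangent_space \<Sigma> q. E v = 0)"
  obtains W where "open W" "p \<in> W" "\<And>q. q \<in> \<Sigma> \<inter> W \<Longrightarrow> q \<in> R \<and> h q = h p"
proof -
  obtain U f where U: "open U" "p \<in> U" "local_equation \<Sigma> U f (\<lambda>x. frechet_derivative f (at x))"
    "\<And>q. q \<in> \<Sigma> \<inter> U \<Longrightarrow> q \<in> R"
    by (rule oriented_equation[OF p]) blast
  have UA: "open (U \<inter> A)" "U \<inter> A \<subseteq> U" using U(1) A(1) by auto
  have leq: "local_equation \<Sigma> (U \<inter> A) (\<lambda>x. 1 * f x) (\<lambda>x. frechet_derivative (\<lambda>x. 1 * f x) (at x))"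
    by (rule local_equation_scaled(1)[OF U(3) _ UA]) simp
  have pS: "p \<in> \<Sigma>" "p \<in> U \<inter> A" using p R_subset U(2) A(2) by auto
  obtain W where W: "open W" "p \<in> W" "\<And>q. q \<in> \<Sigma> \<inter> W \<Longrightarrow> h q = h p"
  proof (rule locally_constant_on_hypersurface[OF leq pS])
    show "\<exists>E. (h has_derivative E) (at q within \<Sigma>) \<and> (\<forall>v\<in>tangent_space \<Sigma> q. E v = 0)"
      if "q \<in> \<Sigma> \<inter> (U \<inter> A)" for q using h[of q] U(4)[of q] that by blast
  qed blast
  show ?thesis
    by (rule that[of "W \<inter> U"]) (use W U in auto)
qed

text \<open>Tangency of \<open>\<alpha> \<nu> + T\<close> gives
  \<open>\<bar>\<alpha>\<bar> * norm (hgrad f) = \<bar>T f\<bar>\<close>; at a singular point the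
  gradient vanishes and \<open>T f\<close> does not.\<close>

lemma alpha_unbounded_at_singular:
  assumes p: "p \<in> \<Sigma>" "p \<notin> R"
  obtains U where "open U" "p \<in> U" "\<And>q. q \<in> R \<inter> U \<Longrightarrow> \<bar>\<alpha> q\<bar> > B"
proof -
  have "hypersurface_at 2 \<Sigma> p" using hyp p unfolding closed_embedded_hypersurface_def by blast
  then obtain U f where U: "p \<in> U" "local_equation \<Sigma> U f (\<lambda>x. frechet_derivative f (at x))"
    by (rule hypersurface_at_local_equation) auto
  note leq = U(2)
  have opU: "open U" using leq unfolding local_equation_def by blast
  have N0: "hgrad f p = 0" and T0: "T f p \<noteq> 0"
    using regular_iff[OF leq, of p] hgrad_or_T_nonzero[OF leq U(1)] p U(1) by auto
  have rel: "\<bar>\<alpha> q\<bar> * norm (hgrad f q) = \<bar>T f q\<bar>" if q: "q \<in> R \<inter> U" for q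
  proof -
    have qS: "q \<in> \<Sigma> \<inter> U" using q R_subset by blast
    define V where "V = hor q (\<alpha> q *\<^sub>R \<nu> q) + (0, 1)"
    have "V \<in> tangent_space \<Sigma> q"
      using \<nu>_unit q by (simp add: tangent_iff V_def contact_form_eq hor_def inner_simps)
    then have 1: "\<alpha> q * (hgrad f q \<bullet> \<nu> q) + T f q = 0"
      unfolding leq_tangent[OF leq qS] by (simp add: V_def contact_form_eq hor_def inner_simps)
    have "\<bar>hgrad f q \<bullet> \<nu> q\<bar> = norm (hgrad f q)"
      using characteristic_direction(2)[OF leq qS _ char] q regular_iff[OF leq qS] unfolding \<nu>_def
      by (auto simp: dot_square_norm power2_eq_square)
    then show ?thesis using 1 by (metis abs_minus_cancel abs_mult add_eq_0_iff)
  qed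
  define g where "g q = (\<bar>B\<bar> + 1) * norm (hgrad f q) - \<bar>T f q\<bar>" for q
  have "continuous_on U g" unfolding g_def by (intro continuous_intros continuous_on_T_hgrad[OF leq])
  then have op: "open (U \<inter> g -` {..<0})" by (rule continuous_open_preimage[OF _ opU open_lessThan])
  show ?thesis
  proof (rule that[OF op])
    show "p \<in> U \<inter> g -` {..<0}" using U(1) N0 T0 by (simp add: g_def)
    fix q assume "q \<in> R \<inter> (U \<inter> g -` {..<0})"
    then have q: "q \<in> R \<inter> U" "g q < 0" by auto
    then have "(\<bar>B\<bar> + 1) * norm (hgrad f q) < \<bar>\<alpha> q\<bar> * norm (hgrad f q)" using rel[OF q(1)] by (simp add: g_def)
    then have "\<bar>B\<bar> + 1 < \<bar>\<alpha> q\<bar>" by (simp add: mult_less_cancel_right)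
    then show "\<bar>\<alpha> q\<bar> > B" by linarith
  qed
qed

text \<open>A limit of points of \<open>M\<close> lies in \<open>\<Sigma>\<close>, and it cannot be
  singular because \<open>\<alpha>\<close> is unbounded near singular points. So closedness relative
  to \<open>R\<close> suffices.\<close>

lemma closed_if_alpha_bounded:
  assumes "closedin (top_of_set R) M" "\<And>p. p \<in> M \<Longrightarrow> \<bar>\<alpha> p\<bar> \<le> B"
  shows "closed M"
proof -
  obtain C where C: "closed C" "M = R \<inter> C" using assms(1) by (auto simp: closedin_closed)
  have "p \<in> M" if p: "p \<in> closure M" for p
  proof -
    have "p \<in> closure \<Sigma>" using p closure_mono[of M \<Sigma>] C(2) R_subset by blast
    then have pS: "p \<in> \<Sigma>" using compact_imp_closed[OF compact_\<Sigma>] by simp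
    have "p \<in> R"
    proof (rule ccontr)
      assume "p \<notin> R"
      then obtain U where U: "open U" "p \<in> U" "\<And>q. q \<in> R \<inter> U \<Longrightarrow> \<bar>\<alpha> q\<bar> > B"
        by (rule alpha_unbounded_at_singular[OF pS]) blast
      have "U \<inter> M \<noteq> {}" using p U(2) open_Int_closure_eq_empty[OF U(1), of M] by blast
      then obtain q where "q \<in> U" "q \<in> M" by blast
      then show False using U(3)[of q] assms(2)[of q] C(2) by auto
    qed
    moreover have "p \<in> C" using p C closure_minimal[of M C] by blast
    ultimately show ?thesis using C(2) by blast
  qed
  then show ?thesis using closure_subset_eq by blast
qed

lemma clopen_eq_\<Sigma>:
  assumes "M \<subseteq> \<Sigma>" "M \<noteq> {}" "closed M" "\<And>p. p \<in> M \<Longrightarrow> \<exists>W. open W \<and> p \<in> W \<and> \<Sigma> \<inter> W \<subseteq> M"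
  shows "M = \<Sigma>"
proof -
  have "openin (top_of_set \<Sigma>) M"
    unfolding openin_subopen[of _ M]
  proof
    fix p assume p: "p \<in> M"
    then obtain W where "open W" "p \<in> W" "\<Sigma> \<inter> W \<subseteq> M" using assms(4) by blast
    then show "\<exists>T. openin (top_of_set \<Sigma>) T \<and> p \<in> T \<and> T \<subseteq> M"
      using p assms(1) by (intro exI[of _ "\<Sigma> \<inter> W"]) (auto simp: openin_open_Int)
  qed
  moreover have "closedin (top_of_set \<Sigma>) M" using assms(1,3) closed_subset by blast
  ultimately show ?thesis using conn assms(2) by (auto simp: connected_clopen)
qed

text \<open>Otherwise all tangent spaces are contact planes. At a maximum of \<open>|z|^2\<close>
  the horizontal vector with coefficients \<open>z\<close> is then tangent, so \<open>z = 0\<close>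
  there and on all of \<open>\<Sigma>\<close>. But then \<open>fst\<close> is constant on
  \<open>\<Sigma>\<close>, although the contact plane projects onto every direction of
  \<open>z\<close>.\<close>

lemma R_nonempty: "R \<noteq> {}"
proof
  assume empty: "R = {}"
  have sing: "tangent_space \<Sigma> p = range (hor p)" if "p \<in> \<Sigma>" for p
    using empty that unfolding contact_plane_eq[symmetric] regular_points_def by blast
  have "continuous_on \<Sigma> (\<lambda>p. fst p \<bullet> fst p)" by (intro continuous_intros)
  then obtain p where p: "p \<in> \<Sigma>" "\<And>q. q \<in> \<Sigma> \<Longrightarrow> fst q \<bullet> fst q \<le> fst p \<bullet> fst p"
    using continuous_attains_sup[OF compact_\<Sigma> nonempty_\<Sigma>] by blast
  have 0: "hor p (fst p) \<in> tangent_space \<Sigma> p" using sing[OF p(1)] by blast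
  have 1: "((\<lambda>p. fst p \<bullet> fst p) has_derivative (\<lambda>v. fst p \<bullet> fst v + fst v \<bullet> fst p)) (at p within \<Sigma>)"
    by (intro has_derivative_inner has_derivative_fst has_derivative_ident)
  have "fst p \<bullet> fst p + fst p \<bullet> fst p = 0"
    using derivative_within_max_tangent[OF 0 1] p(2) by simp
  then have z: "fst q = 0" if "q \<in> \<Sigma>" for q 
  proof -
    have "fst p \<bullet> fst p = 0" using \<open>fst p \<bullet> fst p + fst p \<bullet> fst p = 0\<close> by linarith
    then have "fst q \<bullet> fst q = 0" using p(2)[OF that] inner_ge_zero[of "fst q"] by linarith
    then show ?thesis by simp
  qed
  obtain w :: "(complex, 'n) vec" where w: "w \<noteq> 0" using exists_complex_orthogonal[OF n2] by blast
  have 1: "(fst has_derivative fst) (at p within \<Sigma>)" by (intro has_derivative_fst has_derivative_ident)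
  have 2: "(fst has_derivative (\<lambda>v. 0)) (at p within \<Sigma>)"
    by (rule has_derivative_transform_within[where f = "\<lambda>q. 0" and d = 1]) (use p(1) z in auto)
  have "hor p w \<in> tangent_space \<Sigma> p" using sing[OF p(1)] by blast
  from derivative_within_unique_on_tangent[OF this 1 2] w show False by simp
qed

end

section \<open>First integrals\<close>

context umbilic_hypersurface
begin

text \<open>The point \<open>z + \<nu> / \<kappa>\<close> in real terms, as
  \<open>1 / \<kappa> = (k + \<i> \<alpha>) / K\<close>.\<close>

definition F :: "'n heis \<Rightarrow> (complex, 'n) vec" where
  "F p = fst p + ((k p / K p) *\<^sub>R \<nu> p + (\<alpha> p / K p) *\<^sub>R rot (\<nu> p))"

lemma continuous_on_K: "continuous_on R K"
  unfolding K_def by (intro continuous_intros continuous_on_k continuous_on_\<alpha>)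

lemma continuous_on_\<delta>: "continuous_on R \<delta>"
  unfolding \<delta>_def by (intro continuous_intros continuous_on_k)

lemma continuous_on_F: "(\<And>p. p \<in> A \<Longrightarrow> K p \<noteq> 0) \<Longrightarrow> A \<subseteq> R \<Longrightarrow> continuous_on A F"
  unfolding F_def
  by (intro continuous_intros bounded_linear.continuous_on[OF bounded_linear_rot])
     (auto intro: continuous_on_subset continuous_on_k continuous_on_\<alpha> continuous_on_\<nu> continuous_on_K)

lemma nonzero_neighbourhood:
  fixes g :: "'n heis \<Rightarrow> real"
  assumes "continuous_on R g" "p \<in> R" "g p \<noteq> 0"
  obtains A where "open A" "p \<in> A" "\<And>q. q \<in> R \<inter> A \<Longrightarrow> g q \<noteq> 0"
proof -
  have "openin (top_of_set R) (R \<inter> g -` (- {0}))"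
    by (rule continuous_openin_preimage_gen[OF assms(1)]) auto
  then obtain A where A: "open A" "R \<inter> g -` (- {0}) = R \<inter> A" unfolding openin_open by blast
  show ?thesis by (rule that[OF A(1)]) (use A(2) assms(2,3) in blast)+
qed

lemma K_derivative:
  assumes "(k has_derivative Dk) (at p within \<Sigma>)" "(\<alpha> has_derivative D\<alpha>) (at p within \<Sigma>)"
  shows "(K has_derivative (\<lambda>v. 2 * k p * Dk v + 2 * \<alpha> p * D\<alpha> v)) (at p within \<Sigma>)"
proof -
  have "((\<lambda>p. k p * k p + \<alpha> p * \<alpha> p) has_derivative (\<lambda>v. (k p * Dk v + Dk v * k p) + (\<alpha> p * D\<alpha> v + D\<alpha> v * \<alpha> p)))
      (at p within \<Sigma>)"
    by (intro has_derivative_add has_derivative_mult assms)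
  then show ?thesis by (simp add: K_def[abs_def] power2_eq_square algebra_simps)
qed

text \<open>In complex notation: along \<open>X\<close> the changes \<open>X\<close> of
  \<open>z\<close> and \<open>- X\<close> of \<open>\<nu> / \<kappa>\<close> cancel. Along
  \<open>J\<nu>\<close> the equations say
  \<open>d\<kappa> = - \<i> \<kappa> (cnj \<kappa> + \<delta>)\<close>, so
  \<open>\<nu> / \<kappa>\<close> changes by \<open>\<i> (cnj \<kappa> + \<delta> - l) \<nu> /
  \<kappa> = - \<i> \<nu>\<close> because \<open>l = \<delta> + 2 k\<close>. Along \<open>V\<close>,
  \<open>z\<close> changes by \<open>- \<i> cnj \<kappa> \<nu>\<close> and
  \<open>\<nu> / \<kappa>\<close> by \<open>\<i> K \<nu> / \<kappa>\<close>, its negative.\<close>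

lemma F_derivative:
  assumes p: "p \<in> R" and K0: "K p \<noteq> 0"
  shows "\<exists>E. (F has_derivative E) (at p within \<Sigma>) \<and> (\<forall>v\<in>tangent_space \<Sigma> p. E v = 0)"
proof -
  obtain D\<nu> Dk D\<alpha> where D: "(\<nu> has_derivative D\<nu>) (at p within \<Sigma>)" "(k has_derivative Dk) (at p within \<Sigma>)"
    "(\<alpha> has_derivative D\<alpha>) (at p within \<Sigma>)"
    "\<And>v. v \<in> tangent_space \<Sigma> p \<Longrightarrow> structure_equations p v (D\<nu> v) (Dk v) (D\<alpha> v)"
    by (rule derivatives[OF p]) (rule that)
  define DK where "DK v = 2 * k p * Dk v + 2 * \<alpha> p * D\<alpha> v" for v
  have DK: "(K has_derivative DK) (at p within \<Sigma>)" unfolding DK_def by (rule K_derivative[OF D(2,3)])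
  define D1 where "D1 v = (Dk v * K p - k p * DK v) / (K p * K p)" for v
  define D2 where "D2 v = (D\<alpha> v * K p - \<alpha> p * DK v) / (K p * K p)" for v
  define E where "E v = fst v + (((k p / K p) *\<^sub>R D\<nu> v + D1 v *\<^sub>R \<nu> p)
      + ((\<alpha> p / K p) *\<^sub>R rot (D\<nu> v) + D2 v *\<^sub>R rot (\<nu> p)))" for v
  have "(F has_derivative E) (at p within \<Sigma>)"
    unfolding F_def[abs_def] E_def[abs_def] D1_def D2_def
    by (intro has_derivative_add has_derivative_scaleR has_derivative_divide' has_derivative_fst
        has_derivative_ident bounded_linear.has_derivative[OF bounded_linear_rot] D DK K0)
  moreover have "E v = 0" if v: "v \<in> tangent_space \<Sigma> p" for v
  proof -
    obtain X s \<theta> where x: "fst v = X + ((\<alpha> p * \<theta>) *\<^sub>R \<nu> p + (s - k p * \<theta>) *\<^sub>R rot (\<nu> p))"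
       "D\<nu> v = - k p *\<^sub>R X + \<alpha> p *\<^sub>R rot X + (\<theta> * K p - s * l p) *\<^sub>R rot (\<nu> p)"
       "Dk v = - (s * \<delta> p * \<alpha> p)" "D\<alpha> v = s * (K p + k p * \<delta> p)"
      using D(4)[OF v] unfolding structure_equations_def by blast
    have dk: "DK v = 2 * \<alpha> p * K p * s"
      by (simp add: DK_def x algebra_simps)
    have d1: "D1 v = - (s * \<alpha> p * l p / K p)" and d2: "D2 v = s * (K p + k p * \<delta> p - 2 * (\<alpha> p)\<^sup>2) / K p"
      using K0 by (simp_all add: D1_def D2_def dk x l_eq_\<delta> field_simps power2_eq_square)
    define a b where "a = k p / K p" and "b = \<alpha> p / K p"
    have "E v = (1 - a * k p - b * \<alpha> p) *\<^sub>R X + (a * \<alpha> p - b * k p) *\<^sub>R rot X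
       + (\<alpha> p * \<theta> + D1 v - b * (\<theta> * K p - s * l p)) *\<^sub>R \<nu> p
       + (s - k p * \<theta> + a * (\<theta> * K p - s * l p) + D2 v) *\<^sub>R rot (\<nu> p)"
      unfolding E_def x(1,2) a_def[symmetric] b_def[symmetric] by (simp add: rot_simps algebra_simps)
    moreover have "1 - a * k p - b * \<alpha> p = 0"
    proof -
      have "a * k p + b * \<alpha> p = ((k p)\<^sup>2 + (\<alpha> p)\<^sup>2) / K p"
        by (simp add: a_def b_def add_divide_distrib power2_eq_square)
      also have "\<dots> = K p / K p" by (simp only: K_def)
      finally have "a * k p + b * \<alpha> p = K p / K p" .
      then show ?thesis using K0 by simp
    qed
    moreover have "a * \<alpha> p - b * k p = 0" by (simp add: a_def b_def)
    moreover have "\<alpha> p * \<theta> + D1 v - b * (\<theta> * K p - s * l p) = 0"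
      using K0 by (simp add: d1 b_def field_simps)
    moreover have "s - k p * \<theta> + a * (\<theta> * K p - s * l p) + D2 v = 0"
    proof -
      have "s - k p * \<theta> + a * (\<theta> * K p - s * l p) + D2 v
        = s * (2 * K p + k p * \<delta> p - 2 * (\<alpha> p)\<^sup>2 - k p * l p) / K p"
        using K0 by (simp add: d2 a_def field_simps)
      also have "2 * K p + k p * \<delta> p - 2 * (\<alpha> p)\<^sup>2 - k p * l p = 0"
        by (simp add: K_def l_eq_\<delta> power2_eq_square algebra_simps)
      finally show ?thesis by simp
    qed
    ultimately show ?thesis by simp
  qed
  ultimately show ?thesis by blast
qed

lemma F_locally_constant:
  assumes p: "p \<in> R" and K0: "K p \<noteq> 0"
  obtains W where "open W" "p \<in> W" "\<And>q. q \<in> \<Sigma> \<inter> W \<Longrightarrow> q \<in> R \<and> F q = F p"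
proof -
  obtain A where A: "open A" "p \<in> A" "\<And>q. q \<in> R \<inter> A \<Longrightarrow> K q \<noteq> 0"
    by (rule nonzero_neighbourhood[OF continuous_on_K p K0]) blast
  show ?thesis
    by (rule locally_constant[OF p A(1,2), of F]) (use A(3) F_derivative that in auto)
qed

text \<open>Along \<open>J\<nu>\<close> the logarithmic derivatives of \<open>K\<close> and
  \<open>\<delta>\<close> are \<open>2 \<alpha>\<close> and \<open>2 n \<alpha>\<close>; the
  directions in \<open>\<xi>'\<close> and \<open>V\<close> leave both fixed.\<close>

lemma ratio_locally_constant:
  assumes p: "p \<in> R" and \<delta>0: "\<delta> p \<noteq> 0"
  obtains W where "open W" "p \<in> W"
    "\<And>q. q \<in> \<Sigma> \<inter> W \<Longrightarrow> q \<in> R \<and> \<delta> q \<noteq> 0 \<and> K q ^ CARD('n) / \<delta> q = K p ^ CARD('n) / \<delta> p"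
proof -
  obtain A where A: "open A" "p \<in> A" "\<And>q. q \<in> R \<inter> A \<Longrightarrow> \<delta> q \<noteq> 0"
    by (rule nonzero_neighbourhood[OF continuous_on_\<delta> p \<delta>0]) blast
  obtain m where m: "CARD('n) = Suc m" using n2 by (cases "CARD('n)") auto
  have *: "\<exists>E. ((\<lambda>p. K p ^ CARD('n) / \<delta> p) has_derivative E) (at p within \<Sigma>) \<and> (\<forall>v\<in>tangent_space \<Sigma> p. E v = 0)"
    if p: "p \<in> R \<inter> A" for p
  proof -
    have pR: "p \<in> R" and d0: "\<delta> p \<noteq> 0" using p A(3) by auto
    obtain D\<nu> Dk D\<alpha> where D: "(k has_derivative Dk) (at p within \<Sigma>)"
      "(\<alpha> has_derivative D\<alpha>) (at p within \<Sigma>)"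
      "\<And>v. v \<in> tangent_space \<Sigma> p \<Longrightarrow> \<exists>s. Dk v = - (s * \<delta> p * \<alpha> p) \<and> D\<alpha> v = s * (K p + k p * \<delta> p)"
      by (rule derivatives[OF pR]) (unfold structure_equations_def, blast)
    define DK where "DK v = 2 * k p * Dk v + 2 * \<alpha> p * D\<alpha> v" for v
    have DK: "(K has_derivative DK) (at p within \<Sigma>)" unfolding DK_def by (rule K_derivative[OF D(1,2)])
    define E where "E v = ((real (Suc m) * DK v * K p ^ m) * \<delta> p - K p ^ Suc m * (0 - 2 * real CARD('n) * Dk v)) / (\<delta> p * \<delta> p)" for v
    have dp: "((\<lambda>p. K p ^ Suc m) has_derivative (\<lambda>v. real (Suc m) * DK v * K p ^ m)) (at p within \<Sigma>)"
      using has_derivative_power[OF DK, of "Suc m"] by simp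
    have "((\<lambda>p. K p ^ CARD('n) / \<delta> p) has_derivative E) (at p within \<Sigma>)"
      unfolding E_def[abs_def] m[symmetric]
      unfolding m
      using d0 unfolding \<delta>_def[abs_def] m
      by (intro has_derivative_divide' dp has_derivative_diff has_derivative_const has_derivative_mult_right D)
    moreover have "E v = 0" if v: "v \<in> tangent_space \<Sigma> p" for v
    proof -
      obtain s where x: "Dk v = - (s * \<delta> p * \<alpha> p)" "D\<alpha> v = s * (K p + k p * \<delta> p)" using D(3)[OF v] by blast
      have dk: "DK v = 2 * \<alpha> p * K p * s" by (simp add: DK_def x algebra_simps)
      show ?thesis by (simp add: E_def dk x m algebra_simps)
    qed
    ultimately show ?thesis by blast
  qed
  obtain W where W: "open W" "p \<in> W" "\<And>q. q \<in> \<Sigma> \<inter> W \<Longrightarrow> q \<in> R \<and> K q ^ CARD('n) / \<delta> q = K p ^ CARD('n) / \<delta> p"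
    by (rule locally_constant[OF p A(1,2) *], assumption) (rule that)
  show ?thesis by (rule that[of "W \<inter> A"]) (use W A in auto)
qed

section \<open>Compactness forces \<open>\<delta> = 0\<close>\<close>

lemma characteristic_curve:
  assumes p: "p \<in> R"
  obtains \<gamma> \<epsilon> where "\<epsilon> > 0" "\<gamma> ` {-\<epsilon><..<\<epsilon>} \<subseteq> \<Sigma>" "\<gamma> 0 = p"
    "((\<lambda>t. k (\<gamma> t)) has_real_derivative - (\<delta> p * \<alpha> p)) (at (0::real))"
    "((\<lambda>t. \<alpha> (\<gamma> t)) has_real_derivative K p + k p * \<delta> p) (at 0)"
    "\<And>w. ((\<lambda>t. snd (\<gamma> t) + rot w \<bullet> fst (\<gamma> t)) has_real_derivative (w - fst p) \<bullet> \<nu> p) (at 0)"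
proof -
  obtain D\<nu> Dk D\<alpha> where D: "(\<nu> has_derivative D\<nu>) (at p within \<Sigma>)" "(k has_derivative Dk) (at p within \<Sigma>)"
    "(\<alpha> has_derivative D\<alpha>) (at p within \<Sigma>)"
    "\<And>v. v \<in> tangent_space \<Sigma> p \<Longrightarrow> structure_equations p v (D\<nu> v) (Dk v) (D\<alpha> v)"
    by (rule derivatives[OF p]) (rule that)
  define v where "v = hor p (rot (\<nu> p))"
  have v: "v \<in> tangent_space \<Sigma> p" by (simp add: tangent_iff[OF p] v_def)
  obtain X s where x: "X \<bullet> rot (\<nu> p) = 0" "rot (\<nu> p) = X + s *\<^sub>R rot (\<nu> p)"
     "Dk v = - (s * \<delta> p * \<alpha> p)" "D\<alpha> v = s * (K p + k p * \<delta> p)"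
    using D(4)[OF v] by (auto simp: v_def structure_equations_def)
  have "s = 1"
    using arg_cong[OF x(2), of "\<lambda>x. x \<bullet> rot (\<nu> p)"] x(1) \<nu>_unit[OF p] by (simp add: inner_simps)
  \<comment> \<open>A curve with this velocity at 0 is enough, as it serves only to test first
    derivatives at \<open>p\<close>.\<close>
  obtain \<gamma> \<epsilon> where g: "\<epsilon> > 0" "\<gamma> ` {-\<epsilon><..<\<epsilon>} \<subseteq> \<Sigma>" "\<gamma> 0 = p" "(\<gamma> has_vector_derivative v) (at 0)"
    using v unfolding tangent_space_def by blast
  note chain = has_vector_derivative_along_curve[OF g(1,2,4), unfolded g(3)]
  show ?thesis
  proof (rule that[OF g(1-3)])
    show "((\<lambda>t. k (\<gamma> t)) has_real_derivative - (\<delta> p * \<alpha> p)) (at 0)"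
      using chain[OF D(2)] by (simp add: x(3) \<open>s = 1\<close> has_real_derivative_iff_has_vector_derivative)
    show "((\<lambda>t. \<alpha> (\<gamma> t)) has_real_derivative K p + k p * \<delta> p) (at 0)"
      using chain[OF D(3)] by (simp add: x(4) \<open>s = 1\<close> has_real_derivative_iff_has_vector_derivative)
    fix w
    \<comment> \<open>The \<open>t\<close>-coordinate after left translation by
      \<open>(- w, 0)\<close>.\<close>
    have "((\<lambda>q. snd q + rot w \<bullet> fst q) has_derivative (\<lambda>v. snd v + rot w \<bullet> fst v)) (at p within \<Sigma>)"
      by (intro has_derivative_add has_derivative_snd has_derivative_inner_right has_derivative_fst has_derivative_ident)
    from chain[OF this] show "((\<lambda>t. snd (\<gamma> t) + rot w \<bullet> fst (\<gamma> t)) has_real_derivative (w - fst p) \<bullet> \<nu> p) (at 0)"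
      by (simp add: v_def hor_def inner_diff_left has_real_derivative_iff_has_vector_derivative)
  qed
qed

text \<open>If \<open>\<alpha>\<close> vanished, the vertical direction would be tangent everywhere,
  also at the highest point.\<close>

lemma not_all_\<alpha>_zero:
  assumes "\<Sigma> = R"
  shows "\<exists>p\<in>R. \<alpha> p \<noteq> 0"
proof (rule ccontr)
  assume 0: "\<not> ?thesis"
  have "continuous_on \<Sigma> (\<lambda>p. snd p)" by (intro continuous_intros)
  then obtain p where p: "p \<in> \<Sigma>" "\<And>q. q \<in> \<Sigma> \<Longrightarrow> snd q \<le> snd p"
    using continuous_attains_sup[OF compact_\<Sigma> nonempty_\<Sigma>] by blast
  have "(0, 1) \<in> tangent_space \<Sigma> p" using 0 p(1) assms by (auto simp: tangent_iff)
  moreover have "(snd has_derivative snd) (at p within \<Sigma>)" by (intro has_derivative_snd has_derivative_ident)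
  ultimately have "snd (0 :: (complex, 'n) vec, 1 :: real) = 0" using p(2) derivative_within_max_tangent by blast
  then show False by simp
qed


lemma constant_on_\<Sigma>:
  assumes "\<And>p. p \<in> \<Sigma> \<Longrightarrow> \<exists>W. open W \<and> p \<in> W \<and> (\<forall>q\<in>\<Sigma> \<inter> W. h q = h p)" "p \<in> \<Sigma>" "q \<in> \<Sigma>"
  shows "h p = h q"
proof (rule connected_local_const[OF conn assms(2,3)], rule ballI)
  fix a assume "a \<in> \<Sigma>"
  then obtain W where "open W" "a \<in> W" "\<forall>q\<in>\<Sigma> \<inter> W. h q = h a" using assms(1) by blast
  then show "eventually (\<lambda>b. h a = h b) (at a within \<Sigma>)"
    unfolding eventually_at_topological by (intro exI[of _ W]) auto
qed

text \<open>The level set \<open>M\<close> is open by local constancy. It is closed because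
  \<open>\<alpha>\<close> is bounded on it: \<open>\<delta>\<close> grows at most linearly in
  \<open>K\<close>, while \<open>K^n\<close> with n at least 2 grows faster. So it is everything,
  and it consists of regular points.\<close>

lemma ratio_constant:
  assumes p0: "p0 \<in> R" and \<delta>0: "\<delta> p0 \<noteq> 0"
  defines "a \<equiv> K p0 ^ CARD('n) / \<delta> p0"
  shows "\<Sigma> = R" and "p \<in> R \<Longrightarrow> \<delta> p \<noteq> 0" and "p \<in> R \<Longrightarrow> K p ^ CARD('n) = a * \<delta> p"
proof -
  let ?n = "CARD('n)"
  \<comment> \<open>Stated without division by \<open>\<delta>\<close>, the condition is closed in
    \<open>R\<close>. Then \<open>nz\<close> recovers \<open>\<delta> \<noteq> 0\<close>: otherwise
    \<open>K = 0\<close>, so \<open>k = 0\<close> and \<open>\<delta> = c > 0\<close>.\<close>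
  define M where "M = {p \<in> R. K p ^ ?n - a * \<delta> p = 0}"
  have nz: "\<delta> p \<noteq> 0" if "p \<in> M" for p
  proof
    assume d: "\<delta> p = 0"
    then have "K p = 0" using that n2 by (simp add: M_def)
    then have "k p = 0" by (simp add: K_def sum_power2_eq_zero_iff)
    then show False using d c_pos by (simp add: \<delta>_def)
  qed
  have bound: "\<bar>\<alpha> p\<bar> \<le> 1 + (1 + \<bar>a\<bar> * (c + 2 * ?n))" if p: "p \<in> M" for p
  proof -
    have K\<alpha>: "(\<alpha> p)\<^sup>2 \<le> K p" "(k p)\<^sup>2 \<le> K p" by (simp_all add: K_def)
    then have K0: "K p \<ge> 0" by (meson order_trans zero_le_power2)
    have "K p \<le> 1 + \<bar>a\<bar> * (c + 2 * ?n)"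
    proof (cases "K p \<le> 1")
      case True
      then show ?thesis using c_pos by (smt (verit) mult_nonneg_nonneg of_nat_0_le_iff)
    next
      case False
      have "\<bar>k p\<bar> \<le> K p"
      proof -
        have "K p * 1 \<le> K p * K p" using False by (intro mult_left_mono) auto
        then have "(k p)\<^sup>2 \<le> (K p)\<^sup>2" using K\<alpha>(2) by (simp add: power2_eq_square)
        then show ?thesis using K0 by (simp flip: abs_le_square_iff)
      qed
      then have "\<bar>\<delta> p\<bar> \<le> c + 2 * ?n * K p"
      proof -
        assume "\<bar>k p\<bar> \<le> K p"
        then have "2 * real ?n * \<bar>k p\<bar> \<le> 2 * real ?n * K p" by (intro mult_left_mono) auto
        moreover have "\<bar>\<delta> p\<bar> \<le> c + 2 * real ?n * \<bar>k p\<bar>"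
          unfolding \<delta>_def using abs_triangle_ineq4[of c "2 * real ?n * k p"] c_pos by (simp add: abs_mult)
        ultimately show ?thesis by linarith
      qed
      also have "\<dots> \<le> (c + 2 * ?n) * K p" using False c_pos by (simp add: algebra_simps)
      finally have d: "\<bar>\<delta> p\<bar> \<le> (c + 2 * ?n) * K p" .
      \<comment> \<open>As \<open>K p > 1\<close>, the square is at most \<open>K p ^ n\<close>;
        dividing the linear bound by \<open>K p\<close> then bounds \<open>K p\<close>
        itself.\<close>
      have "K p * K p = K p ^ 2" by (simp add: power2_eq_square)
      also have "\<dots> \<le> K p ^ ?n" using False n2 by (intro power_increasing) auto
      also have "\<dots> \<le> \<bar>a * \<delta> p\<bar>" using p by (simp add: M_def)
      also have "\<dots> \<le> \<bar>a\<bar> * (c + 2 * ?n) * K p"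
        using mult_left_mono[OF d, of "\<bar>a\<bar>"] by (simp add: abs_mult mult.assoc)
      finally have "K p \<le> \<bar>a\<bar> * (c + 2 * ?n)" using False by (simp add: mult_le_cancel_right)
      then show ?thesis by simp
    qed
    moreover have "\<bar>\<alpha> p\<bar> \<le> 1 + K p"
    proof -
      have "0 \<le> (\<bar>\<alpha> p\<bar> - 1)\<^sup>2" by simp
      then show ?thesis using K\<alpha>(1) K0 by (simp add: power2_diff)
    qed
    ultimately show ?thesis by simp
  qed
  have "M = \<Sigma>"
  proof (rule clopen_eq_\<Sigma>)
    show "M \<subseteq> \<Sigma>" using R_subset by (auto simp: M_def)
    have "p0 \<in> M" using p0 \<delta>0 by (simp add: M_def a_def)
    then show "M \<noteq> {}" by blast
    have "continuous_on R (\<lambda>p. K p ^ ?n - a * \<delta> p)"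
      by (intro continuous_intros continuous_on_K continuous_on_\<delta>)
    then have "closedin (top_of_set R) M"
      using continuous_closedin_preimage_constant unfolding M_def by blast
    then show "closed M" using closed_if_alpha_bounded bound by blast
    fix p assume p: "p \<in> M"
    then have "p \<in> R" by (simp add: M_def)
    then obtain W where W: "open W" "p \<in> W"
      "\<And>q. q \<in> \<Sigma> \<inter> W \<Longrightarrow> q \<in> R \<and> \<delta> q \<noteq> 0 \<and> K q ^ ?n / \<delta> q = K p ^ ?n / \<delta> p"
      using ratio_locally_constant[OF _ nz[OF p]] by blast
    have "K p ^ ?n / \<delta> p = a" using p nz[OF p] by (simp add: M_def field_simps)
    then have "\<Sigma> \<inter> W \<subseteq> M" using W(3) by (fastforce simp: M_def field_simps)
    then show "\<exists>W. open W \<and> p \<in> W \<and> \<Sigma> \<inter> W \<subseteq> M" using W by blast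
  qed
  moreover have "M \<subseteq> R" by (auto simp: M_def)
  ultimately have MR: "M = R" and \<Sigma>R: "\<Sigma> = R" using R_subset by auto
  show "\<Sigma> = R" by (rule \<Sigma>R)
  show "\<delta> p \<noteq> 0" "K p ^ ?n = a * \<delta> p" if "p \<in> R"
  proof -
    have "p \<in> M" using that MR by simp
    then show "\<delta> p \<noteq> 0" "K p ^ ?n = a * \<delta> p" using nz by (simp_all add: M_def)
  qed
qed

text \<open>The sign of the constant \<open>a = K^n / \<delta>\<close> decides. If
  \<open>a = 0\<close>, then \<open>\<alpha>\<close> vanishes identically. If \<open>a < 0\<close>,
  then \<open>\<delta> < 0\<close>, so \<open>k > 0\<close> and \<open>\<tau>\<close> strictly
  increases along characteristic curves. If \<open>a > 0\<close>, the sign of \<open>k\<close> is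
  open and \<open>G\<close> takes the place of \<open>\<tau>\<close>.\<close>

lemma \<delta>_zero:
  assumes p0: "p0 \<in> R"
  shows "\<delta> p0 = 0"
proof (rule ccontr)
  assume \<delta>0: "\<delta> p0 \<noteq> 0"
  let ?n = "CARD('n)"
  define a where "a = K p0 ^ ?n / \<delta> p0"
  note all = ratio_constant[OF p0 \<delta>0, folded a_def]
  have a0: "a \<noteq> 0"
  proof
    assume "a = 0"
    then have "\<alpha> p = 0" if "p \<in> R" for p
      using all(3)[OF that] n2 by (simp add: K_def sum_power2_eq_zero_iff)
    then show False using not_all_\<alpha>_zero[OF all(1)] by blast
  qed
  have K0: "K p > 0" if "p \<in> R" for p
  proof -
    have "K p \<noteq> 0" using all(2,3)[OF that] a0 n2 by (auto simp: zero_power)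
    moreover have "K p \<ge> 0" by (simp add: K_def)
    ultimately show ?thesis by linarith
  qed
  define F0 where "F0 = F p0"
  have F: "F p = F0" if "p \<in> R" for p
    unfolding F0_def
  proof (rule constant_on_\<Sigma>)
    show "\<exists>W. open W \<and> p \<in> W \<and> (\<forall>q\<in>\<Sigma> \<inter> W. F q = F p)" if "p \<in> \<Sigma>" for p
      using F_locally_constant[of p] K0[of p] that all(1) by (metis less_irrefl)
  qed (use that p0 R_subset in auto)
  \<comment> \<open>The height after moving the common centre onto the \<open>t\<close>-axis; its
    rate along characteristic curves is \<open>k / K\<close> by \<open>F\<nu>\<close>.\<close>
  define \<tau> where "\<tau> p = snd p + rot F0 \<bullet> fst p" for p
  have F\<nu>: "(F0 - fst p) \<bullet> \<nu> p = k p / K p" if "p \<in> R" for p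
    using F[OF that] \<nu>_unit[OF that] by (auto simp: F_def inner_simps)
  show False
  proof (cases "a < 0")
    case True
    have neg: "\<delta> p < 0" if "p \<in> R" for p
      using all(3)[OF that] True K0[OF that] by (smt (verit) mult_nonpos_nonneg zero_less_power)
    have "continuous_on \<Sigma> \<tau>" unfolding \<tau>_def by (intro continuous_intros)
    then obtain p where p: "p \<in> \<Sigma>" "\<And>q. q \<in> \<Sigma> \<Longrightarrow> \<tau> q \<le> \<tau> p"
      using continuous_attains_sup[OF compact_\<Sigma> nonempty_\<Sigma>] by blast
    then have pR: "p \<in> R" using all(1) by simp
    obtain \<gamma> \<epsilon> where g: "\<epsilon> > 0" "\<gamma> ` {-\<epsilon><..<\<epsilon>} \<subseteq> \<Sigma>" "\<gamma> 0 = p"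
      "\<And>w. ((\<lambda>t. snd (\<gamma> t) + rot w \<bullet> fst (\<gamma> t)) has_real_derivative (w - fst p) \<bullet> \<nu> p) (at (0::real))"
      by (rule characteristic_curve[OF pR]) blast
    have "((\<lambda>t. \<tau> (\<gamma> t)) has_real_derivative k p / K p) (at 0)"
      using g(4)[of F0] by (simp add: F\<nu>[OF pR] \<tau>_def)
    then have "k p / K p = 0" using derivative_along_curve_max[OF g(1,2), of \<tau>] p(2) g(3) by blast
    then have "k p = 0" using K0[OF pR] by simp
    then show False using neg[OF pR] c_pos by (simp add: \<delta>_def)
  next
    case False
    then have a: "a > 0" using a0 by simp
    have pos: "\<delta> p > 0" if "p \<in> R" for p
      using all(3)[OF that] a K0[OF that] by (smt (verit) mult_pos_neg zero_less_power all(2)[OF that])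
    have k\<delta>: "k p + \<delta> p > 0" "k p + 2 * real ?n * \<delta> p > 0" if "p \<in> R" for p
    proof -
      have n: "real ?n \<ge> 2" using n2 by simp
      have "2 * real ?n * (k p + \<delta> p) = c + (2 * real ?n - 1) * \<delta> p" by (simp add: \<delta>_def algebra_simps)
      moreover have "(2 * real ?n - 1) * \<delta> p > 0" using pos[OF that] n by (intro mult_pos_pos) auto
      ultimately have "2 * real ?n * (k p + \<delta> p) > 0" using c_pos by linarith
      then show "k p + \<delta> p > 0" using n by (simp add: zero_less_mult_iff)
      moreover have "(2 * real ?n - 1) * \<delta> p \<ge> 0" using \<open>(2 * real ?n - 1) * \<delta> p > 0\<close> by simp
      ultimately show "k p + 2 * real ?n * \<delta> p > 0" by (simp add: algebra_simps)
    qed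
    \<comment> \<open>\<open>K0\<close> is the value that \<open>K\<close> would take where
      \<open>k = 0\<close>: there \<open>\<delta> = c\<close>, so \<open>K^n = a c\<close>.
      Accordingly \<open>h0\<close> is the value of \<open>1 / (sqrt K * (k + \<delta>))\<close>
      there.\<close>
    define K0 where "K0 = root ?n (a * c)"
    have K0n: "K0 ^ ?n = a * c" and K0pos: "K0 > 0"
      using a c_pos n2 by (simp_all add: K0_def)
    define h0 where "h0 = 1 / (sqrt K0 * c)"
    \<comment> \<open>As \<open>k\<close> grows, \<open>\<delta>\<close> and
      \<open>k + \<delta>\<close> decrease, and so does \<open>K\<close> since
      \<open>K^n = a \<delta>\<close>. Hence \<open>1 / (sqrt K * (k + \<delta>))\<close> increases
      with \<open>k\<close> and crosses \<open>h0\<close> at \<open>k = 0\<close>.\<close>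
    have sgn: "k p * (1 / (sqrt (K p) * (k p + \<delta> p)) - h0) > 0" if pR: "p \<in> R" and k0: "k p \<noteq> 0" for p
    proof -
      have d: "k p + \<delta> p = c - (2 * real ?n - 1) * k p" "\<delta> p = c - 2 * real ?n * k p"
        by (simp_all add: \<delta>_def algebra_simps)
      have n: "real ?n \<ge> 2" using n2 by simp
      have Kp: "K p > 0" by (rule \<open>\<And>p. p \<in> R \<Longrightarrow> K p > 0\<close>[OF pR])
      show ?thesis
      proof (cases "k p > 0")
        case True
        have "\<delta> p < c" using True n unfolding d(2) by simp
        then have "K p ^ ?n < K0 ^ ?n" using all(3)[OF pR] K0n a by simp
        then have "K p < K0" using K0pos power_less_imp_less_base by fastforce
        moreover have "k p + \<delta> p < c" using True n unfolding d(1) by simp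
        ultimately have "sqrt (K p) * (k p + \<delta> p) < sqrt K0 * c"
          using k\<delta>(1)[OF pR] Kp by (intro mult_strict_mono) auto
        moreover have "sqrt (K p) * (k p + \<delta> p) > 0" using k\<delta>(1)[OF pR] Kp by simp
        ultimately have "h0 < 1 / (sqrt (K p) * (k p + \<delta> p))" unfolding h0_def by (simp add: frac_less2)
        then show ?thesis using True by simp
      next
        case False
        then have k: "k p < 0" using k0 by simp
        have "\<delta> p > c" using k n unfolding d(2) by (simp add: mult_pos_neg)
        then have "K0 ^ ?n < K p ^ ?n" using all(3)[OF pR] K0n a by simp
        then have "K0 < K p" using Kp power_less_imp_less_base by fastforce
        moreover have "k p + \<delta> p > c" using k n unfolding d(1) by (simp add: mult_pos_neg)
        ultimately have "sqrt K0 * c < sqrt (K p) * (k p + \<delta> p)"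
          using K0pos c_pos by (intro mult_strict_mono) auto
        moreover have "sqrt K0 * c > 0" using K0pos c_pos by simp
        ultimately have "1 / (sqrt (K p) * (k p + \<delta> p)) < h0" unfolding h0_def by (simp add: frac_less2)
        then show ?thesis using k by (simp add: mult_neg_neg)
      qed
    qed
    \<comment> \<open>With \<open>r = 1 / sqrt K\<close> and \<open>m = r / (k + \<delta>)\<close>, both \<open>\<tau> - \<alpha> r h0\<close> and \<open>\<tau> - \<alpha> r m\<close> increase weakly along
      characteristic curves; the first stalls only where \<open>k = 0\<close>, the second only where \<open>\<alpha> = 0\<close>.\<close>
    define G where "G p = 2 * \<tau> p - \<alpha> p / sqrt (K p) * (1 / (sqrt (K p) * (k p + \<delta> p)) + h0)" for p
    have "continuous_on R G"
      unfolding G_def \<tau>_def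
      using \<open>\<And>p. p \<in> R \<Longrightarrow> K p > 0\<close> k\<delta>(1)
      by (intro continuous_intros continuous_on_k continuous_on_\<alpha> continuous_on_K continuous_on_\<delta>) fastforce+
    then have "continuous_on \<Sigma> G" using all(1) by simp
    then obtain p where p: "p \<in> \<Sigma>" "\<And>q. q \<in> \<Sigma> \<Longrightarrow> G q \<le> G p"
      using continuous_attains_sup[OF compact_\<Sigma> nonempty_\<Sigma>] by blast
    then have pR: "p \<in> R" using all(1) by simp
    have Kp: "K p > 0" by (rule \<open>\<And>p. p \<in> R \<Longrightarrow> K p > 0\<close>[OF pR])
    obtain \<gamma> \<epsilon> where g: "\<epsilon> > 0" "\<gamma> ` {-\<epsilon><..<\<epsilon>} \<subseteq> \<Sigma>" "\<gamma> 0 = p"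
      "((\<lambda>t. k (\<gamma> t)) has_real_derivative - (\<delta> p * \<alpha> p)) (at (0::real))"
      "((\<lambda>t. \<alpha> (\<gamma> t)) has_real_derivative K p + k p * \<delta> p) (at 0)"
      "\<And>w. ((\<lambda>t. snd (\<gamma> t) + rot w \<bullet> fst (\<gamma> t)) has_real_derivative (w - fst p) \<bullet> \<nu> p) (at 0)"
      by (rule characteristic_curve[OF pR]) (rule that)
    define w where "w = sqrt (K p)"
    have w: "w > 0" "w * w = K p" using Kp by (simp_all add: w_def)
    define m where "m = k p + \<delta> p"
    have m: "m > 0" using k\<delta>(1)[OF pR] by (simp add: m_def)
    have d\<tau>: "((\<lambda>t. \<tau> (\<gamma> t)) has_real_derivative k p / K p) (at 0)"
      using g(6)[of F0] by (simp add: F\<nu>[OF pR] \<tau>_def)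
    have dK: "((\<lambda>t. K (\<gamma> t)) has_real_derivative 2 * \<alpha> p * K p) (at 0)"
    proof -
      have "((\<lambda>t. K (\<gamma> t)) has_real_derivative (2 * k p * - (\<delta> p * \<alpha> p) + 2 * \<alpha> p * (K p + k p * \<delta> p))) (at 0)"
        unfolding K_def[of "\<gamma> _"]
        by (rule derivative_eq_intros g(4,5) refl)+ (simp add: g(3))
      then show ?thesis by (simp add: algebra_simps)
    qed
    have dw: "((\<lambda>t. sqrt (K (\<gamma> t))) has_real_derivative \<alpha> p * w) (at 0)"
    proof -
      have "((\<lambda>t. sqrt (K (\<gamma> t))) has_real_derivative (inverse (sqrt (K (\<gamma> 0))) / 2) * (2 * \<alpha> p * K p)) (at 0)"
        by (rule DERIV_chain2[OF DERIV_real_sqrt dK]) (simp add: g(3) Kp)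
      moreover have eq: "(inverse (sqrt (K (\<gamma> 0))) / 2) * (2 * \<alpha> p * K p) = \<alpha> p * w"
        unfolding g(3) w_def[symmetric] using w(1) by (simp add: w(2)[symmetric] field_simps)
      ultimately show ?thesis unfolding eq by blast
    qed
    have dm: "((\<lambda>t. k (\<gamma> t) + \<delta> (\<gamma> t)) has_real_derivative (2 * real ?n - 1) * (\<delta> p * \<alpha> p)) (at 0)"
      unfolding \<delta>_def[of "\<gamma> _"]
      by (rule derivative_eq_intros g(4) refl)+ (simp add: algebra_simps)
    have d1: "((\<lambda>t. \<alpha> (\<gamma> t) / sqrt (K (\<gamma> t))) has_real_derivative k p * m / w) (at 0)"
    proof -
      have "((\<lambda>t. \<alpha> (\<gamma> t) / sqrt (K (\<gamma> t))) has_real_derivative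
          ((K p + k p * \<delta> p) * sqrt (K (\<gamma> 0)) - \<alpha> (\<gamma> 0) * (\<alpha> p * w)) / (sqrt (K (\<gamma> 0)) * sqrt (K (\<gamma> 0)))) (at 0)"
        by (rule DERIV_divide[OF g(5) dw]) (use Kp in \<open>simp add: g(3)\<close>)
      moreover have "((K p + k p * \<delta> p) * w - \<alpha> p * (\<alpha> p * w)) / (w * w) = k p * m / w"
      proof -
        have "K p + k p * \<delta> p - \<alpha> p * \<alpha> p = k p * m" by (simp add: K_def m_def power2_eq_square algebra_simps)
        then have "(K p + k p * \<delta> p) * w - \<alpha> p * (\<alpha> p * w) = k p * m * w" by (metis left_diff_distrib mult.assoc)
        then show ?thesis using w(1) by simp
      qed
      ultimately show ?thesis by (simp add: g(3) flip: w_def)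
    qed
    have d2: "((\<lambda>t. 1 / (sqrt (K (\<gamma> t)) * (k (\<gamma> t) + \<delta> (\<gamma> t))) + h0) has_real_derivative
        - (\<alpha> p * (k p + 2 * real ?n * \<delta> p) / (w * (m * m)))) (at 0)"
    proof -
      have "((\<lambda>t. sqrt (K (\<gamma> t)) * (k (\<gamma> t) + \<delta> (\<gamma> t))) has_real_derivative
          (\<alpha> p * w) * m + (2 * real ?n - 1) * (\<delta> p * \<alpha> p) * w) (at 0)"
        using DERIV_mult[OF dw dm] by (simp add: g(3) m_def flip: w_def)
      then have 1: "((\<lambda>t. 1 / (sqrt (K (\<gamma> t)) * (k (\<gamma> t) + \<delta> (\<gamma> t)))) has_real_derivative
          (0 * (w * m) - 1 * ((\<alpha> p * w) * m + (2 * real ?n - 1) * (\<delta> p * \<alpha> p) * w)) / ((w * m) * (w * m))) (at 0)"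
        using DERIV_divide[OF DERIV_const, of _ _ 0 UNIV 1] w(1) m by (fastforce simp: g(3) m_def simp flip: w_def)
      have "(\<alpha> p * w) * m + (2 * real ?n - 1) * (\<delta> p * \<alpha> p) * w = w * (\<alpha> p * (k p + 2 * real ?n * \<delta> p))"
        by (simp add: m_def algebra_simps)
      then have "(0 * (w * m) - 1 * ((\<alpha> p * w) * m + (2 * real ?n - 1) * (\<delta> p * \<alpha> p) * w)) / ((w * m) * (w * m))
         = - (\<alpha> p * (k p + 2 * real ?n * \<delta> p) / (w * (m * m)))"
        using w(1) m by (simp add: field_simps)
      with DERIV_add[OF 1 DERIV_const[of h0]] show ?thesis by simp
    qed
    define D where "D = 2 * (k p / K p) - (k p * m / w * (1 / (w * m) + h0)
        + - (\<alpha> p * (k p + 2 * real ?n * \<delta> p) / (w * (m * m))) * (\<alpha> p / w))"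
    have dG: "((\<lambda>t. G (\<gamma> t)) has_real_derivative D) (at 0)"
      unfolding G_def D_def
      using DERIV_diff[OF DERIV_cmult[OF d\<tau>, of 2] DERIV_mult[OF d1 d2]]
      by (simp add: g(3) flip: w_def m_def)
    then have "D = 0" using derivative_along_curve_max[OF g(1,2), of G] p(2) g(3) by blast
    \<comment> \<open>The term \<open>k m / w * (1 / (w m))\<close> equals \<open>k / K\<close> and
      cancels one of the two copies from \<open>2 \<tau>\<close>; the other combines with
      \<open>h0\<close>.\<close>
    moreover have "D = (k p * (1 / (w * m) - h0)) * (m / w) + (\<alpha> p)\<^sup>2 * ((k p + 2 * real ?n * \<delta> p) / (K p * (m * m)))"
      unfolding D_def w(2)[symmetric] using w(1) m by (simp add: field_simps power2_eq_square)
    moreover have "(k p * (1 / (w * m) - h0)) * (m / w) \<ge> 0"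
      using sgn[OF pR] w(1) m by (cases "k p = 0") (auto simp flip: w_def m_def)
    moreover have "(k p + 2 * real ?n * \<delta> p) / (K p * (m * m)) > 0"
      using k\<delta>(2)[OF pR] Kp m by simp
    ultimately have "(k p * (1 / (w * m) - h0)) * (m / w) = 0" "\<alpha> p = 0"
      by (smt (verit, best) mult_nonneg_nonneg zero_le_power2, smt (verit, best) mult_pos_pos zero_less_power2)
    moreover have "k p \<noteq> 0" using Kp \<open>\<alpha> p = 0\<close> by (auto simp: K_def)
    ultimately show False using sgn[OF pR] w(1) m by (simp flip: w_def m_def)
  qed
qed

end

section \<open>The Pansu sphere\<close>

text \<open>The profile with parameter \<open>a = \<alpha>\<close> in place of
  \<open>norm z\<close>. Being odd in \<open>a\<close>, it describes both graphs by one
  formula.\<close>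

definition pansu_height :: "real \<Rightarrow> real \<Rightarrow> real" where
  "pansu_height lam a = 1 / (2 * lam\<^sup>2) * (a * lam / (a\<^sup>2 + lam\<^sup>2) + arctan (a / lam))"

text \<open>Here \<open>z = - n / (lam - \<i> a)\<close>: the point with \<open>\<nu> = n\<close>,
  \<open>\<alpha> = a\<close> and \<open>k = lam\<close> whose centre
  \<open>z + \<nu> / \<kappa>\<close> is the origin.\<close>

definition pansu_point :: "real \<Rightarrow> (complex, 'n::finite) vec \<Rightarrow> real \<Rightarrow> 'n heis" where
  "pansu_point lam n a = (- ((lam / (lam\<^sup>2 + a\<^sup>2)) *\<^sub>R n + (a / (lam\<^sup>2 + a\<^sup>2)) *\<^sub>R rot n), pansu_height lam a)"

text \<open>This is what the structure equations for \<open>\<delta> = 0\<close> require: along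
  characteristic curves the height relative to the centre changes at the rate \<open>k / K\<close>
  and \<open>\<alpha>\<close> at the rate \<open>K\<close>, with quotient
  \<open>lam / K^2\<close>.\<close>

lemma pansu_height_derivative:
  assumes "lam > 0"
  shows "(pansu_height lam has_real_derivative lam / (a\<^sup>2 + lam\<^sup>2)\<^sup>2) (at a)"
proof -
  have p: "a\<^sup>2 + lam\<^sup>2 > 0" using assms by (simp add: add_nonneg_pos)
  have 1: "((\<lambda>a. a * lam / (a\<^sup>2 + lam\<^sup>2)) has_real_derivative (lam * (a\<^sup>2 + lam\<^sup>2) - a * lam * (2 * a)) / ((a\<^sup>2 + lam\<^sup>2) * (a\<^sup>2 + lam\<^sup>2))) (at a)"
    using p by (auto intro!: derivative_eq_intros)
  have "((\<lambda>a. arctan (a / lam)) has_real_derivative inverse (1 + (a / lam)\<^sup>2) * (1 / lam)) (at a)"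
    using assms by (intro DERIV_chain2[OF DERIV_arctan]) (auto intro!: derivative_eq_intros)
  moreover have "inverse (1 + (a / lam)\<^sup>2) * (1 / lam) = lam / (a\<^sup>2 + lam\<^sup>2)"
  proof -
    have "1 + (a / lam)\<^sup>2 = (a\<^sup>2 + lam\<^sup>2) / lam\<^sup>2" using assms by (simp add: field_simps)
    then show ?thesis using assms by (simp add: power2_eq_square)
  qed
  ultimately have 2: "((\<lambda>a. arctan (a / lam)) has_real_derivative lam / (a\<^sup>2 + lam\<^sup>2)) (at a)" by metis
  define m where "m = a\<^sup>2 + lam\<^sup>2"
  have m0: "m > 0" using p by (simp add: m_def)
  have "(lam * m - a * lam * (2 * a)) / (m * m) + lam / m = 2 * lam ^ 3 / m\<^sup>2"
  proof -
    have "(lam * m - a * lam * (2 * a)) / (m * m) + lam / m = (2 * lam * m - 2 * lam * a\<^sup>2) / m\<^sup>2"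
      using m0 by (simp add: field_simps power2_eq_square)
    also have "2 * lam * m - 2 * lam * a\<^sup>2 = 2 * lam ^ 3"
      by (simp add: m_def power2_eq_square power3_eq_cube algebra_simps)
    finally show ?thesis .
  qed
  then have "1 / (2 * lam\<^sup>2) * ((lam * m - a * lam * (2 * a)) / (m * m) + lam / m) = lam / m\<^sup>2"
    using assms by (simp add: power2_eq_square power3_eq_cube)
  with DERIV_cmult[OF DERIV_add[OF 1 2], of "1 / (2 * lam\<^sup>2)"] show ?thesis
    unfolding pansu_height_def[abs_def] m_def by metis
qed

lemma pansu_height_minus: "pansu_height lam (- a) = - pansu_height lam a"
  by (simp add: pansu_height_def arctan_minus algebra_simps)

text \<open>\<open>lam * norm z\<close> is the cosine of \<open>arctan (a / lam)\<close>, which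
  turns the arccosine into the arctangent.\<close>

lemma pansu_profile_eq_height:
  assumes "lam > 0" "a \<ge> 0" "norm z = 1 / sqrt (lam\<^sup>2 + a\<^sup>2)"
  shows "pansu_profile lam z = pansu_height lam a"
proof -
  define m where "m = lam\<^sup>2 + a\<^sup>2"
  have m: "m > 0" using assms(1) by (simp add: m_def add_pos_nonneg)
  have "1 - lam\<^sup>2 * (norm z)\<^sup>2 = a\<^sup>2 / m"
    using m unfolding assms(3) m_def[symmetric] by (simp add: power_divide field_simps) (simp add: m_def)
  then have "lam * norm z * sqrt (1 - lam\<^sup>2 * (norm z)\<^sup>2) = a * lam / (a\<^sup>2 + lam\<^sup>2)"
    using assms(2) m unfolding assms(3) m_def[symmetric]
    by (simp add: real_sqrt_divide m_def[symmetric] add.commute[of "a\<^sup>2"])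
  moreover have "arccos (lam * norm z) = arctan (a / lam)"
  proof -
    have "sqrt (1 + (a / lam)\<^sup>2) = sqrt m / lam"
    proof -
      have "1 + (a / lam)\<^sup>2 = m / lam\<^sup>2" using assms(1) by (simp add: m_def field_simps)
      then show ?thesis using assms(1) by (simp add: real_sqrt_divide)
    qed
    then have "cos (arctan (a / lam)) = lam * norm z"
      using assms(1) by (simp add: cos_arctan assms(3) m_def)
    moreover have "0 \<le> arctan (a / lam)" using assms by (simp add: zero_le_arctan_iff)
    moreover have "arctan (a / lam) \<le> pi" using arctan_ubound[of "a / lam"] pi_gt_zero by linarith
    ultimately show ?thesis using arccos_cos by metis
  qed
  ultimately show ?thesis by (simp add: pansu_profile_def pansu_height_def)
qed

lemma norm_pansu_point:
  assumes "lam > 0" "norm n = 1"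
  shows "norm (fst (pansu_point lam n a)) = 1 / sqrt (lam\<^sup>2 + a\<^sup>2)"
proof -
  define m where "m = lam\<^sup>2 + a\<^sup>2"
  have m: "m > 0" using assms(1) by (simp add: m_def add_pos_nonneg)
  have nn: "n \<bullet> n = 1" using assms(2) by (simp add: dot_square_norm)
  have "fst (pansu_point lam n a) \<bullet> fst (pansu_point lam n a) = (lam / m) * (lam / m) + (a / m) * (a / m)"
    unfolding pansu_point_def m_def[symmetric] by (simp add: inner_simps nn)
  also have "\<dots> = m / (m * m)" by (simp add: m_def power2_eq_square add_divide_distrib)
  also have "\<dots> = 1 / m" using m by simp
  finally show ?thesis by (simp add: norm_eq_sqrt_inner real_sqrt_divide m_def)
qed

lemma pansu_point_in_sphere:
  assumes "lam > 0" "norm n = 1"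
  shows "pansu_point lam n a \<in> pansu_sphere lam"
proof -
  note N = norm_pansu_point[OF assms, of a]
  have le: "1 / sqrt (lam\<^sup>2 + a\<^sup>2) \<le> 1 / lam"
  proof -
    have "lam \<le> sqrt (lam\<^sup>2 + a\<^sup>2)" by (rule real_le_rsqrt) simp
    then show ?thesis using assms(1) by (simp add: frac_le)
  qed
  have "snd (pansu_point lam n a) = pansu_profile lam (fst (pansu_point lam n a)) \<or>
     snd (pansu_point lam n a) = - pansu_profile lam (fst (pansu_point lam n a))"
  proof (cases "a \<ge> 0")
    case True
    then show ?thesis using pansu_profile_eq_height[OF assms(1) True N] by (simp add: pansu_point_def)
  next
    case False
    have "pansu_profile lam (fst (pansu_point lam n a)) = pansu_height lam (- a)"
      by (rule pansu_profile_eq_height[OF assms(1)]) (use False N in auto)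
    then show ?thesis by (simp add: pansu_point_def pansu_height_minus)
  qed
  then show ?thesis using N le unfolding pansu_sphere_def by (auto simp: case_prod_beta)
qed

text \<open>The poles need their own case: they are the limits of \<open>pansu_point\<close> as
  \<open>a\<close> tends to plus or minus infinity.\<close>

lemma pansu_sphere_cases:
  fixes x :: "'n::finite heis"
  assumes "lam > 0" "x \<in> pansu_sphere lam"
  obtains (point) n a where "norm n = 1" "x = pansu_point lam n a"
    | (pole) s where "s = 1 \<or> s = -1" "x = (0, s * (pi / (4 * lam\<^sup>2)))"
proof (cases "fst x = 0")
  case True
  have "pansu_profile lam (0 :: (complex, 'n) vec) = pi / (4 * lam\<^sup>2)"
    by (simp add: pansu_profile_def)
  then have "x = (0, 1 * (pi / (4 * lam\<^sup>2))) \<or> x = (0, (-1) * (pi / (4 * lam\<^sup>2)))"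
    using assms(2) True unfolding pansu_sphere_def by (auto simp: prod_eq_iff)
  then show ?thesis using pole by blast
next
  case False
  define r where "r = norm (fst x)"
  have r: "r > 0" "r \<le> 1 / lam" using False assms(2) by (auto simp: r_def pansu_sphere_def)
  obtain s where s: "s = 1 \<or> s = (-1 :: real)" "snd x = s * pansu_profile lam (fst x)"
  proof -
    have "snd x = pansu_profile lam (fst x) \<or> snd x = - pansu_profile lam (fst x)"
      using assms(2) by (auto simp: pansu_sphere_def)
    then show ?thesis using that[of 1] that[of "-1"] by auto
  qed
  \<comment> \<open>Solves \<open>r = 1 / sqrt (lam^2 + b^2)\<close>, the radius found in
    \<open>norm_pansu_point\<close>.\<close>
  define b where "b = sqrt (1 / r\<^sup>2 - lam\<^sup>2)"
  have "lam\<^sup>2 \<le> 1 / r\<^sup>2"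
  proof -
    have "lam \<le> 1 / r" using r assms(1) by (simp add: field_simps)
    then have "lam\<^sup>2 \<le> (1 / r)\<^sup>2" using assms(1) by (intro power_mono) auto
    then show ?thesis by (simp add: power_divide)
  qed
  then have b: "b \<ge> 0" "lam\<^sup>2 + b\<^sup>2 = 1 / r\<^sup>2" by (simp_all add: b_def)
  have rb: "r = 1 / sqrt (lam\<^sup>2 + b\<^sup>2)" using r(1) by (simp add: b(2) real_sqrt_divide)
  define a where "a = s * b"
  have a2: "lam\<^sup>2 + a\<^sup>2 = 1 / r\<^sup>2" using s(1) b(2) by (auto simp: a_def)
  have ht: "snd x = pansu_height lam a"
    using s pansu_profile_eq_height[OF assms(1) b(1) rb[unfolded r_def]]
    by (auto simp: a_def pansu_height_minus)
  \<comment> \<open>Solves \<open>z = - n / (lam - \<i> a)\<close> for \<open>n\<close>.\<close>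
  define n where "n = a *\<^sub>R rot (fst x) - lam *\<^sub>R fst x"
  have "n \<bullet> n = (lam\<^sup>2 + a\<^sup>2) * (fst x \<bullet> fst x)"
    by (simp add: n_def inner_simps power2_eq_square algebra_simps)
  also have "\<dots> = 1" unfolding a2 using r(1) by (simp add: r_def dot_square_norm)
  finally have n: "norm n = 1" by (simp add: norm_eq_sqrt_inner)
  have "fst (pansu_point lam n a) = fst x"
  proof -
    define m where "m = lam\<^sup>2 + a\<^sup>2"
    have m: "m > 0" using assms(1) by (simp add: m_def add_pos_nonneg)
    have "fst (pansu_point lam n a) = ((lam / m) * lam + (a / m) * a) *\<^sub>R fst x"
      unfolding pansu_point_def m_def[symmetric] n_def by (simp add: rot_simps algebra_simps)
    also have "(lam / m) * lam + (a / m) * a = (lam\<^sup>2 + a\<^sup>2) / m" by (simp add: power2_eq_square add_divide_distrib)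
    also have "lam\<^sup>2 + a\<^sup>2 = m" by (simp add: m_def)
    finally show ?thesis using m by simp
  qed
  then have "x = pansu_point lam n a" using ht by (simp add: prod_eq_iff pansu_point_def)
  then show ?thesis using point n by blast
qed

lemma continuous_on_pansu_profile: "lam > 0 \<Longrightarrow> continuous_on {z. norm z \<le> 1 / lam} (pansu_profile lam)"
  unfolding pansu_profile_def[abs_def]
  by (intro continuous_intros) (auto simp: field_simps intro: order_trans[of _ 0])

lemma closed_pansu_sphere:
  assumes "lam > 0"
  shows "closed (pansu_sphere lam :: 'n::finite heis set)"
proof -
  let ?A = "{x :: 'n heis. norm (fst x) \<le> 1 / lam}"
  have A: "closed ?A" by (intro closed_Collect_le continuous_intros)
  have c: "continuous_on ?A (\<lambda>x. pansu_profile lam (fst x))"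
    by (rule continuous_on_compose2[OF continuous_on_pansu_profile[OF assms]]) (auto intro: continuous_intros)
  have 1: "closed {x \<in> ?A. snd x - pansu_profile lam (fst x) = 0}"
    by (intro continuous_closed_preimage_constant A continuous_intros c)
  have 2: "closed {x \<in> ?A. snd x + pansu_profile lam (fst x) = 0}"
    by (intro continuous_closed_preimage_constant A continuous_intros c)
  have "pansu_sphere lam = {x \<in> ?A. snd x - pansu_profile lam (fst x) = 0} \<union>
     {x \<in> ?A. snd x + pansu_profile lam (fst x) = 0}"
    unfolding pansu_sphere_def by (auto simp: add_eq_0_iff2)
  then show ?thesis using closed_Un[OF 1 2] by simp
qed

lemma pansu_points_tend_to_pole:
  fixes n :: "(complex, 'n::finite) vec"
  assumes "lam > 0" "norm n = 1" "s = 1 \<or> s = -1"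
  shows "(\<lambda>j. pansu_point lam n (s * real j)) \<longlonglongrightarrow> (0, s * (pi / (4 * lam\<^sup>2)))"
proof -
  have s2: "s\<^sup>2 = 1" using assms(3) by auto
  have "(\<lambda>j. fst (pansu_point lam n (s * real j))) \<longlonglongrightarrow> 0"
  proof (rule tendsto_norm_zero_cancel)
    have "(\<lambda>j. 1 / sqrt (lam\<^sup>2 + (real j)\<^sup>2)) \<longlonglongrightarrow> 0" by real_asymp
    then show "(\<lambda>j. norm (fst (pansu_point lam n (s * real j)))) \<longlonglongrightarrow> 0"
      by (simp add: norm_pansu_point[OF assms(1,2)] power_mult_distrib s2)
  qed
  moreover have "(\<lambda>j. snd (pansu_point lam n (s * real j))) \<longlonglongrightarrow> s * (pi / (4 * lam\<^sup>2))"
  proof -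
    have "(\<lambda>j. pansu_height lam (real j)) \<longlonglongrightarrow> pi / (4 * lam\<^sup>2)"
      unfolding pansu_height_def using assms(1) by real_asymp
    then have "(\<lambda>j. s * pansu_height lam (real j)) \<longlonglongrightarrow> s * (pi / (4 * lam\<^sup>2))" by (rule tendsto_mult_left)
    moreover have "snd (pansu_point lam n (s * real j)) = s * pansu_height lam (real j)" for j
      using assms(3) by (auto simp: pansu_point_def pansu_height_minus)
    ultimately show ?thesis by simp
  qed
  ultimately show ?thesis using tendsto_Pair by force
qed

section \<open>Congruence with the Pansu sphere\<close>

context umbilic_hypersurface
begin

definition lam :: real where "lam = c / (2 * real CARD('n))"

lemma lam_pos: "lam > 0"
  using c_pos n2 by (simp add: lam_def)

lemma k_eq_lam: "p \<in> R \<Longrightarrow> k p = lam"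
  using \<delta>_zero[of p] n2 by (simp add: \<delta>_def lam_def field_simps)

lemma K_eq: "p \<in> R \<Longrightarrow> K p = lam\<^sup>2 + (\<alpha> p)\<^sup>2"
  by (simp add: K_def k_eq_lam)

lemma K_pos: "p \<in> R \<Longrightarrow> K p > 0"
  using lam_pos by (simp add: K_eq add_pos_nonneg)

text \<open>The height of \<open>p\<close> after left translation by \<open>(- F p, 0)\<close>,
  minus the height that the sphere centred at the origin has at parameter
  \<open>\<alpha> p\<close>.\<close>

definition h :: "'n heis \<Rightarrow> real" where
  "h p = snd p + rot (F p) \<bullet> fst p - pansu_height lam (\<alpha> p)"

lemma continuous_on_h: "continuous_on R h"
proof -
  have "continuous_on UNIV (pansu_height lam)"
    using pansu_height_derivative[OF lam_pos] DERIV_isCont continuous_at_imp_continuous_on by blast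
  then have "continuous_on R (\<lambda>p. pansu_height lam (\<alpha> p))"
    by (rule continuous_on_compose2[OF _ continuous_on_\<alpha>]) simp
  moreover have "continuous_on R F" by (rule continuous_on_F) (use K_pos in force)+
  ultimately show ?thesis
    unfolding h_def by (intro continuous_intros bounded_linear.continuous_on[OF bounded_linear_rot])
qed

text \<open>The Heisenberg centre \<open>(F p, h p)\<close> of the Pansu sphere through a regular point \<open>p\<close>.\<close>
lemma center_locally_constant:
  assumes p: "p \<in> R"
  obtains W where "open W" "p \<in> W" "\<And>q. q \<in> \<Sigma> \<inter> W \<Longrightarrow> q \<in> R \<and> F q = F p \<and> h q = h p"
proof -
  obtain A where A: "open A" "p \<in> A" "\<And>q. q \<in> \<Sigma> \<inter> A \<Longrightarrow> q \<in> R \<and> F q = F p"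
    by (rule F_locally_constant[OF p]) (use K_pos[OF p] in auto)
  \<comment> \<open>\<open>F q\<close> is replaced by the constant \<open>F p\<close>, so that no
    derivative of \<open>F\<close> enters; near \<open>p\<close> on \<open>\<Sigma>\<close> this
    agrees with \<open>h\<close>.\<close>
  define g where "g q = snd q + rot (F p) \<bullet> fst q - pansu_height lam (\<alpha> q)" for q
  have *: "\<exists>E. (g has_derivative E) (at q within \<Sigma>) \<and> (\<forall>v\<in>tangent_space \<Sigma> q. E v = 0)" if q: "q \<in> R \<inter> A" for q
  proof -
    have qR: "q \<in> R" and Fq: "F p = F q" using q A(3)[of q] R_subset by auto
    obtain D\<nu> Dk D\<alpha> where D: "(\<nu> has_derivative D\<nu>) (at q within \<Sigma>)" "(k has_derivative Dk) (at q within \<Sigma>)"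
      "(\<alpha> has_derivative D\<alpha>) (at q within \<Sigma>)"
      "\<And>v. v \<in> tangent_space \<Sigma> q \<Longrightarrow> structure_equations q v (D\<nu> v) (Dk v) (D\<alpha> v)"
      by (rule derivatives[OF qR]) (rule that)
    define r where "r = lam / ((\<alpha> q)\<^sup>2 + lam\<^sup>2)\<^sup>2"
    have "(pansu_height lam has_derivative (\<lambda>x. r * x)) (at (\<alpha> q))"
      using pansu_height_derivative[OF lam_pos, of "\<alpha> q"] unfolding has_field_derivative_def r_def .
    from has_derivative_compose[OF D(3) this]
    have "((\<lambda>q. pansu_height lam (\<alpha> q)) has_derivative (\<lambda>v. r * D\<alpha> v)) (at q within \<Sigma>)" .
    then have "(g has_derivative (\<lambda>v. snd v + rot (F p) \<bullet> fst v - r * D\<alpha> v)) (at q within \<Sigma>)"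
      unfolding g_def
      by (intro has_derivative_diff has_derivative_add has_derivative_snd has_derivative_fst
          has_derivative_inner_right has_derivative_ident)
    moreover have "snd v + rot (F p) \<bullet> fst v - r * D\<alpha> v = 0" if v: "v \<in> tangent_space \<Sigma> q" for v
    proof -
      obtain X s \<theta> where x: "\<theta> = contact_form q v" "X \<bullet> \<nu> q = 0" "X \<bullet> rot (\<nu> q) = 0"
         "fst v = X + ((\<alpha> q * \<theta>) *\<^sub>R \<nu> q + (s - k q * \<theta>) *\<^sub>R rot (\<nu> q))"
         "D\<alpha> v = s * (K q + k q * \<delta> q)"
        using D(4)[OF v] unfolding structure_equations_def by blast
      have K: "K q \<noteq> 0" using K_pos[OF qR] by simp
      have inn: "\<nu> q \<bullet> fst v = \<alpha> q * \<theta>" "rot (\<nu> q) \<bullet> fst v = s - k q * \<theta>"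
        using x(2,3) \<nu>_unit[OF qR] unfolding x(4) by (simp_all add: inner_simps inner_commute)
      have "snd v + rot (F p) \<bullet> fst v = \<theta> + (rot (F q) - rot (fst q)) \<bullet> fst v"
        by (simp add: x(1) contact_form_eq Fq inner_diff_left)
      also have "rot (F q) - rot (fst q) = (k q / K q) *\<^sub>R rot (\<nu> q) - (\<alpha> q / K q) *\<^sub>R \<nu> q"
        by (simp add: F_def rot_simps)
      also have "\<theta> + \<dots> \<bullet> fst v = \<theta> + ((k q / K q) * (s - k q * \<theta>) - (\<alpha> q / K q) * (\<alpha> q * \<theta>))"
        by (simp add: inner_diff_left inn)
      also have "\<dots> = k q * s / K q + \<theta> * (K q - ((k q)\<^sup>2 + (\<alpha> q)\<^sup>2)) / K q"
        using K by (simp add: field_simps power2_eq_square)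
      also have "K q - ((k q)\<^sup>2 + (\<alpha> q)\<^sup>2) = 0" by (simp add: K_def)
      finally have 1: "snd v + rot (F p) \<bullet> fst v = lam * s / K q" using k_eq_lam[OF qR] by simp
      have "r * D\<alpha> v = lam / (K q)\<^sup>2 * (s * K q)"
        unfolding x(5) r_def by (simp add: \<delta>_zero[OF qR] K_eq[OF qR] add.commute)
      then show ?thesis unfolding 1 using K by (simp add: power2_eq_square)
    qed
    ultimately show ?thesis by blast
  qed
  obtain W where W: "open W" "p \<in> W" "\<And>q. q \<in> \<Sigma> \<inter> W \<Longrightarrow> q \<in> R \<and> g q = g p"
    by (rule locally_constant[OF p A(1,2) *], assumption) (rule that)
  have "h q = h p" if "q \<in> \<Sigma> \<inter> (W \<inter> A)" for q
    using W(3)[of q] A(3)[of q] that by (simp add: h_def g_def)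
  then show ?thesis using that[of "W \<inter> A"] W A by blast
qed

text \<open>On \<open>M\<close> the map \<open>(\<nu>, \<alpha>)\<close> is inverted by
  \<open>pansu_point\<close>. Its image is closed: a convergent image sequence has bounded
  \<open>\<alpha>\<close>, so the points themselves converge to a regular point of \<open>M\<close>.
  It is open by invariance of domain.\<close>

lemma sphere_part_surjective:
  fixes F0 :: "(complex, 'n) vec" and t0 :: real
  defines "M \<equiv> {p \<in> R. F p = F0 \<and> h p = t0}"
  defines "\<psi> \<equiv> \<lambda>x :: 'n heis. (fst x + F0, snd x + t0 - rot F0 \<bullet> (fst x + F0))"
  assumes ne: "M \<noteq> {}"
  shows "p \<in> M \<Longrightarrow> p = \<psi> (pansu_point lam (\<nu> p) (\<alpha> p))"
    and "norm n = 1 \<Longrightarrow> \<exists>p\<in>M. \<nu> p = n \<and> \<alpha> p = a"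
    and "p \<in> M \<Longrightarrow> \<exists>W. open W \<and> p \<in> W \<and> \<Sigma> \<inter> W \<subseteq> M"
proof -
  show param: "p = \<psi> (pansu_point lam (\<nu> p) (\<alpha> p))" if "p \<in> M" for p
  proof -
    have p: "p \<in> R" "F p = F0" "h p = t0" using that by (auto simp: M_def)
    have "fst (pansu_point lam (\<nu> p) (\<alpha> p)) = fst p - F0"
      unfolding p(2)[symmetric]
      by (simp add: pansu_point_def F_def k_eq_lam[OF p(1)] flip: K_eq[OF p(1)])
    moreover have "snd (pansu_point lam (\<nu> p) (\<alpha> p)) = snd p + rot F0 \<bullet> fst p - t0"
      using p(2,3) by (simp add: pansu_point_def h_def)
    ultimately show ?thesis by (simp add: \<psi>_def prod_eq_iff)
  qed
  show nbhd: "\<exists>W. open W \<and> p \<in> W \<and> \<Sigma> \<inter> W \<subseteq> M" if p: "p \<in> M" for p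
    by (rule center_locally_constant[of p]) (use p in \<open>auto simp: M_def\<close>)
  define E where "E = (\<lambda>p. (\<nu> p, \<alpha> p)) ` M"
  let ?S = "sphere (0 :: (complex, 'n) vec) 1 \<times> (UNIV :: real set)"
  have \<nu>1: "norm (\<nu> p) = 1" if "p \<in> R" for p using \<nu>_unit[OF that] by (simp add: norm_eq_sqrt_inner)
  have cont\<psi>: "continuous_on UNIV \<psi>" unfolding \<psi>_def by (intro continuous_intros)
  have contF: "continuous_on R F" by (rule continuous_on_F) (use K_pos in force)+
  have "closed E"
    unfolding closed_sequential_limits
  proof (intro allI impI)
    fix x z assume xz: "(\<forall>j. x j \<in> E) \<and> x \<longlonglongrightarrow> z"
    then have "\<forall>j. \<exists>p. p \<in> M \<and> x j = (\<nu> p, \<alpha> p)" unfolding E_def by blast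
    then obtain p where p: "\<And>j. p j \<in> M" "\<And>j. x j = (\<nu> (p j), \<alpha> (p j))" by metis
    have lim: "(\<lambda>j. \<nu> (p j)) \<longlonglongrightarrow> fst z" "(\<lambda>j. \<alpha> (p j)) \<longlonglongrightarrow> snd z"
      using tendsto_fst[of x z] tendsto_snd[of x z] xz p(2) by auto
    have "isCont (pansu_height lam) (snd z)" using pansu_height_derivative[OF lam_pos] DERIV_isCont by blast
    then have "(\<lambda>j. pansu_point lam (\<nu> (p j)) (\<alpha> (p j))) \<longlonglongrightarrow> pansu_point lam (fst z) (snd z)"
      unfolding pansu_point_def using lam_pos
      by (intro tendsto_intros lim bounded_linear.tendsto[OF bounded_linear_rot])
         (auto intro: isCont_tendsto_compose lim simp: add_pos_nonneg sum_power2_eq_zero_iff)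
    then have "(\<lambda>j. \<psi> (pansu_point lam (\<nu> (p j)) (\<alpha> (p j)))) \<longlonglongrightarrow> \<psi> (pansu_point lam (fst z) (snd z))"
      by (rule continuous_on_tendsto_compose[OF cont\<psi>]) simp_all
    then have limp: "p \<longlonglongrightarrow> \<psi> (pansu_point lam (fst z) (snd z))" (is "_ \<longlonglongrightarrow> ?p")
      using param[OF p(1)] by simp
    obtain B where B: "\<And>j. \<bar>\<alpha> (p j)\<bar> \<le> B"
      using convergent_imp_Bseq[OF convergentI[OF lim(2)]] by (auto simp: Bseq_def)
    define M' where "M' = {p \<in> M. \<bar>\<alpha> p\<bar> \<le> B}"
    have "closedin (top_of_set R) ((R \<inter> F -` {F0}) \<inter> (R \<inter> h -` {t0}) \<inter> (R \<inter> (\<lambda>p. \<bar>\<alpha> p\<bar>) -` {..B}))"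
      by (intro closedin_Int continuous_closedin_preimage contF continuous_on_h continuous_intros
          continuous_on_\<alpha> closed_singleton closed_atMost)
    moreover have "(R \<inter> F -` {F0}) \<inter> (R \<inter> h -` {t0}) \<inter> (R \<inter> (\<lambda>p. \<bar>\<alpha> p\<bar>) -` {..B}) = M'"
      by (auto simp: M'_def M_def)
    ultimately have "closed M'" by (intro closed_if_alpha_bounded[of _ B]) (auto simp: M'_def)
    moreover have "\<forall>j. p j \<in> M'" using p(1) B by (simp add: M'_def)
    ultimately have "?p \<in> M'" using limp closed_sequentially by blast
    then have pM: "?p \<in> M" and pR: "?p \<in> R" by (auto simp: M'_def M_def)
    have pjR: "\<forall>\<^sub>F j in sequentially. p j \<in> R" using p(1) by (auto simp: M_def)
    have "(\<lambda>j. \<nu> (p j)) \<longlonglongrightarrow> \<nu> ?p" "(\<lambda>j. \<alpha> (p j)) \<longlonglongrightarrow> \<alpha> ?p"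
      by (rule continuous_on_tendsto_compose[OF continuous_on_\<nu> limp pR pjR],
          rule continuous_on_tendsto_compose[OF continuous_on_\<alpha> limp pR pjR])
    then have "\<nu> ?p = fst z" "\<alpha> ?p = snd z" using lim LIMSEQ_unique by blast+
    then have "z = (\<nu> ?p, \<alpha> ?p)" by simp
    then show "z \<in> E" unfolding E_def using pM by (rule image_eqI)
  qed
  moreover have "E \<subseteq> ?S" using \<nu>1 by (auto simp: E_def M_def)
  ultimately have "closedin (top_of_set ?S) E" using closed_subset by blast
  moreover have "openin (top_of_set ?S) E"
    unfolding openin_subopen[of _ E]
  proof
    fix z assume "z \<in> E"
    then obtain p where p: "p \<in> M" "z = (\<nu> p, \<alpha> p)" unfolding E_def by blast
    then have pR: "p \<in> R" by (simp add: M_def)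
    obtain A where A: "open A" "p \<in> A" "\<Sigma> \<inter> A \<subseteq> M" using nbhd[OF p(1)] by blast
    obtain U f where U: "open U" "p \<in> U" "local_equation \<Sigma> U f (\<lambda>x. frechet_derivative f (at x))"
      by (rule oriented_equation[OF pR]) blast
    have UA: "open (U \<inter> A)" "U \<inter> A \<subseteq> U" using U(1) A(1) by auto
    have leq: "local_equation \<Sigma> (U \<inter> A) (\<lambda>x. 1 * f x) (\<lambda>x. frechet_derivative (\<lambda>x. 1 * f x) (at x))"
      by (rule local_equation_scaled(1)[OF U(3) _ UA]) simp
    have pS: "p \<in> \<Sigma>" "p \<in> U \<inter> A" using pR R_subset U(2) A(2) by auto
    obtain g :: "'n heis \<Rightarrow> 'n heis" and g' cc r b W where c: "\<Sigma> \<inter> W \<subseteq> g ` ball cc r" "cc \<bullet> b = 0" "0 < r"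
      "g cc = p" "open W" "p \<in> W"
      "\<And>y. y \<in> ball cc r \<Longrightarrow> g y \<in> \<Sigma> \<inter> (U \<inter> A)"
      "\<And>y. y \<in> ball cc r \<Longrightarrow> (g has_derivative g' y) (at y)"
      "\<And>y y'. y \<in> ball cc r \<Longrightarrow> y' \<in> ball cc r \<Longrightarrow> g y = g y' \<Longrightarrow> y \<bullet> b = y' \<bullet> b \<Longrightarrow> y = y'"
      by (rule hypersurface_retraction[OF leq pS]) (rule that)
    have gM: "g y \<in> M" if "y \<in> ball cc r" for y using c(7)[OF that] A(3) by blast
    have gR: "g y \<in> R" if "y \<in> ball cc r" for y using gM[OF that] by (simp add: M_def)
    \<comment> \<open>Invariance of domain needs equal dimensions, so the lost coordinate
      \<open>y \<bullet> b\<close> is stored in the length of the first component; length one gives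
      back points of \<open>E\<close>.\<close>
    define \<eta> where "\<eta> y = (exp (y \<bullet> b) *\<^sub>R \<nu> (g y), \<alpha> (g y))" for y
    have contg: "continuous_on (ball cc r) g"
      using c(8) by (meson continuous_at_imp_continuous_on has_derivative_continuous)
    have "continuous_on (ball cc r) \<eta>" unfolding \<eta>_def
      using gR by (intro continuous_intros continuous_on_compose2[OF continuous_on_\<nu> contg]
          continuous_on_compose2[OF continuous_on_\<alpha> contg]) auto
    moreover have "inj_on \<eta> (ball cc r)"
    proof (rule inj_onI)
      fix y y' assume y: "y \<in> ball cc r" "y' \<in> ball cc r" "\<eta> y = \<eta> y'"
      have n: "norm (fst (\<eta> y)) = exp (y \<bullet> b)" if "y \<in> ball cc r" for y
        using \<nu>1[OF gR[OF that]] by (simp add: \<eta>_def)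
      have yb: "y \<bullet> b = y' \<bullet> b" using n[OF y(1)] n[OF y(2)] y(3) by simp
      then have "\<nu> (g y) = \<nu> (g y')" "\<alpha> (g y) = \<alpha> (g y')" using y(3) by (simp_all add: \<eta>_def)
      then have "g y = g y'" using param[OF gM[OF y(1)]] param[OF gM[OF y(2)]] by simp
      then show "y = y'" using c(9) y yb by blast
    qed
    ultimately have op: "open (\<eta> ` ball cc r)" using invariance_of_domain open_ball by blast
    have "\<eta> cc = z" using p(2) c(2,4) by (simp add: \<eta>_def)
    then have "z \<in> \<eta> ` ball cc r" using c(3) by (metis centre_in_ball image_eqI)
    moreover have "?S \<inter> \<eta> ` ball cc r \<subseteq> E"
    proof
      fix x assume x: "x \<in> ?S \<inter> \<eta> ` ball cc r"
      then obtain y where y: "y \<in> ball cc r" "x = \<eta> y" by blast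
      have "exp (y \<bullet> b) = 1" using x y \<nu>1[OF gR[OF y(1)]] by (auto simp: \<eta>_def)
      then have "x = (\<nu> (g y), \<alpha> (g y))" using y(2) by (simp add: \<eta>_def)
      then show "x \<in> E" unfolding E_def using gM[OF y(1)] by blast
    qed
    moreover have "z \<in> ?S" using \<open>E \<subseteq> ?S\<close> \<open>z \<in> E\<close> by blast
    ultimately show "\<exists>T. openin (top_of_set ?S) T \<and> z \<in> T \<and> T \<subseteq> E"
      using op by (intro exI[of _ "?S \<inter> \<eta> ` ball cc r"]) (simp add: openin_open_Int)
  qed
  moreover have "connected ?S"
    by (intro connected_Times connected_UNIV) (use n2 in \<open>simp add: connected_sphere_eq\<close>)
  moreover have "E \<noteq> {}" using ne by (simp add: E_def)
  ultimately have "E = ?S" unfolding connected_clopen by blast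
  then show "\<exists>p\<in>M. \<nu> p = n \<and> \<alpha> p = a" if "norm n = 1"
  proof -
    have "(n, a) \<in> E" using that \<open>E = ?S\<close> by simp
    then show ?thesis unfolding E_def by blast
  qed
qed

end

text \<open>Between two such points the mean value theorem would produce a zero of
  \<open>T f\<close>. It applies near the poles: a singular point has no horizontal gradient, so
  \<open>T f\<close> is nonzero there.\<close>

lemma vertical_line_meets_once:
  fixes f :: "'n::finite heis \<Rightarrow> real"
  assumes leq: "local_equation S U f (\<lambda>x. frechet_derivative f (at x))"
    and box: "A \<times> B \<subseteq> U" "convex B" "\<And>q. q \<in> A \<times> B \<Longrightarrow> T f q \<noteq> 0"
    and pts: "(z, t1) \<in> S" "(z, t2) \<in> S" "z \<in> A" "t1 \<in> B" "t2 \<in> B"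
  shows "t1 = t2"
proof -
  have no: False if t: "(z, s1) \<in> S" "(z, s2) \<in> S" "s1 \<in> B" "s2 \<in> B" "s1 < s2" for s1 s2
  proof -
    have inB: "s \<in> B" if "s1 \<le> s" "s \<le> s2" for s
      using mem_is_interval_1_I[of B s1 s2 s] t(3,4) that box(2) is_interval_convex_1 by blast
    have zero: "f (z, s1) = 0" "f (z, s2) = 0"
      using leq t(1-4) box(1) pts(3) unfolding local_equation_def by blast+
    have d: "((\<lambda>s. f (z, s)) has_derivative (\<lambda>r. r * T f (z, s))) (at s within {s1..s2})"
      if s: "s1 \<le> s" "s \<le> s2" for s
    proof -
      have D: "(f has_derivative frechet_derivative f (at (z, s))) (at (z, s))"
        using leq box(1) pts(3) inB[OF s] unfolding local_equation_def by blast
      have "((\<lambda>s. (z, s)) has_derivative (\<lambda>r. (0, r))) (at s within {s1..s2})"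
        by (intro has_derivative_Pair has_derivative_const has_derivative_ident)
      from has_derivative_compose[OF this D]
      have "((\<lambda>s. f (z, s)) has_derivative (\<lambda>r. frechet_derivative f (at (z, s)) (0, r))) (at s within {s1..s2})" .
      moreover have "frechet_derivative f (at (z, s)) (0, r) = r * T f (z, s)" for r
        using linear_cmul[OF has_derivative_linear[OF D], of r "(0, 1)"] by (simp add: T_def)
      ultimately show ?thesis by simp
    qed
    obtain s where s: "s \<in> {s1<..<s2}" "f (z, s2) - f (z, s1) = (s2 - s1) * T f (z, s)"
      using mvt_simple[OF t(5) d] by auto
    then have "T f (z, s) = 0" using zero t(5) by simp
    moreover have "(z, s) \<in> A \<times> B" using pts(3) inB[of s] s(1) by simp
    ultimately show False using box(3) by blast
  qed
  show ?thesis using no[of t1 t2] no[of t2 t1] pts by (cases t1 t2 rule: linorder_cases) auto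
qed

section \<open>The surface is a single Pansu sphere\<close>

context umbilic_hypersurface
begin

theorem congruent_to_pansu_sphere: "\<exists>\<phi>\<in>rigid_motions. \<phi> ` \<Sigma> = pansu_sphere lam"
proof -
  obtain p0 where p0: "p0 \<in> R" using R_nonempty by blast
  define F0 where "F0 = F p0"
  define t0 where "t0 = h p0"
  define \<psi> where "\<psi> = (\<lambda>x :: 'n heis. (fst x + F0, snd x + t0 - rot F0 \<bullet> (fst x + F0)))"
  \<comment> \<open>The left translation that moves the centre \<open>(F0, t0)\<close> to the
    origin; \<open>\<psi>\<close> is its inverse.\<close>
  define \<phi> where "\<phi> = heis_mult (- F0, - t0)"
  have \<phi>: "\<phi> p = (fst p - F0, snd p - t0 + rot F0 \<bullet> fst p)" for p
    by (simp add: \<phi>_def heis_mult_def inner_vec_def inner_complex_def rot_nth algebra_simps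
        flip: sum_negf sum_subtractf)
  have \<phi>\<psi>: "\<phi> (\<psi> x) = x" and \<psi>\<phi>: "\<psi> (\<phi> x) = x" for x
    by (simp_all add: \<phi> \<psi>_def prod_eq_iff)
  define M where "M = {p \<in> R. F p = F0 \<and> h p = t0}"
  have "p0 \<in> M" using p0 by (simp add: M_def F0_def t0_def)
  then have "M \<noteq> {}" by blast
  note part = sphere_part_surjective[of F0 t0, folded M_def, OF this]
  have param: "p = \<psi> (pansu_point lam (\<nu> p) (\<alpha> p))" if "p \<in> M" for p
    unfolding \<psi>_def by (rule part(1)[OF that])
  define S0 where "S0 = \<psi> ` pansu_sphere lam"
  have cont\<psi>: "continuous_on UNIV \<psi>" unfolding \<psi>_def by (intro continuous_intros)
  have M_S0: "M \<subseteq> S0"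
  proof
    fix p assume p: "p \<in> M"
    then have "norm (\<nu> p) = 1" using \<nu>_unit[of p] by (simp add: M_def norm_eq_sqrt_inner)
    then have "pansu_point lam (\<nu> p) (\<alpha> p) \<in> pansu_sphere lam" by (rule pansu_point_in_sphere[OF lam_pos])
    then show "p \<in> S0" unfolding S0_def using param[OF p] by blast
  qed
  have point_M: "\<exists>p\<in>M. \<psi> (pansu_point lam n a) = p \<and> \<alpha> p = a" if "norm n = 1" for n a
    using part(2)[OF that, of a] param by metis
  obtain n0 :: "(complex, 'n) vec" where n0: "norm n0 = 1"
    using vector_choose_size[of 1] by (metis zero_le_one)
  have closed\<Sigma>: "closed \<Sigma>" using compact_\<Sigma> compact_imp_closed by blast
  have M_\<Sigma>: "M \<subseteq> \<Sigma>" using R_subset by (auto simp: M_def)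
  \<comment> \<open>This sequence has two uses: closedness of \<open>\<Sigma>\<close> puts its
    limit, the pole, into \<open>\<Sigma>\<close>, and the unbounded \<open>\<alpha>\<close> makes
    the pole singular.\<close>
  have pole_limit: "\<exists>x. (\<forall>j. x j \<in> M \<and> \<alpha> (x j) = s * real j) \<and> x \<longlonglongrightarrow> \<psi> (0, s * (pi / (4 * lam\<^sup>2)))"
    if s: "s = 1 \<or> s = -1" for s
  proof (intro exI conjI allI)
    let ?x = "\<lambda>j. \<psi> (pansu_point lam n0 (s * real j))"
    show "?x j \<in> M" "\<alpha> (?x j) = s * real j" for j using point_M[OF n0, of "s * real j"] by auto
    show "?x \<longlonglongrightarrow> \<psi> (0, s * (pi / (4 * lam\<^sup>2)))"
      by (rule continuous_on_tendsto_compose[OF cont\<psi> pansu_points_tend_to_pole[OF lam_pos n0 s]]) simp_all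
  qed
  have S0_\<Sigma>: "S0 \<subseteq> \<Sigma>"
  proof
    fix p assume "p \<in> S0"
    then obtain x where x: "x \<in> pansu_sphere lam" "p = \<psi> x" by (auto simp: S0_def)
    from lam_pos x(1) show "p \<in> \<Sigma>"
    proof (cases rule: pansu_sphere_cases)
      case (point n a)
      then show ?thesis using point_M[of n a] x(2) M_\<Sigma> by auto
    next
      case (pole s)
      obtain y where "\<forall>j. y j \<in> M \<and> \<alpha> (y j) = s * real j" "y \<longlonglongrightarrow> p"
        using pole_limit[OF pole(1)] unfolding x(2) pole(2) by blast
      then show ?thesis using closed\<Sigma> M_\<Sigma> closed_sequentially[of \<Sigma> y p] by blast
    qed
  qed
  have S0_eq: "S0 = \<phi> -` pansu_sphere lam"
    using \<phi>\<psi> \<psi>\<phi> unfolding S0_def by (metis (no_types, lifting) image_eqI image_iff subsetI subset_antisym vimageE vimageI2)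
  have "continuous_on UNIV \<phi>" unfolding \<phi>[abs_def] by (intro continuous_intros)
  then have "closed S0"
    unfolding S0_eq using closed_vimage closed_pansu_sphere[OF lam_pos] by blast
  moreover have "\<exists>W. open W \<and> p \<in> W \<and> \<Sigma> \<inter> W \<subseteq> S0" if p: "p \<in> S0" for p
  proof -
    obtain x where x: "x \<in> pansu_sphere lam" "p = \<psi> x" using p by (auto simp: S0_def)
    from lam_pos x(1) show ?thesis
    proof (cases rule: pansu_sphere_cases)
      case (point n a)
      then have "p \<in> M" using point_M[of n a] x(2) by auto
      then show ?thesis using part(3)[of p] M_S0 by blast
    next
      case (pole s)
      obtain y where y: "\<And>j. y j \<in> M" "\<And>j. \<alpha> (y j) = s * real j" "y \<longlonglongrightarrow> p"
        using pole_limit[OF pole(1)] unfolding x(2) pole(2) by blast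
      have p\<Sigma>: "p \<in> \<Sigma>" using p S0_\<Sigma> by blast
      have "p \<notin> R"
      proof
        assume pR: "p \<in> R"
        have "(\<lambda>j. \<alpha> (y j)) \<longlonglongrightarrow> \<alpha> p"
          by (rule continuous_on_tendsto_compose[OF continuous_on_\<alpha> y(3) pR]) (use y(1) in \<open>auto simp: M_def\<close>)
        then have "Bseq (\<lambda>j. \<alpha> (y j))" by (rule convergent_imp_Bseq[OF convergentI])
        then obtain B where B: "\<And>j. \<bar>\<alpha> (y j)\<bar> \<le> B" by (auto simp: Bseq_def)
        obtain j :: nat where "real j > B" using reals_Archimedean2 by blast
        moreover have "\<bar>\<alpha> (y j)\<bar> = real j" using pole(1) y(2) by auto
        ultimately show False using B[of j] by simp
      qed
      then have "hypersurface_at 2 \<Sigma> p" using hyp p\<Sigma> unfolding closed_embedded_hypersurface_def by blast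
      then obtain U f where U: "p \<in> U" "local_equation \<Sigma> U f (\<lambda>x. frechet_derivative f (at x))"
        by (rule hypersurface_at_local_equation) auto
      note leq = U(2)
      have opU: "open U" using leq unfolding local_equation_def by blast
      have "T f p \<noteq> 0"
        using regular_iff[OF leq, of p] hgrad_or_T_nonzero[OF leq U(1)] \<open>p \<notin> R\<close> p\<Sigma> U(1) by auto
      moreover have "open (U \<inter> T f -` (- {0}))"
        by (rule continuous_open_preimage[OF continuous_on_T_hgrad(1)[OF leq] opU]) auto
      ultimately obtain A B where AB: "open A" "open B" "p \<in> A \<times> B" "A \<times> B \<subseteq> U \<inter> T f -` (- {0})"
        using open_prod_elim[of "U \<inter> T f -` (- {0})" p] U(1) by blast
      have "snd p \<in> B" using AB(3) by (simp add: mem_Times_iff)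
      then obtain d where d: "d > 0" "ball (snd p) d \<subseteq> B" using AB(2) openE by blast
      have box: "A \<times> ball (snd p) d \<subseteq> U" "\<And>q. q \<in> A \<times> ball (snd p) d \<Longrightarrow> T f q \<noteq> 0"
        using AB(4) d(2) by auto
      \<comment> \<open>The cap of the sphere around this pole, as a graph over the
        \<open>z\<close>-coordinates.\<close>
      define \<sigma> where "\<sigma> w = \<psi> (w, s * pansu_profile lam w)" for w
      have \<sigma>0: "\<sigma> 0 = p" by (simp add: \<sigma>_def x(2) pole(2) pansu_profile_def)
      have ball: "ball (0 :: (complex, 'n) vec) (1 / lam) \<subseteq> {z. norm z \<le> 1 / lam}" by auto
      have prof: "continuous_on (ball (0 :: (complex, 'n) vec) (1 / lam)) (pansu_profile lam)"
        by (rule continuous_on_subset[OF continuous_on_pansu_profile[OF lam_pos] ball])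
      have cont\<sigma>: "continuous_on (ball 0 (1 / lam)) \<sigma>" unfolding \<sigma>_def
        by (rule continuous_on_compose2[OF cont\<psi>]) (intro continuous_intros prof, simp)
      have "open (ball 0 (1 / lam) \<inter> \<sigma> -` (A \<times> ball (snd p) d))"
        by (rule continuous_open_preimage[OF cont\<sigma> open_ball]) (intro open_Times AB(1) open_ball)
      moreover have "0 \<in> ball 0 (1 / lam) \<inter> \<sigma> -` (A \<times> ball (snd p) d)"
        using lam_pos AB(3) d(1) by (auto simp: \<sigma>0 mem_Times_iff)
      ultimately obtain r where r: "r > 0" "ball 0 r \<subseteq> ball 0 (1 / lam) \<inter> \<sigma> -` (A \<times> ball (snd p) d)"
        using openE by blast
      define W where "W = (A \<inter> ball F0 r) \<times> ball (snd p) d"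
      have "fst p = F0" by (simp add: x(2) pole(2) \<psi>_def)
      then have "p \<in> W" using AB(3) r(1) d(1) by (auto simp: W_def mem_Times_iff)
      moreover have "open W" unfolding W_def by (intro open_Times open_Int AB(1) open_ball)
      moreover have "\<Sigma> \<inter> W \<subseteq> S0"
      proof
        fix q assume q: "q \<in> \<Sigma> \<inter> W"
        define w where "w = fst q - F0"
        have "w \<in> ball 0 r" using q by (auto simp: W_def w_def dist_norm norm_minus_commute)
        then have w: "norm w < 1 / lam" "\<sigma> w \<in> A \<times> ball (snd p) d" using r(2) by auto
        have "(w, s * pansu_profile lam w) \<in> pansu_sphere lam"
          using w(1) pole(1) by (auto simp: pansu_sphere_def)
        then have \<sigma>S: "\<sigma> w \<in> S0" unfolding \<sigma>_def S0_def by (rule imageI)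
        have fs: "fst (\<sigma> w) = fst q" by (simp add: \<sigma>_def \<psi>_def w_def)
        \<comment> \<open>Both points lie on \<open>\<Sigma>\<close> and on one vertical line,
          inside the box where \<open>T f\<close> has no zero.\<close>
        have "snd q = snd (\<sigma> w)"
        proof (rule vertical_line_meets_once[OF leq box(1) convex_ball box(2)])
          show "(fst q, snd q) \<in> \<Sigma>" using q by simp
          show "(fst q, snd (\<sigma> w)) \<in> \<Sigma>" using \<sigma>S S0_\<Sigma> by (metis fs prod.collapse subsetD)
          show "fst q \<in> A" "snd q \<in> ball (snd p) d" using q by (auto simp: W_def)
          show "snd (\<sigma> w) \<in> ball (snd p) d" using w(2) by (auto simp: mem_Times_iff)
        qed
        then have "q = \<sigma> w" using fs by (simp add: prod_eq_iff)
        then show "q \<in> S0" using \<sigma>S by simp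
      qed
      ultimately show ?thesis by blast
    qed
  qed
  moreover have "S0 \<noteq> {}" using M_S0 \<open>M \<noteq> {}\<close> by blast
  ultimately have "S0 = \<Sigma>" by (intro clopen_eq_\<Sigma>[OF S0_\<Sigma>])
  then have "\<phi> ` \<Sigma> = (\<lambda>x. \<phi> (\<psi> x)) ` pansu_sphere lam" unfolding S0_def by blast
  then have "\<phi> ` \<Sigma> = pansu_sphere lam" by (simp add: \<phi>\<psi>)
  moreover have "\<phi> \<in> rigid_motions" unfolding \<phi>_def by (rule rigid_motions.translation)
  ultimately show ?thesis by blast
qed

end

theorem corollary4p5:
  fixes \<Sigma> :: "'n::finite heis set"
    and e :: "'n heis \<Rightarrow> 'n heis"
    and c :: real
  assumes "CARD('n) \<ge> 2"
    and "closed_embedded_hypersurface \<Sigma>"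
    and "connected \<Sigma>"
    and "characteristic_field \<Sigma> e"
    and "c > 0"
    and "\<forall>p\<in>regular_points \<Sigma>. has_p_mean_curvature \<Sigma> e p c"
    and "umbilic \<Sigma> e"
  shows "\<exists>\<phi>\<in>rigid_motions. \<exists>lam>0. \<phi> ` \<Sigma> = pansu_sphere lam"
proof -
  interpret umbilic_hypersurface \<Sigma> e c
    by unfold_locales (fact assms)+
  show ?thesis using congruent_to_pansu_sphere lam_pos by blast
qed

end
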